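(* Let $H,G$ be countable discrete groups, $L$ be a subgroup of $G$ and $p>1$ with $p\notin 2\mathbb Z\smallsetminus\{2\}$. Denote by $I$ the quotient $G/L$ and $W=\bigoplus_I H$. Assume that $G$ is Haagerup, $L$ is co-Haagerup in $G$ and $H$ has property $PL^p$. Then the permutational wreath product $H\wr_I G=W\rtimes G$ has property $PL^p$.
   Context: A countable discrete group has property $PL^p$ ($p\ge1$) if it admits a proper isometric affine action $\alpha$ on an $L^p$ space (proper: $\|\alpha(g)0\|\to+\infty$ as $g\to\infty$, i.e. $\{g:\|\alpha(g)0\|\le R\}$ is finite for all $R\ge0$). It is Haagerup if it admits a proper isometric affine action on a Hilbert space. A subgroup $L$ of $G$ is co-Haagerup in $G$ if there exists a proper $G$-invariant conditionally negative definite kernel on $G/L$ (a kernel $\psi$ on $G/L$ is proper if $\{i\in G/L:\psi(i,i_0)\le R\}$ is finite for every $i_0\in G/L$ and $R\ge0$). For a $G$-set $I$, $\bigoplus_I H$ is the group of finitely supported families $(h_i)_{i\in I}$ in $H$, and the permutational wreath product is $H\wr_I G=\left(\bigoplus_I H\right)\rtimes_\rho G$ where $\rho(g):(h_i)_{i\in I}\mapsto(h_{g^{-1}i})_{i\in I}$. It is regarded as a discrete group. *)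

theory Defs
  imports
    "HOL-Analysis.Analysis"
    "HOL-Algebra.Left_Coset"
    "HOL-Algebra.Product_Groups"
begin

section \<open>Normed spaces with an explicit carrier\<close>

text \<open>
  The carrier is explicit because the points of an \<open>L\<^sup>p\<close> space are classes of functions modulo
  almost everywhere equality with respect to a measure that is existentially quantified below,
  so they do not form a type.
\<close>

record ('k, 'v) normed_space =
  points :: "'v set"
  vzero :: "'v"
  vadd :: "'v \<Rightarrow> 'v \<Rightarrow> 'v"
  vscale :: "'k \<Rightarrow> 'v \<Rightarrow> 'v"
  vnorm :: "'v \<Rightarrow> real"

definition normed_space_of_type :: "'v::real_normed_vector itself \<Rightarrow> (real, 'v) normed_space" where
  "normed_space_of_type _ =
     \<lparr>points = UNIV, vzero = 0, vadd = (+), vscale = (*\<^sub>R), vnorm = norm\<rparr>"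


section \<open>\<open>L\<^sup>p\<close> spaces\<close>

definition Lp_functions :: "real \<Rightarrow> 'x measure \<Rightarrow> ('x \<Rightarrow> 'k::{real_normed_field, euclidean_space}) set" where
  "Lp_functions p M =
     {f \<in> borel_measurable M. integrable M (\<lambda>x. norm (f x) powr p)}"

definition AE_rel :: "real \<Rightarrow> 'x measure \<Rightarrow> (('x \<Rightarrow> 'k::{real_normed_field, euclidean_space}) \<times> ('x \<Rightarrow> 'k)) set" where
  "AE_rel p M = {(f, g). f \<in> Lp_functions p M \<and> g \<in> Lp_functions p M \<and> (AE x in M. f x = g x)}"

definition Lp_norm :: "real \<Rightarrow> 'x measure \<Rightarrow> ('x \<Rightarrow> 'k::{real_normed_field, euclidean_space}) \<Rightarrow> real" where
  "Lp_norm p M f = (LINT x|M. norm (f x) powr p) powr (1 / p)"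

text \<open>
  The type classes of the scalars \<open>'k\<close> admit exactly the two fields of real and of complex numbers.
  For the class operations see the lemmas below.
\<close>

definition Lp_space ::
    "real \<Rightarrow> 'x measure \<Rightarrow> ('k::{real_normed_field, euclidean_space}, ('x \<Rightarrow> 'k) set) normed_space" where
  "Lp_space p M =
     \<lparr>points = Lp_functions p M // AE_rel p M,
      vzero = AE_rel p M `` {\<lambda>_. 0},
      vadd = (\<lambda>A B. \<Union>f\<in>A. \<Union>g\<in>B. AE_rel p M `` {\<lambda>x. f x + g x}),
      vscale = (\<lambda>c A. \<Union>f\<in>A. AE_rel p M `` {\<lambda>x. c * f x}),
      vnorm = (\<lambda>A. the_elem (Lp_norm p M ` A))\<rparr>"

lemma equiv_AE_rel: "equiv (Lp_functions p M) (AE_rel p M)"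
proof (rule equivI)
  show "AE_rel p M \<subseteq> Lp_functions p M \<times> Lp_functions p M"
    by (auto simp: AE_rel_def)
  show "refl_on (Lp_functions p M) (AE_rel p M)"
    by (auto simp: refl_on_def AE_rel_def)
  show "sym (AE_rel p M)"
    by (auto simp: sym_def AE_rel_def eq_commute)
  show "trans (AE_rel p M)"
    unfolding trans_def AE_rel_def by auto
qed

lemma Lp_functions_zero: "(\<lambda>_. 0) \<in> Lp_functions p M"
  by (simp add: Lp_functions_def)

lemma Lp_functions_scale:
  fixes f :: "'x \<Rightarrow> 'k::{real_normed_field, euclidean_space}"
  assumes "f \<in> Lp_functions p M"
  shows "(\<lambda>x. c * f x) \<in> Lp_functions p M"
  using assms by (auto simp: Lp_functions_def norm_mult powr_mult)

lemma Lp_functions_add: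
  fixes f g :: "'x \<Rightarrow> 'k::{real_normed_field, euclidean_space}"
  assumes p: "p \<ge> 1" and f: "f \<in> Lp_functions p M" and g: "g \<in> Lp_functions p M"
  shows "(\<lambda>x. f x + g x) \<in> Lp_functions p M"
proof -
  have bd: "norm (f x + g x) powr p \<le> 2 powr p * (norm (f x) powr p + norm (g x) powr p)" for x
  proof -
    have "norm (f x + g x) \<le> 2 * max (norm (f x)) (norm (g x))"
      using norm_triangle_ineq[of "f x" "g x"] by linarith
    hence "norm (f x + g x) powr p \<le> (2 * max (norm (f x)) (norm (g x))) powr p"
      using p by (intro powr_mono2) auto
    also have "\<dots> = 2 powr p * max (norm (f x)) (norm (g x)) powr p"
      by (simp add: powr_mult)
    also have "\<dots> \<le> 2 powr p * (norm (f x) powr p + norm (g x) powr p)"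
      by (intro mult_left_mono) (auto simp: max_def)
    finally show ?thesis .
  qed
  have [measurable]: "f \<in> borel_measurable M" "g \<in> borel_measurable M"
    using f g by (auto simp: Lp_functions_def)
  have "integrable M (\<lambda>x. 2 powr p * (norm (f x) powr p + norm (g x) powr p))"
    using f g by (auto simp: Lp_functions_def)
  hence "integrable M (\<lambda>x. norm (f x + g x) powr p)"
    by (rule Bochner_Integration.integrable_bound) (use bd in auto)
  thus ?thesis by (simp add: Lp_functions_def)
qed

lemma Lp_space_add_class:
  fixes f g :: "'x \<Rightarrow> 'k::{real_normed_field, euclidean_space}"
  assumes p: "p \<ge> 1" and f: "f \<in> Lp_functions p M" and g: "g \<in> Lp_functions p M"
  shows "vadd (Lp_space p M) (AE_rel p M `` {f}) (AE_rel p M `` {g}) =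
         AE_rel p M `` {\<lambda>x. f x + g x}"
proof -
  have "congruent2 (AE_rel p M) (AE_rel p M) (\<lambda>f g. AE_rel p M `` {\<lambda>x. f x + g x :: 'k})"
  proof (rule congruent2I')
    fix f f' g g' :: "'x \<Rightarrow> 'k"
    assume "(f, f') \<in> AE_rel p M" "(g, g') \<in> AE_rel p M"
    hence "((\<lambda>x. f x + g x), (\<lambda>x. f' x + g' x)) \<in> AE_rel p M"
      using p by (auto simp: AE_rel_def intro!: Lp_functions_add)
    thus "AE_rel p M `` {\<lambda>x. f x + g x} = AE_rel p M `` {\<lambda>x. f' x + g' x}"
      by (rule equiv_class_eq[OF equiv_AE_rel])
  qed
  thus ?thesis
    using UN_equiv_class2[OF equiv_AE_rel equiv_AE_rel _ f g] by (simp add: Lp_space_def)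
qed

lemma Lp_space_scale_class:
  fixes f :: "'x \<Rightarrow> 'k::{real_normed_field, euclidean_space}"
  assumes f: "f \<in> Lp_functions p M"
  shows "vscale (Lp_space p M) c (AE_rel p M `` {f}) = AE_rel p M `` {\<lambda>x. c * f x}"
proof -
  have "congruent (AE_rel p M) (\<lambda>f. AE_rel p M `` {\<lambda>x. c * f x :: 'k})"
  proof (rule congruentI)
    fix f f' :: "'x \<Rightarrow> 'k"
    assume "(f, f') \<in> AE_rel p M"
    hence "((\<lambda>x. c * f x), (\<lambda>x. c * f' x)) \<in> AE_rel p M"
      by (auto simp: AE_rel_def intro!: Lp_functions_scale)
    thus "AE_rel p M `` {\<lambda>x. c * f x} = AE_rel p M `` {\<lambda>x. c * f' x}"
      by (rule equiv_class_eq[OF equiv_AE_rel])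
  qed
  thus ?thesis
    using UN_equiv_class[OF equiv_AE_rel _ f] by (simp add: Lp_space_def)
qed

lemma Lp_space_norm_class:
  fixes f :: "'x \<Rightarrow> 'k::{real_normed_field, euclidean_space}"
  assumes f: "f \<in> Lp_functions p M"
  shows "vnorm (Lp_space p M) (AE_rel p M `` {f}) = Lp_norm p M f"
proof -
  have "Lp_norm p M g = Lp_norm p M f" if "(f, g) \<in> AE_rel p M" for g
  proof -
    have [measurable]: "f \<in> borel_measurable M" "g \<in> borel_measurable M"
      and "AE x in M. f x = g x"
      using that by (auto simp: AE_rel_def Lp_functions_def)
    hence "(LINT x|M. norm (g x) powr p) = (LINT x|M. norm (f x) powr p)"
      by (intro integral_cong_AE) auto
    thus ?thesis by (simp add: Lp_norm_def)
  qed
  moreover have "(f, f) \<in> AE_rel p M"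
    using f by (simp add: AE_rel_def)
  ultimately have "Lp_norm p M ` (AE_rel p M `` {f}) = {Lp_norm p M f}"
    by (intro equalityI subsetI) (blast, metis ImageI empty_iff image_eqI insertE insertI1)
  thus ?thesis by (simp add: Lp_space_def)
qed


section \<open>Proper isometric affine actions\<close>

definition linear_isometry :: "('k, 'v) normed_space \<Rightarrow> ('v \<Rightarrow> 'v) \<Rightarrow> bool" where
  "linear_isometry V T \<longleftrightarrow>
     (\<forall>v\<in>points V. T v \<in> points V) \<and>
     (\<forall>u\<in>points V. \<forall>v\<in>points V. T (vadd V u v) = vadd V (T u) (T v)) \<and>
     (\<forall>c. \<forall>v\<in>points V. T (vscale V c v) = vscale V c (T v)) \<and>
     (\<forall>v\<in>points V. vnorm V (T v) = vnorm V v)"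

text \<open>Each \<open>\<alpha> g\<close> is automatically bijective, by the two action laws.\<close>

definition isometric_affine_action ::
    "('g, 'a) monoid_scheme \<Rightarrow> ('k, 'v) normed_space \<Rightarrow> ('g \<Rightarrow> 'v \<Rightarrow> 'v) \<Rightarrow> bool" where
  "isometric_affine_action G V \<alpha> \<longleftrightarrow>
     (\<forall>g\<in>carrier G. \<exists>T. \<exists>b\<in>points V. linear_isometry V T \<and>
        (\<forall>v\<in>points V. \<alpha> g v = vadd V (T v) b)) \<and>
     (\<forall>v\<in>points V. \<alpha> \<one>\<^bsub>G\<^esub> v = v) \<and>
     (\<forall>g\<in>carrier G. \<forall>h\<in>carrier G. \<forall>v\<in>points V. \<alpha> (g \<otimes>\<^bsub>G\<^esub> h) v = \<alpha> g (\<alpha> h v))"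

definition proper_action ::
    "('g, 'a) monoid_scheme \<Rightarrow> ('k, 'v) normed_space \<Rightarrow> ('g \<Rightarrow> 'v \<Rightarrow> 'v) \<Rightarrow> bool" where
  "proper_action G V \<alpha> \<longleftrightarrow>
     (\<forall>R\<ge>0. finite {g \<in> carrier G. vnorm V (\<alpha> g (vzero V)) \<le> R})"

text \<open>
  A formula cannot quantify over types, so the scalar field \<open>'k\<close> and the type \<open>'x\<close> underlying the
  measure space are passed as a parameter.
\<close>

definition property_PL ::
    "('x \<Rightarrow> 'k::{real_normed_field, euclidean_space}) itself \<Rightarrow> real \<Rightarrow> ('g, 'a) monoid_scheme \<Rightarrow> bool" where
  "property_PL _ p G \<longleftrightarrow>
     (\<exists>(M :: 'x measure) (\<alpha> :: 'g \<Rightarrow> ('x \<Rightarrow> 'k) set \<Rightarrow> ('x \<Rightarrow> 'k) set).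
        isometric_affine_action G (Lp_space p M) \<alpha> \<and> proper_action G (Lp_space p M) \<alpha>)"

text \<open>
  Here the parameter is the Hilbert space. A complex Hilbert space is covered through its
  underlying real one, on which complex affine isometries are real affine isometries.
\<close>

definition haagerup ::
    "'v::{real_inner, complete_space} itself \<Rightarrow> ('g, 'a) monoid_scheme \<Rightarrow> bool" where
  "haagerup V G \<longleftrightarrow>
     (\<exists>\<alpha> :: 'g \<Rightarrow> 'v \<Rightarrow> 'v.
        isometric_affine_action G (normed_space_of_type V) \<alpha> \<and>
        proper_action G (normed_space_of_type V) \<alpha>)"


section \<open>Co-Haagerup subgroups\<close>

definition cond_neg_def_kernel :: "'i set \<Rightarrow> ('i \<Rightarrow> 'i \<Rightarrow> real) \<Rightarrow> bool" where
  "cond_neg_def_kernel I \<psi> \<longleftrightarrow>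
     (\<forall>i\<in>I. \<psi> i i = 0) \<and>
     (\<forall>i\<in>I. \<forall>j\<in>I. \<psi> i j = \<psi> j i) \<and>
     (\<forall>F c. finite F \<and> F \<subseteq> I \<and> sum c F = 0 \<longrightarrow> (\<Sum>i\<in>F. \<Sum>j\<in>F. c i * c j * \<psi> i j) \<le> 0)"

definition proper_kernel :: "'i set \<Rightarrow> ('i \<Rightarrow> 'i \<Rightarrow> real) \<Rightarrow> bool" where
  "proper_kernel I \<psi> \<longleftrightarrow> (\<forall>i0\<in>I. \<forall>R\<ge>0. finite {i \<in> I. \<psi> i i0 \<le> R})"

definition co_haagerup :: "'g set \<Rightarrow> ('g, 'a) monoid_scheme \<Rightarrow> bool" where
  "co_haagerup L G \<longleftrightarrow>
     (\<exists>\<psi>. cond_neg_def_kernel (lcosets\<^bsub>G\<^esub> L) \<psi> \<and>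
          proper_kernel (lcosets\<^bsub>G\<^esub> L) \<psi> \<and>
          (\<forall>g\<in>carrier G. \<forall>i\<in>lcosets\<^bsub>G\<^esub> L. \<forall>j\<in>lcosets\<^bsub>G\<^esub> L.
             \<psi> (g <#\<^bsub>G\<^esub> i) (g <#\<^bsub>G\<^esub> j) = \<psi> i j))"


section \<open>Permutational wreath products\<close>

definition semidirect_product ::
    "('n, 'a) monoid_scheme \<Rightarrow> ('g, 'b) monoid_scheme \<Rightarrow> ('g \<Rightarrow> 'n \<Rightarrow> 'n) \<Rightarrow> ('n \<times> 'g) monoid" where
  "semidirect_product N G \<rho> =
     \<lparr>carrier = carrier N \<times> carrier G,
      monoid.mult = (\<lambda>(m, g) (n, h). (m \<otimes>\<^bsub>N\<^esub> \<rho> g n, g \<otimes>\<^bsub>G\<^esub> h)),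
      one = (\<one>\<^bsub>N\<^esub>, \<one>\<^bsub>G\<^esub>)\<rparr>"

text \<open>The argument \<open>act\<close> is the action of \<open>G\<close> on \<open>I\<close>.\<close>

definition permutational_wreath_product ::
    "('h, 'a) monoid_scheme \<Rightarrow> 'i set \<Rightarrow> ('g, 'b) monoid_scheme \<Rightarrow> ('g \<Rightarrow> 'i \<Rightarrow> 'i)
       \<Rightarrow> (('i \<Rightarrow> 'h) \<times> 'g) monoid" where
  "permutational_wreath_product H I G act =
     semidirect_product (sum_group I (\<lambda>_. H)) G (\<lambda>g w. \<lambda>i\<in>I. w (act (inv\<^bsub>G\<^esub> g) i))"

lemma group_permutational_wreath_product:
  fixes G :: "('g,'b) monoid_scheme" and H :: "('h,'a) monoid_scheme" and I :: "'i set"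
  assumes G: "group G" and H: "group H"
    and cl: "\<And>g i. g \<in> carrier G \<Longrightarrow> i \<in> I \<Longrightarrow> act g i \<in> I"
    and a1: "\<And>i. i \<in> I \<Longrightarrow> act \<one>\<^bsub>G\<^esub> i = i"
    and am: "\<And>g h i. g \<in> carrier G \<Longrightarrow> h \<in> carrier G \<Longrightarrow> i \<in> I \<Longrightarrow> act (g \<otimes>\<^bsub>G\<^esub> h) i = act g (act h i)"
  shows "group (permutational_wreath_product H I G act)"
proof -
  interpret G: group G by fact
  interpret H: group H by fact
  interpret N: group "sum_group I (\<lambda>_. H)" by (simp add: H)
  define \<rho> where "\<rho> = (\<lambda>g (w :: 'i \<Rightarrow> 'h). \<lambda>i\<in>I. w (act (inv\<^bsub>G\<^esub> g) i))"
  let ?N = "sum_group I (\<lambda>_. H)"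
  have NC: "carrier ?N = {x \<in> \<Pi>\<^sub>E i\<in>I. carrier H. finite {i \<in> I. x i \<noteq> \<one>\<^bsub>H\<^esub>}}"
    using H by (simp add: carrier_sum_group)
  have rc: "\<rho> g w \<in> carrier ?N" if g: "g \<in> carrier G" and w: "w \<in> carrier ?N" for g w
  proof -
    have "{i \<in> I. \<rho> g w i \<noteq> \<one>\<^bsub>H\<^esub>} \<subseteq> act g ` {i \<in> I. w i \<noteq> \<one>\<^bsub>H\<^esub>}"
    proof
      fix i assume i: "i \<in> {i \<in> I. \<rho> g w i \<noteq> \<one>\<^bsub>H\<^esub>}"
      hence "i = act g (act (inv\<^bsub>G\<^esub> g) i)" using am[of g "inv\<^bsub>G\<^esub> g" i] a1 g by simp
      moreover have "act (inv\<^bsub>G\<^esub> g) i \<in> {i \<in> I. w i \<noteq> \<one>\<^bsub>H\<^esub>}" using i g cl by (auto simp: \<rho>_def)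
      ultimately show "i \<in> act g ` {i \<in> I. w i \<noteq> \<one>\<^bsub>H\<^esub>}" by blast
    qed
    moreover have "\<rho> g w \<in> (\<Pi>\<^sub>E i\<in>I. carrier H)" using w g cl by (auto simp: NC \<rho>_def PiE_iff)
    ultimately show ?thesis using w unfolding NC by (auto intro: finite_subset)
  qed
  have mul: "x \<otimes>\<^bsub>?N\<^esub> y = (\<lambda>i\<in>I. x i \<otimes>\<^bsub>H\<^esub> y i)" for x y by (simp)
  have rm: "\<rho> g (x \<otimes>\<^bsub>?N\<^esub> y) = \<rho> g x \<otimes>\<^bsub>?N\<^esub> \<rho> g y" if "g \<in> carrier G" for g x y
    using that cl by (auto simp: mul \<rho>_def fun_eq_iff)
  have r1: "\<rho> \<one>\<^bsub>G\<^esub> w = w" if "w \<in> carrier ?N" for w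
    using that a1 by (auto simp: \<rho>_def NC fun_eq_iff PiE_iff extensional_def)
  have rr: "\<rho> (g \<otimes>\<^bsub>G\<^esub> h) w = \<rho> g (\<rho> h w)" if "g \<in> carrier G" "h \<in> carrier G" for g h w
    using that cl am by (auto simp: \<rho>_def fun_eq_iff G.inv_mult_group)
  have "group (semidirect_product ?N G \<rho>)"
  proof (rule groupI, goal_cases)
    case (1 x y) then show ?case unfolding semidirect_product_def using rc by (auto simp del: mult_sum_group carrier_sum_group)
  next
    case 2 show ?case unfolding semidirect_product_def by (auto simp del: mult_sum_group carrier_sum_group one_sum_group)
  next
    case (3 x y z)
    then show ?case unfolding semidirect_product_def
      using rc rm rr by (auto simp: N.m_assoc G.m_assoc simp del: mult_sum_group carrier_sum_group)
  next
    case (4 x) then show ?case unfolding semidirect_product_def using r1 by (auto simp del: mult_sum_group carrier_sum_group one_sum_group)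
  next
    case (5 x)
    obtain n g where x: "x = (n,g)" and n: "n \<in> carrier ?N" and g: "g \<in> carrier G" using 5 by (auto simp: semidirect_product_def)
    have "\<rho> (inv\<^bsub>G\<^esub> g) (inv\<^bsub>?N\<^esub> n) \<otimes>\<^bsub>?N\<^esub> \<rho> (inv\<^bsub>G\<^esub> g) n = \<rho> (inv\<^bsub>G\<^esub> g) \<one>\<^bsub>?N\<^esub>"
      using rm[of "inv\<^bsub>G\<^esub> g" "inv\<^bsub>?N\<^esub> n" n] n g by (simp del: mult_sum_group carrier_sum_group one_sum_group inv_sum_group)
    also have "\<dots> = \<one>\<^bsub>?N\<^esub>" using g cl by (auto simp: \<rho>_def fun_eq_iff)
    finally show ?case using n g rc[of "inv\<^bsub>G\<^esub> g" "inv\<^bsub>?N\<^esub> n"]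
      by (intro bexI[of _ "(\<rho> (inv\<^bsub>G\<^esub> g) (inv\<^bsub>?N\<^esub> n), inv\<^bsub>G\<^esub> g)"])
         (auto simp: x semidirect_product_def simp del: mult_sum_group carrier_sum_group one_sum_group inv_sum_group)
  qed
  thus ?thesis by (simp add: permutational_wreath_product_def \<rho>_def)
qed

end

theory Submission
  imports Defs "HOL-Probability.Probability"
begin

text \<open>
  An element of \<open>H \<wr>\<^sub>I G\<close> is a pair \<open>(w, g)\<close>. The proper action is
  the direct sum of three affine isometric actions on \<open>L\<^sup>p\<close> spaces, of which the
  first bounds \<open>g\<close>, the second bounds the support of \<open>w\<close> once \<open>g\<close>
  is known, and the third bounds the values \<open>w i\<close>.

  The third action is the given action of \<open>H\<close> on \<open>L\<^sup>p(M)\<close>, performed in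
  every coordinate of the \<open>\<l>\<^sup>p\<close>-sum of copies of \<open>L\<^sup>p(M)\<close>
  indexed by \<open>I\<close>, while \<open>G\<close> permutes the copies
  (\<open>Lp_action_coordinatewise\<close>).

  The other two start from Hilbert space data and have to reach every exponent \<open>p\<close>. They
  use commensurated sets: if a group acts on a measure space and moves a set \<open>E\<close> by sets of
  finite measure only, then \<open>1\<^bsub>gE\<^esub> - 1\<^bsub>E\<^esub>\<close> is a cocycle in
  \<open>L\<^sup>p\<close> for all \<open>p\<close> simultaneously, and the \<open>p\<close>-th power of
  its norm is the measure of the symmetric difference (\<open>Lp_action_commensurated_set\<close>). Such
  sets come from Gaussian processes. For a conditionally negative definite kernel \<open>\<psi>\<close>
  on a countable set \<open>X\<close> there is a centred Gaussian process \<open>Y\<close> such that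
  \<open>Y\<^sub>x - Y\<^sub>y\<close> has variance \<open>\<psi> x y\<close>. Choose a level
  \<open>t\<close> by Lebesgue measure and consider the half-space of all \<open>x\<close> with
  \<open>Y\<^sub>x + t \<ge> 0\<close>. The measure of the half-spaces that contain \<open>x\<close> and
  miss \<open>y\<close> is the expectation of the positive part of \<open>Y\<^sub>x - Y\<^sub>y\<close>,
  a constant times the square root of \<open>\<psi> x y\<close>. The law of \<open>(Y\<^sub>x +
  t)\<^sub>x\<close> is determined by \<open>\<psi>\<close>, so every permutation of \<open>X\<close>
  that preserves \<open>\<psi>\<close> preserves this law, and it acts pointwise, by permuting
  coordinates (\<open>cond_neg_def_kernel_walls\<close>).

  For \<open>X = G\<close> and the kernel given by the Haagerup property, the half-spaces containing the
  identity form a commensurated set; this is the first action (\<open>Lp_action_gaussian_walls\<close>).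
  For \<open>X = I\<close> the half-spaces are lifted to the wreath product: a point is a half-space
  together with a configuration of lamps, and \<open>(w, g)\<close> translates both by \<open>g\<close>
  and then multiplies by \<open>w\<close> the lamps outside the half-space. The commensurated set
  consists of the half-spaces containing the base coset \<open>L\<close>, with all lamps equal to the
  identity. The part of it that leaves under \<open>(w, g)\<close> contains the half-spaces that contain
  \<open>L\<close> and miss \<open>g\<^sup>-\<^sup>1 j\<close>, for every \<open>j\<close> in the
  support of \<open>w\<close>. So a bound on the norm of the cocycle bounds \<open>\<psi> L
  (g\<^sup>-\<^sup>1 j) = \<psi> j (g L)\<close>, which by properness of \<open>\<psi>\<close> leaves
  finitely many \<open>j\<close> for each \<open>g\<close> (\<open>Lp_action_wreath_walls\<close>).

  The three measure spaces live on different types. They are carried to subsets of \<open>'x \<times>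
  real\<close> by injections, and the sum of the measures is taken on the final
  \<open>\<sigma>\<close>-algebra of the injections (\<open>Lp_action_glue\<close>).
\<close>

section \<open>Affine isometric actions by operators on functions\<close>

text \<open>
  The \<open>p\<close>-th power of the norm, as an extended number: it is additive over a decomposition of the
  measure space, and it makes sense before a function is known to lie in \<open>L\<^sup>p\<close>.
\<close>

definition Lp_mass :: "real \<Rightarrow> 'x measure \<Rightarrow> ('x \<Rightarrow> 'k::{real_normed_field, euclidean_space}) \<Rightarrow> ennreal" where
  "Lp_mass p M f = (\<integral>\<^sup>+x. ennreal (norm (f x) powr p) \<partial>M)"

lemma Lp_functions_iff_mass:
  "f \<in> Lp_functions p M \<longleftrightarrow> f \<in> borel_measurable M \<and> Lp_mass p M f < \<infinity>"
  by (auto simp: Lp_functions_def Lp_mass_def integrable_iff_bounded)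

lemma Lp_functions_measurable: "f \<in> Lp_functions p M \<Longrightarrow> f \<in> borel_measurable M"
  by (simp add: Lp_functions_def)

lemma Lp_norm_eq_mass:
  assumes "f \<in> borel_measurable M"
  shows "Lp_norm p M f = enn2real (Lp_mass p M f) powr (1 / p)"
  unfolding Lp_norm_def Lp_mass_def using assms
  by (subst integral_eq_nn_integral) auto

lemma Lp_mass_eq_norm:
  assumes "f \<in> Lp_functions p M" "p > 0"
  shows "Lp_mass p M f = ennreal (Lp_norm p M f powr p)"
proof -
  have "Lp_mass p M f < \<infinity>" using assms by (simp add: Lp_functions_iff_mass)
  then show ?thesis
    using assms by (simp add: Lp_norm_eq_mass Lp_functions_measurable powr_powr)
qed

lemma Lp_mass_cong_AE:
  assumes "AE x in M. f x = g x"
  shows "Lp_mass p M f = Lp_mass p M g"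
  unfolding Lp_mass_def using assms by (intro nn_integral_cong_AE) auto

lemma Lp_mass_cong: "(\<And>x. x \<in> space M \<Longrightarrow> f x = g x) \<Longrightarrow> Lp_mass p M f = Lp_mass p M g"
  unfolding Lp_mass_def by (intro nn_integral_cong) auto

lemma Lp_functions_cong:
  "(\<And>x. x \<in> space M \<Longrightarrow> f x = g x) \<Longrightarrow> f \<in> Lp_functions p M \<longleftrightarrow> g \<in> Lp_functions p M"
  unfolding Lp_functions_iff_mass
  by (metis (no_types, lifting) Lp_mass_cong measurable_cong)

text \<open>
  The linear parts \<open>T g\<close> and the translation parts \<open>b g\<close> of an affine action, on functions instead of
  classes, with all laws up to null sets. On functions one can take slices, compose with maps and
  glue; representatives have to be chosen only when the action is passed to classes and back.
\<close>

definition Lp_action ::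
    "('g, 'a) monoid_scheme \<Rightarrow> real \<Rightarrow> 'x measure \<Rightarrow> ('g \<Rightarrow> ('x \<Rightarrow> 'k) \<Rightarrow> 'x \<Rightarrow> 'k::{real_normed_field, euclidean_space})
      \<Rightarrow> ('g \<Rightarrow> 'x \<Rightarrow> 'k) \<Rightarrow> bool" where
  "Lp_action G p M T b \<longleftrightarrow>
     (\<forall>g\<in>carrier G. \<forall>f\<in>Lp_functions p M. T g f \<in> Lp_functions p M) \<and>
     (\<forall>g\<in>carrier G. \<forall>f\<in>Lp_functions p M. Lp_mass p M (T g f) = Lp_mass p M f) \<and>
     (\<forall>g\<in>carrier G. \<forall>f\<in>Lp_functions p M. \<forall>f'\<in>Lp_functions p M.
        (AE x in M. f x = f' x) \<longrightarrow> (AE x in M. T g f x = T g f' x)) \<and>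
     (\<forall>g\<in>carrier G. \<forall>f\<in>Lp_functions p M. \<forall>f'\<in>Lp_functions p M.
        AE x in M. T g (\<lambda>x. f x + f' x) x = T g f x + T g f' x) \<and>
     (\<forall>g\<in>carrier G. \<forall>c. \<forall>f\<in>Lp_functions p M. AE x in M. T g (\<lambda>x. c * f x) x = c * T g f x) \<and>
     (\<forall>f\<in>Lp_functions p M. AE x in M. T \<one>\<^bsub>G\<^esub> f x = f x) \<and>
     (\<forall>g\<in>carrier G. \<forall>h\<in>carrier G. \<forall>f\<in>Lp_functions p M. AE x in M. T (g \<otimes>\<^bsub>G\<^esub> h) f x = T g (T h f) x) \<and>
     (\<forall>g\<in>carrier G. b g \<in> Lp_functions p M) \<and>
     (AE x in M. b \<one>\<^bsub>G\<^esub> x = 0) \<and>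
     (\<forall>g\<in>carrier G. \<forall>h\<in>carrier G. AE x in M. b (g \<otimes>\<^bsub>G\<^esub> h) x = T g (b h) x + b g x)"

lemma Lp_actionD:
  assumes "Lp_action G p M T b"
  shows "\<And>g f. g \<in> carrier G \<Longrightarrow> f \<in> Lp_functions p M \<Longrightarrow> T g f \<in> Lp_functions p M"
    and "\<And>g f. g \<in> carrier G \<Longrightarrow> f \<in> Lp_functions p M \<Longrightarrow> Lp_mass p M (T g f) = Lp_mass p M f"
    and "\<And>g f f'. g \<in> carrier G \<Longrightarrow> f \<in> Lp_functions p M \<Longrightarrow> f' \<in> Lp_functions p M \<Longrightarrow>
           AE x in M. f x = f' x \<Longrightarrow> AE x in M. T g f x = T g f' x"
    and "\<And>g f f'. g \<in> carrier G \<Longrightarrow> f \<in> Lp_functions p M \<Longrightarrow> f' \<in> Lp_functions p M \<Longrightarrow>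
           AE x in M. T g (\<lambda>x. f x + f' x) x = T g f x + T g f' x"
    and "\<And>g c f. g \<in> carrier G \<Longrightarrow> f \<in> Lp_functions p M \<Longrightarrow> AE x in M. T g (\<lambda>x. c * f x) x = c * T g f x"
    and "\<And>f. f \<in> Lp_functions p M \<Longrightarrow> AE x in M. T \<one>\<^bsub>G\<^esub> f x = f x"
    and "\<And>g h f. g \<in> carrier G \<Longrightarrow> h \<in> carrier G \<Longrightarrow> f \<in> Lp_functions p M \<Longrightarrow>
           AE x in M. T (g \<otimes>\<^bsub>G\<^esub> h) f x = T g (T h f) x"
    and "\<And>g. g \<in> carrier G \<Longrightarrow> b g \<in> Lp_functions p M"
    and "AE x in M. b \<one>\<^bsub>G\<^esub> x = 0"
    and "\<And>g h. g \<in> carrier G \<Longrightarrow> h \<in> carrier G \<Longrightarrow> AE x in M. b (g \<otimes>\<^bsub>G\<^esub> h) x = T g (b h) x + b g x"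
  using assms unfolding Lp_action_def by blast+

lemma AE_rel_class_eq_iff:
  assumes "f \<in> Lp_functions p M" "g \<in> Lp_functions p M"
  shows "AE_rel p M `` {f} = AE_rel p M `` {g} \<longleftrightarrow> (AE x in M. f x = g x)"
  using eq_equiv_class_iff[OF equiv_AE_rel assms] assms by (simp add: AE_rel_def)

lemma points_Lp_space: "points (Lp_space p M) = Lp_functions p M // AE_rel p M"
  by (simp add: Lp_space_def)

lemma points_Lp_space_class:
  assumes "C \<in> points (Lp_space p M)"
  obtains f where "f \<in> Lp_functions p M" "C = AE_rel p M `` {f}"
  using assms by (auto simp: points_Lp_space elim: quotientE)

lemma class_in_points: "f \<in> Lp_functions p M \<Longrightarrow> AE_rel p M `` {f} \<in> points (Lp_space p M)"
  by (auto simp: points_Lp_space intro: quotientI)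

lemma vzero_Lp_space: "vzero (Lp_space p M) = AE_rel p M `` {\<lambda>_. 0}"
  by (simp add: Lp_space_def)

text \<open>
  The operators respect equality almost everywhere, so they descend to classes. The origin is moved to
  the class of \<open>b g\<close> because \<open>T g\<close> annihilates \<open>0\<close>.
\<close>

lemma property_PL_of_Lp_action:
  fixes M :: "'x measure" and b :: "'g \<Rightarrow> 'x \<Rightarrow> 'k::{real_normed_field, euclidean_space}"
  assumes p: "p \<ge> 1" and G: "group G"
    and act: "Lp_action G p M T b"
    and proper: "\<And>R. R \<ge> 0 \<Longrightarrow> finite {g \<in> carrier G. Lp_mass p M (b g) \<le> ennreal R}"
  shows "property_PL TYPE('x \<Rightarrow> 'k) p G"
proof -
  interpret G: group G by fact
  note D = Lp_actionD[OF act]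
  let ?V = "Lp_space p M :: ('k, ('x \<Rightarrow> 'k) set) normed_space"
  let ?c = "\<lambda>f :: 'x \<Rightarrow> 'k. AE_rel p M `` {f}"
  define rep where "rep = (\<lambda>C :: ('x \<Rightarrow> 'k) set. SOME f. f \<in> Lp_functions p M \<and> C = ?c f)"
  have rep: "rep (?c f) \<in> Lp_functions p M" "AE x in M. rep (?c f) x = f x"
    if f: "f \<in> Lp_functions p M" for f
  proof -
    have "rep (?c f) \<in> Lp_functions p M \<and> ?c f = ?c (rep (?c f))"
      unfolding rep_def by (rule someI[of _ f]) (use f in auto)
    then show "rep (?c f) \<in> Lp_functions p M" "AE x in M. rep (?c f) x = f x"
      using AE_rel_class_eq_iff[of f p M "rep (?c f)"] f by auto
  qed
  have ceq: "?c f = ?c f'" if "f \<in> Lp_functions p M" "f' \<in> Lp_functions p M" "AE x in M. f x = f' x" for f f'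
    using that by (simp add: AE_rel_class_eq_iff)
  define TT where "TT = (\<lambda>g C. ?c (T g (rep C)))"
  define \<alpha> where "\<alpha> = (\<lambda>g C. vadd ?V (TT g C) (?c (b g)))"
  have TT: "TT g (?c f) = ?c (T g f)" if "g \<in> carrier G" "f \<in> Lp_functions p M" for g f
    unfolding TT_def
    using rep[OF that(2)] that by (intro ceq D(1) D(3)) auto
  have \<alpha>: "\<alpha> g (?c f) = ?c (\<lambda>x. T g f x + b g x)" if "g \<in> carrier G" "f \<in> Lp_functions p M" for g f
    unfolding \<alpha>_def TT[OF that]
    by (rule Lp_space_add_class[OF p]) (use that in \<open>auto intro!: D(1,8)\<close>)
  have lin: "linear_isometry ?V (TT g)" if g: "g \<in> carrier G" for g
    unfolding linear_isometry_def
  proof (intro conjI ballI allI)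
    fix C assume "C \<in> points ?V"
    then obtain f where f: "f \<in> Lp_functions p M" "C = ?c f" by (rule points_Lp_space_class)
    show "TT g C \<in> points ?V" using f g by (auto simp: TT intro!: class_in_points D(1))
    show "vnorm ?V (TT g C) = vnorm ?V C"
      using f g D(1)[OF g f(1)] D(2)[OF g f(1)]
      by (simp add: TT Lp_space_norm_class Lp_norm_eq_mass Lp_functions_measurable)
    fix c
    show "TT g (vscale ?V c C) = vscale ?V c (TT g C)"
      using f g D(1)[OF g f(1)] D(5)[OF g f(1)]
      by (simp add: TT Lp_space_scale_class Lp_functions_scale)
         (intro ceq D(1) Lp_functions_scale, auto)
  next
    fix C C' assume "C \<in> points ?V" "C' \<in> points ?V"
    then obtain f f' where f: "f \<in> Lp_functions p M" "C = ?c f" "f' \<in> Lp_functions p M" "C' = ?c f'"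
      by (metis points_Lp_space_class)
    show "TT g (vadd ?V C C') = vadd ?V (TT g C) (TT g C')"
      using f g D(1)[OF g f(1)] D(1)[OF g f(3)] D(4)[OF g f(1,3)] p
      by (simp add: TT Lp_space_add_class Lp_functions_add)
         (intro ceq D(1) Lp_functions_add, auto)
  qed
  have "isometric_affine_action G ?V \<alpha>"
    unfolding isometric_affine_action_def
  proof (intro conjI ballI)
    fix g assume "g \<in> carrier G"
    then show "\<exists>T. \<exists>b\<in>points ?V. linear_isometry ?V T \<and> (\<forall>v\<in>points ?V. \<alpha> g v = vadd ?V (T v) b)"
      by (intro exI[of _ "TT g"] bexI[of _ "?c (b g)"]) (auto simp: lin \<alpha>_def intro!: class_in_points D(8))
  next
    fix C assume "C \<in> points ?V"
    then obtain f where f: "f \<in> Lp_functions p M" "C = ?c f" by (rule points_Lp_space_class)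
    show "\<alpha> \<one>\<^bsub>G\<^esub> C = C"
      unfolding f(2) \<alpha>[OF G.one_closed f(1)]
      by (intro ceq Lp_functions_add p D(1) D(8)) (use f D(6)[OF f(1)] D(9) in auto)
  next
    fix g h C assume g: "g \<in> carrier G" and h: "h \<in> carrier G" and "C \<in> points ?V"
    then obtain f where f: "f \<in> Lp_functions p M" "C = ?c f" by (metis points_Lp_space_class)
    have 1: "T h f \<in> Lp_functions p M" "b h \<in> Lp_functions p M" "(\<lambda>x. T h f x + b h x) \<in> Lp_functions p M"
      using f g h by (auto intro!: Lp_functions_add p D(1,8))
    have "\<alpha> (g \<otimes>\<^bsub>G\<^esub> h) C = ?c (\<lambda>x. T (g \<otimes>\<^bsub>G\<^esub> h) f x + b (g \<otimes>\<^bsub>G\<^esub> h) x)"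
      using f g h by (simp add: \<alpha>)
    also have "\<dots> = ?c (\<lambda>x. T g (\<lambda>x. T h f x + b h x) x + b g x)"
    proof (intro ceq Lp_functions_add p D(1) D(8))
      show "AE x in M. T (g \<otimes>\<^bsub>G\<^esub> h) f x + b (g \<otimes>\<^bsub>G\<^esub> h) x = T g (\<lambda>x. T h f x + b h x) x + b g x"
        using D(7)[OF g h f(1)] D(10)[OF g h] D(4)[OF g 1(1,2)] by eventually_elim simp
    qed (use f g h in auto)
    also have "\<dots> = \<alpha> g (\<alpha> h C)"
      using f g h 1 by (simp add: \<alpha>)
    finally show "\<alpha> (g \<otimes>\<^bsub>G\<^esub> h) C = \<alpha> g (\<alpha> h C)" .
  qed
  moreover have "proper_action G ?V \<alpha>"
    unfolding proper_action_def
  proof (intro allI impI)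
    fix R :: real assume R: "0 \<le> R"
    have "Lp_mass p M (b g) \<le> ennreal (R powr p)"
      if g: "g \<in> carrier G" and le: "vnorm ?V (\<alpha> g (vzero ?V)) \<le> R" for g
    proof -
      have z: "(\<lambda>_. 0 :: 'k) \<in> Lp_functions p M" by (rule Lp_functions_zero)
      have T0: "AE x in M. T g (\<lambda>_. 0) x = 0" using D(5)[OF g z, of 0] by simp
      have "\<alpha> g (vzero ?V) = ?c (b g)"
        unfolding vzero_Lp_space \<alpha>[OF g z]
        by (intro ceq Lp_functions_add p D(1,8) g z) (use T0 in auto)
      then have "Lp_norm p M (b g) \<le> R"
        using le D(8)[OF g] by (simp add: Lp_space_norm_class)
      then have "Lp_norm p M (b g) powr p \<le> R powr p"
        using p by (intro powr_mono2) (auto simp: Lp_norm_def)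
      then show ?thesis
        using D(8)[OF g] p by (simp add: Lp_mass_eq_norm ennreal_leI)
    qed
    then show "finite {g \<in> carrier G. vnorm ?V (\<alpha> g (vzero ?V)) \<le> R}"
      by (intro finite_subset[OF _ proper[of "R powr p"]]) auto
  qed
  ultimately show ?thesis unfolding property_PL_def by (intro exI conjI)
qed

text \<open>
  Representatives are chosen for the values of the linear parts and for the translation parts. The laws
  of an action only speak of the sums \<open>T g f + b g\<close>; the value at \<open>f = 0\<close> gives the law for \<open>b\<close>, and
  subtracting it gives the law for \<open>T\<close>.
\<close>

lemma Lp_action_of_property_PL:
  fixes H :: "('h, 'a) monoid_scheme"
  assumes p: "p \<ge> 1" and H: "group H"
    and PL: "property_PL TYPE('x \<Rightarrow> 'k::{real_normed_field, euclidean_space}) p H"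
  obtains M :: "'x measure" and T :: "'h \<Rightarrow> ('x \<Rightarrow> 'k::{real_normed_field, euclidean_space}) \<Rightarrow> 'x \<Rightarrow> 'k" and b where
    "Lp_action H p M T b"
    "\<And>R. R \<ge> 0 \<Longrightarrow> finite {h \<in> carrier H. Lp_mass p M (b h) \<le> ennreal R}"
proof -
  interpret H: group H by fact
  obtain M :: "'x measure" and \<alpha> :: "'h \<Rightarrow> ('x \<Rightarrow> 'k) set \<Rightarrow> ('x \<Rightarrow> 'k) set" where
    iso: "isometric_affine_action H (Lp_space p M) \<alpha>" and prp: "proper_action H (Lp_space p M) \<alpha>"
    using PL unfolding property_PL_def by (elim exE conjE)
  let ?V = "Lp_space p M :: ('k, ('x \<Rightarrow> 'k) set) normed_space"
  let ?c = "\<lambda>f :: 'x \<Rightarrow> 'k. AE_rel p M `` {f}"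
  let ?L = "Lp_functions p M :: ('x \<Rightarrow> 'k) set"
  have ceq: "?c f = ?c f' \<longleftrightarrow> (AE x in M. f x = f' x)" if "f \<in> ?L" "f' \<in> ?L" for f f'
    using that by (simp add: AE_rel_class_eq_iff)
  note iso_unfolded = iso[unfolded isometric_affine_action_def]
  note iso1 = conjunct1[OF iso_unfolded] and iso2 = conjunct1[OF conjunct2[OF iso_unfolded]]
    and iso3 = conjunct2[OF conjunct2[OF iso_unfolded]]
  from bchoice[OF iso1] obtain S where
    "\<forall>h\<in>carrier H. \<exists>b\<in>points ?V. linear_isometry ?V (S h) \<and> (\<forall>v\<in>points ?V. \<alpha> h v = vadd ?V (S h v) b)" ..
  from bchoice[OF this[unfolded Bex_def]] obtain B where
    SB: "\<forall>h\<in>carrier H. B h \<in> points ?V \<and> linear_isometry ?V (S h) \<and> (\<forall>v\<in>points ?V. \<alpha> h v = vadd ?V (S h v) (B h))" ..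
  have S: "linear_isometry ?V (S h)" and B: "B h \<in> points ?V" if "h \<in> carrier H" for h
    using bspec[OF SB that] by simp_all
  have \<alpha>: "\<alpha> h v = vadd ?V (S h v) (B h)" if "h \<in> carrier H" "v \<in> points ?V" for h v
    using bspec[OF SB that(1)] that(2) by simp
  define rep where "rep = (\<lambda>C. SOME f. f \<in> ?L \<and> C = ?c f)"
  have rep: "rep C \<in> ?L \<and> C = ?c (rep C)" if C: "C \<in> points ?V" for C
  proof -
    obtain f where "f \<in> ?L \<and> C = ?c f" using points_Lp_space_class[OF C] by metis
    then show ?thesis unfolding rep_def by (rule someI[of "\<lambda>f. f \<in> ?L \<and> C = ?c f"])
  qed
  define T where "T = (\<lambda>h f. rep (S h (?c f)))"
  define b where "b = (\<lambda>h. rep (B h))"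
  have T: "T h f \<in> ?L" "?c (T h f) = S h (?c f)" if "h \<in> carrier H" "f \<in> ?L" for h f
  proof -
    have "S h (?c f) \<in> points ?V"
      using S[OF that(1)] class_in_points[OF that(2)] by (simp add: linear_isometry_def)
    from rep[OF this] show "T h f \<in> ?L" "?c (T h f) = S h (?c f)" by (auto simp: T_def)
  qed
  have b: "b h \<in> ?L" "?c (b h) = B h" if "h \<in> carrier H" for h
    using rep[OF B[OF that]] by (auto simp: b_def)
  have \<alpha>c: "\<alpha> h (?c f) = ?c (\<lambda>x. T h f x + b h x)" if "h \<in> carrier H" "f \<in> ?L" for h f
    using \<alpha>[OF that(1) class_in_points[OF that(2)]] Lp_space_add_class[OF p T(1)[OF that] b(1)[OF that(1)]]
    by (simp add: T(2)[OF that] b(2)[OF that(1)])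
  have mass: "Lp_mass p M (T h f) = Lp_mass p M f" if "h \<in> carrier H" "f \<in> ?L" for h f
  proof -
    have "vnorm ?V (?c (T h f)) = vnorm ?V (?c f)"
      using S[OF that(1)] class_in_points[OF that(2)] by (simp add: linear_isometry_def T(2)[OF that])
    then show ?thesis
      using that T(1)[OF that] p by (simp add: Lp_space_norm_class Lp_mass_eq_norm)
  qed
  have cong: "AE x in M. T h f x = T h f' x"
    if "h \<in> carrier H" "f \<in> ?L" "f' \<in> ?L" "AE x in M. f x = f' x" for h f f'
    using T(2)[OF that(1,2)] T(2)[OF that(1,3)] ceq[OF that(2,3)] that(4)
      ceq[OF T(1)[OF that(1,2)] T(1)[OF that(1,3)]] by simp
  have add: "AE x in M. T h (\<lambda>x. f x + f' x) x = T h f x + T h f' x"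
    if "h \<in> carrier H" "f \<in> ?L" "f' \<in> ?L" for h f f'
  proof -
    have "?c (T h (\<lambda>x. f x + f' x)) = S h (vadd ?V (?c f) (?c f'))"
      using that p by (simp add: T Lp_space_add_class Lp_functions_add)
    also have "\<dots> = vadd ?V (?c (T h f)) (?c (T h f'))"
      using S[OF that(1)] that by (simp add: linear_isometry_def T(2) class_in_points)
    also have "\<dots> = ?c (\<lambda>x. T h f x + T h f' x)"
      using that T(1) p by (simp add: Lp_space_add_class)
    finally show ?thesis
      using that T(1) p by (simp add: ceq Lp_functions_add)
  qed
  have scale: "AE x in M. T h (\<lambda>x. c * f x) x = c * T h f x"
    if "h \<in> carrier H" "f \<in> ?L" for h f c
  proof -
    have "?c (T h (\<lambda>x. c * f x)) = S h (vscale ?V c (?c f))"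
      using that p by (simp add: T Lp_space_scale_class Lp_functions_scale)
    also have "\<dots> = vscale ?V c (?c (T h f))"
      using S[OF that(1)] that by (simp add: linear_isometry_def T(2) class_in_points)
    also have "\<dots> = ?c (\<lambda>x. c * T h f x)"
      using that T(1) p by (simp add: Lp_space_scale_class)
    finally show ?thesis
      using that T(1) p by (simp add: ceq Lp_functions_scale)
  qed
  have z: "(\<lambda>_. 0) \<in> ?L" by (rule Lp_functions_zero)
  have T0: "AE x in M. T h (\<lambda>_. 0) x = 0" if "h \<in> carrier H" for h
    using scale[OF that z, of 0] by simp
  have one: "AE x in M. T \<one>\<^bsub>H\<^esub> f x + b \<one>\<^bsub>H\<^esub> x = f x" if "f \<in> ?L" for f
  proof -
    have "?c (\<lambda>x. T \<one>\<^bsub>H\<^esub> f x + b \<one>\<^bsub>H\<^esub> x) = ?c f"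
      using bspec[OF iso2 class_in_points[OF that]] \<alpha>c[OF H.one_closed that] by simp
    then show ?thesis using that T(1) b(1) p by (simp add: ceq Lp_functions_add)
  qed
  have b1: "AE x in M. b \<one>\<^bsub>H\<^esub> x = 0"
    using one[OF z] T0[OF H.one_closed] by eventually_elim simp
  have mult: "AE x in M. T (g \<otimes>\<^bsub>H\<^esub> h) f x + b (g \<otimes>\<^bsub>H\<^esub> h) x = T g (T h f) x + T g (b h) x + b g x"
    if "g \<in> carrier H" "h \<in> carrier H" "f \<in> ?L" for g h f
  proof -
    have 1: "T h f \<in> ?L" "b h \<in> ?L" "(\<lambda>x. T h f x + b h x) \<in> ?L"
      using that T(1) b(1) p by (auto intro: Lp_functions_add)
    have "?c (\<lambda>x. T (g \<otimes>\<^bsub>H\<^esub> h) f x + b (g \<otimes>\<^bsub>H\<^esub> h) x) = ?c (\<lambda>x. T g (\<lambda>x. T h f x + b h x) x + b g x)"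
      using bspec[OF bspec[OF bspec[OF iso3 that(1)] that(2)] class_in_points[OF that(3)]]
        \<alpha>c[OF that(1) 1(3)] \<alpha>c[OF that(2,3)] \<alpha>c[OF H.m_closed[OF that(1,2)] that(3)]
      by simp
    then have "AE x in M. T (g \<otimes>\<^bsub>H\<^esub> h) f x + b (g \<otimes>\<^bsub>H\<^esub> h) x = T g (\<lambda>x. T h f x + b h x) x + b g x"
      using that T(1) b(1) p 1 by (subst (asm) ceq) (auto intro!: Lp_functions_add)
    then show ?thesis using add[OF that(1) 1(1,2)] by eventually_elim simp
  qed
  have bm: "AE x in M. b (g \<otimes>\<^bsub>H\<^esub> h) x = T g (b h) x + b g x"
    if "g \<in> carrier H" "h \<in> carrier H" for g h
  proof -
    have "AE x in M. T g (T h (\<lambda>_. 0)) x = T g (\<lambda>_. 0) x"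
      using that T(1) z T0 by (intro cong) auto
    then show ?thesis
      using mult[OF that z] T0[OF that(1)] T0[OF H.m_closed[OF that]] by eventually_elim simp
  qed
  have "Lp_action H p M T b"
    unfolding Lp_action_def
  proof (intro conjI ballI allI impI)
    fix f :: "'x \<Rightarrow> 'k" assume f: "f \<in> ?L"
    show "AE x in M. T \<one>\<^bsub>H\<^esub> f x = f x" using one[OF f] b1 by eventually_elim simp
  next
    fix g h and f :: "'x \<Rightarrow> 'k" assume "f \<in> ?L" "g \<in> carrier H" "h \<in> carrier H"
    from mult[OF this(2,3,1)] bm[OF this(2,3)] show "AE x in M. T (g \<otimes>\<^bsub>H\<^esub> h) f x = T g (T h f) x"
      by eventually_elim simp
  qed (simp_all add: T(1) b(1) mass cong add scale b1 bm)
  moreover have "finite {h \<in> carrier H. Lp_mass p M (b h) \<le> ennreal R}" if R: "R \<ge> 0" for R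
  proof (rule finite_subset)
    show "finite {h \<in> carrier H. vnorm ?V (\<alpha> h (vzero ?V)) \<le> R powr (1/p)}"
      using prp unfolding proper_action_def by simp
    show "{h \<in> carrier H. Lp_mass p M (b h) \<le> ennreal R} \<subseteq> \<dots>"
    proof safe
      fix h assume h: "h \<in> carrier H" and le: "Lp_mass p M (b h) \<le> ennreal R"
      have "\<alpha> h (vzero ?V) = ?c (b h)"
        using h z T(1) b(1) p T0[OF h] by (simp add: vzero_Lp_space \<alpha>c ceq Lp_functions_add)
      then have "vnorm ?V (\<alpha> h (vzero ?V)) = enn2real (Lp_mass p M (b h)) powr (1/p)"
        using b(1)[OF h] by (simp add: Lp_space_norm_class Lp_norm_eq_mass Lp_functions_measurable)
      also have "\<dots> \<le> R powr (1/p)"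
        using le R p by (intro powr_mono2) (auto simp: enn2real_leI)
      finally show "vnorm ?V (\<alpha> h (vzero ?V)) \<le> R powr (1/p)" .
    qed
  qed
  ultimately show ?thesis using that by blast
qed

section \<open>Actions from commensurated sets\<close>

lemma emeasure_vimage_measure_preserving:
  assumes "\<tau> \<in> measurable \<Omega> \<Omega>" "distr \<Omega> \<Omega> \<tau> = \<Omega>" "A \<in> sets \<Omega>"
  shows "emeasure \<Omega> (\<tau> -` A \<inter> space \<Omega>) = emeasure \<Omega> A"
  using emeasure_distr[OF assms(1,3)] assms(2) by simp

text \<open>
  The cocycle is the formal coboundary of the indicator function of \<open>E\<close>, which itself need not be in
  \<open>L\<^sup>p\<close>. Its absolute value takes only the values \<open>0\<close> and \<open>1\<close>, so its mass is the same for all \<open>p\<close>.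
  The symmetric difference of \<open>E\<close> and its translate by \<open>g\<close> consists of the points of \<open>E\<close> that leave
  \<open>E\<close> under the inverse of \<open>g\<close>, and of the image under \<open>g\<close> of the points of \<open>E\<close> that leave \<open>E\<close> under \<open>g\<close>.
\<close>

lemma Lp_action_commensurated_set:
  fixes G :: "('g, 'a) monoid_scheme" and \<Omega> :: "'w measure" and p :: real
  assumes G: "group G" and p: "p \<ge> 1"
    and \<tau>: "\<And>g. g \<in> carrier G \<Longrightarrow> \<tau> g \<in> measurable \<Omega> \<Omega>"
    and pres: "\<And>g. g \<in> carrier G \<Longrightarrow> distr \<Omega> \<Omega> (\<tau> g) = \<Omega>"
    and one: "\<And>\<omega>. \<omega> \<in> space \<Omega> \<Longrightarrow> \<tau> \<one>\<^bsub>G\<^esub> \<omega> = \<omega>"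
    and mult: "\<And>g h \<omega>. g \<in> carrier G \<Longrightarrow> h \<in> carrier G \<Longrightarrow> \<omega> \<in> space \<Omega> \<Longrightarrow> \<tau> (g \<otimes>\<^bsub>G\<^esub> h) \<omega> = \<tau> g (\<tau> h \<omega>)"
    and E: "E \<in> sets \<Omega>"
    and fin: "\<And>g. g \<in> carrier G \<Longrightarrow> emeasure \<Omega> {\<omega> \<in> E. \<tau> g \<omega> \<notin> E} < \<infinity>"
  defines "T \<equiv> \<lambda>g (f :: 'w \<Rightarrow> 'k::{real_normed_field, euclidean_space}) \<omega>. f (\<tau> (inv\<^bsub>G\<^esub> g) \<omega>)"
    and "b \<equiv> \<lambda>g \<omega>. indicator E (\<tau> (inv\<^bsub>G\<^esub> g) \<omega>) - indicator E \<omega> :: 'k"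
  shows "Lp_action G p \<Omega> T b"
    and "\<And>g. g \<in> carrier G \<Longrightarrow> emeasure \<Omega> {\<omega> \<in> E. \<tau> g \<omega> \<notin> E} \<le> Lp_mass p \<Omega> (b g)"
proof -
  interpret G: group G by fact
  have [measurable]: "E \<in> sets \<Omega>" by fact
  have sub: "\<omega> \<in> E \<Longrightarrow> \<omega> \<in> space \<Omega>" for \<omega> using E sets.sets_into_space by blast
  define D where "D = (\<lambda>g. {\<omega> \<in> E. \<tau> g \<omega> \<notin> E})"
  have D_meas: "D g \<in> sets \<Omega>" if g: "g \<in> carrier G" for g
  proof -
    have [measurable]: "\<tau> g \<in> measurable \<Omega> \<Omega>" using \<tau>[OF g] .
    have "D g = {\<omega> \<in> space \<Omega>. \<omega> \<in> E \<and> \<tau> g \<omega> \<notin> E}" using sub by (auto simp: D_def)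
    also have "\<dots> \<in> sets \<Omega>" by measurable
    finally show ?thesis .
  qed
  have mass: "Lp_mass p \<Omega> (b g) = emeasure \<Omega> (D (inv\<^bsub>G\<^esub> g)) + emeasure \<Omega> (D g)"
    if g: "g \<in> carrier G" for g
  proof -
    have ig: "inv\<^bsub>G\<^esub> g \<in> carrier G" using g by simp
    have in_space: "\<tau> (inv\<^bsub>G\<^esub> g) \<omega> \<in> space \<Omega>" if "\<omega> \<in> space \<Omega>" for \<omega>
      using measurable_space[OF \<tau>[OF ig] that] .
    have cancel: "\<tau> g (\<tau> (inv\<^bsub>G\<^esub> g) \<omega>) = \<omega>" if "\<omega> \<in> space \<Omega>" for \<omega>
      using mult[OF g ig that] one[OF that] g by simp
    let ?B = "\<tau> (inv\<^bsub>G\<^esub> g) -` D g \<inter> space \<Omega>"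
    have "Lp_mass p \<Omega> (b g)
        = (\<integral>\<^sup>+\<omega>. indicator (D (inv\<^bsub>G\<^esub> g)) \<omega> + indicator ?B \<omega> \<partial>\<Omega>)"
      unfolding Lp_mass_def
      by (intro nn_integral_cong)
        (use p in_space cancel sub in \<open>auto simp: b_def D_def indicator_def\<close>)
    also have "\<dots> = emeasure \<Omega> (D (inv\<^bsub>G\<^esub> g)) + emeasure \<Omega> ?B"
      by (subst nn_integral_add) (use D_meas[OF ig] D_meas[OF g] \<tau>[OF ig] in auto)
    also have "emeasure \<Omega> ?B = emeasure \<Omega> (D g)"
      by (rule emeasure_vimage_measure_preserving) (use D_meas[OF g] \<tau>[OF ig] pres[OF ig] in auto)
    finally show ?thesis .
  qed
  show "emeasure \<Omega> {\<omega> \<in> E. \<tau> g \<omega> \<notin> E} \<le> Lp_mass p \<Omega> (b g)" if "g \<in> carrier G" for g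
    unfolding mass[OF that] by (simp add: D_def)
  have mass_T: "Lp_mass p \<Omega> (T g f) = Lp_mass p \<Omega> f"
    if g: "g \<in> carrier G" and f: "f \<in> borel_measurable \<Omega>" for g f
  proof -
    have [measurable]: "\<tau> (inv\<^bsub>G\<^esub> g) \<in> measurable \<Omega> \<Omega>" "f \<in> borel_measurable \<Omega>" using \<tau> g f by auto
    have "Lp_mass p \<Omega> f = (\<integral>\<^sup>+x. ennreal (norm (f x) powr p) \<partial>distr \<Omega> \<Omega> (\<tau> (inv\<^bsub>G\<^esub> g)))"
      using g by (simp add: Lp_mass_def pres)
    also have "\<dots> = Lp_mass p \<Omega> (T g f)"
      unfolding Lp_mass_def T_def by (subst nn_integral_distr) auto
    finally show ?thesis ..
  qed
  have meas_T: "T g f \<in> borel_measurable \<Omega>"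
    if g: "g \<in> carrier G" and f: "f \<in> borel_measurable \<Omega>" for g f
    unfolding T_def using \<tau>[of "inv\<^bsub>G\<^esub> g"] g f by (auto intro: measurable_compose)
  show "Lp_action G p \<Omega> T b"
    unfolding Lp_action_def
  proof (intro conjI ballI allI impI)
    fix g and f f' :: "_ \<Rightarrow> 'k" assume g: "g \<in> carrier G" and f: "f \<in> Lp_functions p \<Omega>" "f' \<in> Lp_functions p \<Omega>"
      and eq: "AE x in \<Omega>. f x = f' x"
    have [measurable]: "\<tau> (inv\<^bsub>G\<^esub> g) \<in> measurable \<Omega> \<Omega>" "f \<in> borel_measurable \<Omega>" "f' \<in> borel_measurable \<Omega>"
      using \<tau> g f by (auto simp: Lp_functions_measurable)
    have "AE x in distr \<Omega> \<Omega> (\<tau> (inv\<^bsub>G\<^esub> g)). f x = f' x" unfolding pres[OF G.inv_closed[OF g]] by (rule eq)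
    then show "AE x in \<Omega>. T g f x = T g f' x"
      by (subst (asm) AE_distr_iff) (auto simp: T_def)
  next
    fix g assume g: "g \<in> carrier G"
    have [measurable]: "\<tau> (inv\<^bsub>G\<^esub> g) \<in> measurable \<Omega> \<Omega>" using \<tau> g by simp
    show "b g \<in> Lp_functions p \<Omega>"
      unfolding Lp_functions_iff_mass mass[OF g]
      using fin[of g] fin[of "inv\<^bsub>G\<^esub> g"] g by (auto simp: b_def D_def)
  qed (auto simp: Lp_functions_iff_mass mass_T[unfolded T_def] meas_T[unfolded T_def] T_def b_def one mult G.inv_mult_group intro!: AE_I2)
qed

section \<open>Direct sums over glued measure spaces\<close>

text \<open>
  The sum of the two image measures, on the final \<open>\<sigma>\<close>-algebra of the two maps: injections with disjoint
  images then embed both measure spaces isomorphically into any target set.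
\<close>

definition glue_measure :: "('x \<Rightarrow> 'y) \<Rightarrow> 'x measure \<Rightarrow> ('z \<Rightarrow> 'y) \<Rightarrow> 'z measure \<Rightarrow> 'y measure" where
  "glue_measure \<iota> M \<kappa> N = measure_of UNIV
     {A. \<iota> -` A \<inter> space M \<in> sets M \<and> \<kappa> -` A \<inter> space N \<in> sets N}
     (\<lambda>A. emeasure M (\<iota> -` A \<inter> space M) + emeasure N (\<kappa> -` A \<inter> space N))"

lemma sigma_algebra_glue:
  "sigma_algebra UNIV {A. \<iota> -` A \<inter> space M \<in> sets M \<and> \<kappa> -` A \<inter> space N \<in> sets N}"
proof (unfold sigma_algebra_iff2, intro conjI ballI allI impI)
  let ?S = "{A. \<iota> -` A \<inter> space M \<in> sets M \<and> \<kappa> -` A \<inter> space N \<in> sets N}"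
  show "?S \<subseteq> Pow UNIV" "{} \<in> ?S" by auto
  show "UNIV - A \<in> ?S" if "A \<in> ?S" for A
  proof -
    have "\<iota> -` (UNIV - A) \<inter> space M = space M - (\<iota> -` A \<inter> space M)"
      "\<kappa> -` (UNIV - A) \<inter> space N = space N - (\<kappa> -` A \<inter> space N)" by auto
    then show ?thesis using that by auto
  qed
  show "(\<Union>i::nat. A i) \<in> ?S" if "range A \<subseteq> ?S" for A
  proof -
    have "\<iota> -` (\<Union>i. A i) \<inter> space M = (\<Union>i. \<iota> -` A i \<inter> space M)"
      "\<kappa> -` (\<Union>i. A i) \<inter> space N = (\<Union>i. \<kappa> -` A i \<inter> space N)" by auto
    moreover have "(\<Union>i. \<iota> -` A i \<inter> space M) \<in> sets M" "(\<Union>i. \<kappa> -` A i \<inter> space N) \<in> sets N"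
      using that by (intro sets.countable_UN; auto)+
    ultimately show ?thesis by (simp only: mem_Collect_eq)
  qed
qed

lemma space_glue [simp]: "space (glue_measure \<iota> M \<kappa> N) = UNIV"
  by (simp add: glue_measure_def space_measure_of_conv)

lemma sets_glue:
  "sets (glue_measure \<iota> M \<kappa> N) = {A. \<iota> -` A \<inter> space M \<in> sets M \<and> \<kappa> -` A \<inter> space N \<in> sets N}"
  unfolding glue_measure_def using sigma_algebra_glue[of \<iota> M \<kappa> N]
  by (subst sets_measure_of) (auto simp: sigma_algebra.sigma_sets_eq)

lemma emeasure_glue:
  assumes "A \<in> sets (glue_measure \<iota> M \<kappa> N)"
  shows "emeasure (glue_measure \<iota> M \<kappa> N) A = emeasure M (\<iota> -` A \<inter> space M) + emeasure N (\<kappa> -` A \<inter> space N)"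
proof (rule emeasure_measure_of[OF glue_measure_def])
  show "A \<in> sets (glue_measure \<iota> M \<kappa> N)" by fact
  show "positive (sets (glue_measure \<iota> M \<kappa> N)) (\<lambda>A. emeasure M (\<iota> -` A \<inter> space M) + emeasure N (\<kappa> -` A \<inter> space N))"
    by (simp add: positive_def)
  show "countably_additive (sets (glue_measure \<iota> M \<kappa> N))
     (\<lambda>A. emeasure M (\<iota> -` A \<inter> space M) + emeasure N (\<kappa> -` A \<inter> space N))"
  proof (rule countably_additiveI)
    fix A :: "nat \<Rightarrow> _" assume A: "range A \<subseteq> sets (glue_measure \<iota> M \<kappa> N)" "disjoint_family A"
    have 1: "(\<Sum>i. emeasure M (\<iota> -` A i \<inter> space M)) = emeasure M (\<Union>i. \<iota> -` A i \<inter> space M)"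
      by (rule suminf_emeasure) (use A in \<open>auto simp: sets_glue disjoint_family_on_def\<close>)
    have 2: "(\<Sum>i. emeasure N (\<kappa> -` A i \<inter> space N)) = emeasure N (\<Union>i. \<kappa> -` A i \<inter> space N)"
      by (rule suminf_emeasure) (use A in \<open>auto simp: sets_glue disjoint_family_on_def\<close>)
    show "(\<Sum>i. emeasure M (\<iota> -` A i \<inter> space M) + emeasure N (\<kappa> -` A i \<inter> space N)) =
         emeasure M (\<iota> -` \<Union> (range A) \<inter> space M) + emeasure N (\<kappa> -` \<Union> (range A) \<inter> space N)"
      by (subst suminf_add[symmetric]) (auto simp: 1 2 vimage_Union)
  qed
qed auto

lemma measurable_glue_iff:
  "f \<in> borel_measurable (glue_measure \<iota> M \<kappa> N) \<longleftrightarrow>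
     (\<lambda>x. f (\<iota> x)) \<in> borel_measurable M \<and> (\<lambda>x. f (\<kappa> x)) \<in> borel_measurable N"
  by (auto simp: measurable_def sets_glue vimage_def)

lemma nn_integral_glue:
  assumes f: "f \<in> borel_measurable (glue_measure \<iota> M \<kappa> N)"
  shows "(\<integral>\<^sup>+y. f y \<partial>glue_measure \<iota> M \<kappa> N) = (\<integral>\<^sup>+x. f (\<iota> x) \<partial>M) + (\<integral>\<^sup>+x. f (\<kappa> x) \<partial>N)"
  using f
proof induct
  case (cong f g)
  then show ?case by (simp cong: nn_integral_cong)
next
  case (set A)
  have "(\<integral>\<^sup>+x. indicator A (\<iota> x) \<partial>M) = (\<integral>\<^sup>+x. indicator (\<iota> -` A \<inter> space M) x \<partial>M)"
       "(\<integral>\<^sup>+x. indicator A (\<kappa> x) \<partial>N) = (\<integral>\<^sup>+x. indicator (\<kappa> -` A \<inter> space N) x \<partial>N)"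
    by (intro nn_integral_cong; simp add: indicator_def)+
  with set show ?case by (simp add: emeasure_glue) (simp add: sets_glue)
next
  case (mult u c)
  then show ?case
    by (simp add: measurable_glue_iff nn_integral_cmult distrib_left)
next
  case (add u v)
  then show ?case
    by (simp add: measurable_glue_iff nn_integral_add ac_simps)
next
  case (seq U)
  have "(\<integral>\<^sup>+y. (SUP i. U i y) \<partial>glue_measure \<iota> M \<kappa> N) = (SUP i. \<integral>\<^sup>+y. U i y \<partial>glue_measure \<iota> M \<kappa> N)"
    using seq by (intro nn_integral_monotone_convergence_SUP) auto
  also have "\<dots> = (SUP i. (\<integral>\<^sup>+x. U i (\<iota> x) \<partial>M) + (\<integral>\<^sup>+x. U i (\<kappa> x) \<partial>N))"
    using seq by simp
  also have "\<dots> = (SUP i. \<integral>\<^sup>+x. U i (\<iota> x) \<partial>M) + (SUP i. \<integral>\<^sup>+x. U i (\<kappa> x) \<partial>N)"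
    using seq by (intro ennreal_SUP_add) (auto simp: incseq_def le_fun_def intro!: nn_integral_mono)
  also have "\<dots> = (\<integral>\<^sup>+x. (SUP i. U i (\<iota> x)) \<partial>M) + (\<integral>\<^sup>+x. (SUP i. U i (\<kappa> x)) \<partial>N)"
    using seq by (subst (1 2) nn_integral_monotone_convergence_SUP)
      (auto simp: incseq_def le_fun_def measurable_glue_iff)
  finally show ?case by (simp add: image_comp)
qed

text \<open>
  If \<open>A\<close> and \<open>B\<close> are exceptional null sets on the two sides, the complement of the images of their
  complements is an exceptional null set of the glued space: injectivity and disjointness of the images
  make its two preimages exactly \<open>A\<close> and \<open>B\<close>.
\<close>

lemma AE_glue_iff:
  assumes inj: "inj_on \<iota> (space M)" "inj_on \<kappa> (space N)"
    and disj: "\<iota> ` space M \<inter> \<kappa> ` space N = {}"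
  shows "(AE y in glue_measure \<iota> M \<kappa> N. P y) \<longleftrightarrow> (AE x in M. P (\<iota> x)) \<and> (AE x in N. P (\<kappa> x))"
proof safe
  assume "AE y in glue_measure \<iota> M \<kappa> N. P y"
  then obtain A where A: "{y. \<not> P y} \<subseteq> A" "emeasure (glue_measure \<iota> M \<kappa> N) A = 0" "A \<in> sets (glue_measure \<iota> M \<kappa> N)"
    by (auto elim!: AE_E)
  show "AE x in M. P (\<iota> x)" 
    by (rule AE_I[of _ _ "\<iota> -` A \<inter> space M"]) (use A in \<open>auto simp: emeasure_glue\<close>, simp add: sets_glue)
  show "AE x in N. P (\<kappa> x)" 
    by (rule AE_I[of _ _ "\<kappa> -` A \<inter> space N"]) (use A in \<open>auto simp: emeasure_glue\<close>, simp add: sets_glue)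
next
  assume "AE x in M. P (\<iota> x)" "AE x in N. P (\<kappa> x)"
  then obtain A B where A: "{x \<in> space M. \<not> P (\<iota> x)} \<subseteq> A" "emeasure M A = 0" "A \<in> sets M"
    and B: "{x \<in> space N. \<not> P (\<kappa> x)} \<subseteq> B" "emeasure N B = 0" "B \<in> sets N"
    by (auto elim!: AE_E)
  let ?C = "- (\<iota> ` (space M - A) \<union> \<kappa> ` (space N - B))"
  have C: "\<iota> -` ?C \<inter> space M = A" "\<kappa> -` ?C \<inter> space N = B"
    using subsetD[OF sets.sets_into_space[OF A(3)]] subsetD[OF sets.sets_into_space[OF B(3)]] disj
    by (auto dest: inj_onD[OF inj(1)] inj_onD[OF inj(2)]) (metis IntI empty_iff imageI)+
  then have "?C \<in> sets (glue_measure \<iota> M \<kappa> N)" using A B by (simp add: sets_glue)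
  moreover from this have "emeasure (glue_measure \<iota> M \<kappa> N) ?C = 0" using A B C by (simp add: emeasure_glue)
  ultimately have 1: "AE y in glue_measure \<iota> M \<kappa> N. y \<notin> ?C" by (intro AE_not_in) (auto simp: null_sets_def)
  have "{y. \<not> P y} \<subseteq> ?C" using A B by auto
  with 1 show "AE y in glue_measure \<iota> M \<kappa> N. P y" by (auto elim!: eventually_mono)
qed

definition glue_fun :: "('x \<Rightarrow> 'y) \<Rightarrow> 'x measure \<Rightarrow> ('z \<Rightarrow> 'y) \<Rightarrow> 'z measure \<Rightarrow> ('x \<Rightarrow> 'k) \<Rightarrow> ('z \<Rightarrow> 'k) \<Rightarrow> 'y \<Rightarrow> 'k" where
  "glue_fun \<iota> M \<kappa> N u v y =
     (if y \<in> \<iota> ` space M then u (inv_into (space M) \<iota> y) else v (inv_into (space N) \<kappa> y))"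

text \<open>
  \<open>L\<^sup>p\<close> of the glued space is the \<open>\<l>\<^sup>p\<close>-sum of the two \<open>L\<^sup>p\<close> spaces. Going through the glued space changes
  a function on one side only outside the space of that side, which is why the composition laws use that
  the operators respect equality almost everywhere.
\<close>

lemma Lp_action_glue:
  fixes M :: "'x measure" and N :: "'z measure" and b :: "'g \<Rightarrow> 'x \<Rightarrow> 'k::{real_normed_field, euclidean_space}"
  assumes inj: "inj_on \<iota> (space M)" "inj_on \<kappa> (space N)"
    and disj: "\<iota> ` space M \<inter> \<kappa> ` space N = {}"
    and M: "Lp_action G p M T b" and N: "Lp_action G p N S c" and G: "group G" and p: "p \<ge> 1"
  defines "B \<equiv> \<lambda>g. glue_fun \<iota> M \<kappa> N (b g) (c g)"
  shows "Lp_action G p (glue_measure \<iota> M \<kappa> N)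
            (\<lambda>g f. glue_fun \<iota> M \<kappa> N (T g (\<lambda>x. f (\<iota> x))) (S g (\<lambda>x. f (\<kappa> x)))) B"
    and "\<And>g. g \<in> carrier G \<Longrightarrow>
           Lp_mass p (glue_measure \<iota> M \<kappa> N) (B g) = Lp_mass p M (b g) + Lp_mass p N (c g)"
proof -
  interpret G: group G by fact
  let ?K = "glue_measure \<iota> M \<kappa> N" and ?gl = "glue_fun \<iota> M \<kappa> N :: _ \<Rightarrow> _ \<Rightarrow> _ \<Rightarrow> 'k"
  let ?TS = "\<lambda>g f. glue_fun \<iota> M \<kappa> N (T g (\<lambda>x. f (\<iota> x))) (S g (\<lambda>x. f (\<kappa> x)))"
  note MD = Lp_actionD[OF M] and ND = Lp_actionD[OF N]
  have gl: "\<And>u v x. x \<in> space M \<Longrightarrow> ?gl u v (\<iota> x) = u x" "\<And>u v x. x \<in> space N \<Longrightarrow> ?gl u v (\<kappa> x) = v x"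
    using inj disj by (auto simp: glue_fun_def)
  have meas_gl: "?gl u v \<in> borel_measurable ?K" if "u \<in> borel_measurable M" "v \<in> borel_measurable N" for u v
    using that by (simp add: measurable_glue_iff gl cong: measurable_cong)
  have mass: "Lp_mass p ?K f = Lp_mass p M (\<lambda>x. f (\<iota> x)) + Lp_mass p N (\<lambda>x. f (\<kappa> x))"
    if "f \<in> borel_measurable ?K" for f :: "_ \<Rightarrow> 'k"
    unfolding Lp_mass_def by (rule nn_integral_glue) (use that in measurable)
  have Lp: "f \<in> Lp_functions p ?K \<longleftrightarrow> (\<lambda>x. f (\<iota> x)) \<in> Lp_functions p M \<and> (\<lambda>x. f (\<kappa> x)) \<in> Lp_functions p N"
    for f :: "_ \<Rightarrow> 'k"
    by (auto simp: Lp_functions_iff_mass mass measurable_glue_iff)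
  have mass_gl: "Lp_mass p ?K (?gl u v) = Lp_mass p M u + Lp_mass p N v"
    if "u \<in> Lp_functions p M" "v \<in> Lp_functions p N" for u v
    using that by (simp add: mass meas_gl Lp_functions_measurable gl cong: Lp_mass_cong)
  have Lp_gl: "?gl u v \<in> Lp_functions p ?K" if "u \<in> Lp_functions p M" "v \<in> Lp_functions p N" for u v
    using that by (auto simp: Lp gl cong: Lp_functions_cong)
  note AE_gl = AE_glue_iff[OF inj disj]
  have AE_gl1: "(AE x in M. Q x (?gl u v (\<iota> x))) \<longleftrightarrow> (AE x in M. Q x (u x))"
     and AE_gl2: "(AE x in N. R x (?gl u v (\<kappa> x))) \<longleftrightarrow> (AE x in N. R x (v x))" for u v Q R
    by (auto intro!: AE_cong simp: gl)
  show "Lp_mass p ?K (B g) = Lp_mass p M (b g) + Lp_mass p N (c g)" if "g \<in> carrier G" for g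
    using that by (simp add: B_def mass_gl MD(8) ND(8))
  show "Lp_action G p ?K ?TS B"
    unfolding Lp_action_def
  proof (intro conjI ballI allI impI)
    fix g h and f :: "_ \<Rightarrow> 'k"
    assume g: "g \<in> carrier G" and h: "h \<in> carrier G" and f: "f \<in> Lp_functions p ?K"
    let ?u = "T h (\<lambda>x. f (\<iota> x))" and ?v = "S h (\<lambda>x. f (\<kappa> x))"
    have uv: "?u \<in> Lp_functions p M" "?v \<in> Lp_functions p N"
      using f h by (auto simp: Lp MD(1) ND(1))
    have uv': "(\<lambda>x. ?gl ?u ?v (\<iota> x)) \<in> Lp_functions p M" "(\<lambda>x. ?gl ?u ?v (\<kappa> x)) \<in> Lp_functions p N"
      using Lp_gl[OF uv] by (auto simp: Lp)
    have 1: "AE x in M. T g (\<lambda>x. ?gl ?u ?v (\<iota> x)) x = T g ?u x"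
      by (rule MD(3)[OF g uv'(1) uv(1)]) (auto simp: gl)
    have 2: "AE x in N. S g (\<lambda>x. ?gl ?u ?v (\<kappa> x)) x = S g ?v x"
      by (rule ND(3)[OF g uv'(2) uv(2)]) (auto simp: gl)
    have 3: "AE x in M. T (g \<otimes>\<^bsub>G\<^esub> h) (\<lambda>x. f (\<iota> x)) x = T g ?u x"
      using f g h by (intro MD(7)) (auto simp: Lp)
    have 4: "AE x in N. S (g \<otimes>\<^bsub>G\<^esub> h) (\<lambda>x. f (\<kappa> x)) x = S g ?v x"
      using f g h by (intro ND(7)) (auto simp: Lp)
    show "AE x in ?K. ?TS (g \<otimes>\<^bsub>G\<^esub> h) f x =
            ?gl (T g (\<lambda>x. ?gl ?u ?v (\<iota> x))) (S g (\<lambda>x. ?gl ?u ?v (\<kappa> x))) x"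
      unfolding AE_gl using AE_space[of M] AE_space[of N] 1 2 3 4
      by (auto elim!: eventually_elim2 simp: gl)
  next
    fix g h assume g: "g \<in> carrier G" and h: "h \<in> carrier G"
    have bh: "b h \<in> Lp_functions p M" "c h \<in> Lp_functions p N" using MD(8) ND(8) h by auto
    have bh': "(\<lambda>x. B h (\<iota> x)) \<in> Lp_functions p M" "(\<lambda>x. B h (\<kappa> x)) \<in> Lp_functions p N"
      using Lp_gl[OF bh] by (auto simp: Lp B_def)
    have 1: "AE x in M. T g (\<lambda>x. B h (\<iota> x)) x = T g (b h) x"
      by (rule MD(3)[OF g bh'(1) bh(1)]) (auto simp: gl B_def)
    have 2: "AE x in N. S g (\<lambda>x. B h (\<kappa> x)) x = S g (c h) x"
      by (rule ND(3)[OF g bh'(2) bh(2)]) (auto simp: gl B_def)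
    have "AE x in M. B (g \<otimes>\<^bsub>G\<^esub> h) (\<iota> x) =
            ?gl (T g (\<lambda>x. B h (\<iota> x))) (S g (\<lambda>x. B h (\<kappa> x))) (\<iota> x) + B g (\<iota> x)"
      using AE_space 1 MD(10)[OF g h] by eventually_elim (simp add: gl B_def)
    moreover have "AE x in N. B (g \<otimes>\<^bsub>G\<^esub> h) (\<kappa> x) =
            ?gl (T g (\<lambda>x. B h (\<iota> x))) (S g (\<lambda>x. B h (\<kappa> x))) (\<kappa> x) + B g (\<kappa> x)"
      using AE_space 2 ND(10)[OF g h] by eventually_elim (simp add: gl B_def)
    ultimately show "AE x in ?K. B (g \<otimes>\<^bsub>G\<^esub> h) x =
            ?gl (T g (\<lambda>x. B h (\<iota> x))) (S g (\<lambda>x. B h (\<kappa> x))) x + B g x"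
      unfolding AE_gl by simp
  next
    fix f :: "_ \<Rightarrow> 'k" assume f: "f \<in> Lp_functions p ?K"
    have 1: "AE x in M. ?TS \<one>\<^bsub>G\<^esub> f (\<iota> x) = f (\<iota> x)"
      using AE_space MD(6)[of "\<lambda>x. f (\<iota> x)"] f by (auto simp: Lp gl elim!: eventually_elim2)
    have 2: "AE x in N. ?TS \<one>\<^bsub>G\<^esub> f (\<kappa> x) = f (\<kappa> x)"
      using AE_space ND(6)[of "\<lambda>x. f (\<kappa> x)"] f by (auto simp: Lp gl elim!: eventually_elim2)
    show "AE x in ?K. ?TS \<one>\<^bsub>G\<^esub> f x = f x"
      using 1 2 by (simp add: AE_gl)
  next
    fix g and f f' :: "_ \<Rightarrow> 'k" assume g: "g \<in> carrier G" and f: "f \<in> Lp_functions p ?K" "f' \<in> Lp_functions p ?K"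
    have 1: "AE x in M. T g (\<lambda>x. f (\<iota> x) + f' (\<iota> x)) x = T g (\<lambda>x. f (\<iota> x)) x + T g (\<lambda>x. f' (\<iota> x)) x"
      using f g by (intro MD(4)) (auto simp: Lp)
    have 2: "AE x in N. S g (\<lambda>x. f (\<kappa> x) + f' (\<kappa> x)) x = S g (\<lambda>x. f (\<kappa> x)) x + S g (\<lambda>x. f' (\<kappa> x)) x"
      using f g by (intro ND(4)) (auto simp: Lp)
    show "AE x in ?K. ?gl (T g (\<lambda>x. f (\<iota> x) + f' (\<iota> x))) (S g (\<lambda>x. f (\<kappa> x) + f' (\<kappa> x))) x =
       ?TS g f x + ?TS g f' x"
      unfolding AE_gl using AE_space[of M] AE_space[of N] 1 2
      by (auto elim!: eventually_elim2 simp: gl)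
    assume "AE x in ?K. f x = f' x"
    then have eq: "AE x in M. f (\<iota> x) = f' (\<iota> x)" "AE x in N. f (\<kappa> x) = f' (\<kappa> x)"
      by (simp_all add: AE_gl)
    have 3: "AE x in M. T g (\<lambda>x. f (\<iota> x)) x = T g (\<lambda>x. f' (\<iota> x)) x"
      by (rule MD(3)[OF g _ _ eq(1)]) (use f in \<open>auto simp: Lp\<close>)
    have 4: "AE x in N. S g (\<lambda>x. f (\<kappa> x)) x = S g (\<lambda>x. f' (\<kappa> x)) x"
      by (rule ND(3)[OF g _ _ eq(2)]) (use f in \<open>auto simp: Lp\<close>)
    show "AE x in ?K. ?TS g f x =
        ?TS g f' x"
      unfolding AE_gl using AE_space[of M] AE_space[of N] 3 4
      by (auto elim!: eventually_elim2 simp: gl)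
  next
    fix g a and f :: "_ \<Rightarrow> 'k" assume g: "g \<in> carrier G" and f: "f \<in> Lp_functions p ?K"
    have 1: "AE x in M. T g (\<lambda>x. a * f (\<iota> x)) x = a * T g (\<lambda>x. f (\<iota> x)) x"
      using f g by (intro MD(5)) (auto simp: Lp)
    have 2: "AE x in N. S g (\<lambda>x. a * f (\<kappa> x)) x = a * S g (\<lambda>x. f (\<kappa> x)) x"
      using f g by (intro ND(5)) (auto simp: Lp)
    show "AE x in ?K. ?gl (T g (\<lambda>x. a * f (\<iota> x))) (S g (\<lambda>x. a * f (\<kappa> x))) x =
       a * ?TS g f x"
      unfolding AE_gl using AE_space[of M] AE_space[of N] 1 2
      by (auto elim!: eventually_elim2 simp: gl)
  next
    show "AE x in ?K. B \<one>\<^bsub>G\<^esub> x = 0"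
      unfolding AE_gl B_def using AE_space[of M] AE_space[of N] MD(9) ND(9)
      by (auto elim!: eventually_elim2 simp: gl)
  next
    fix g and f :: "_ \<Rightarrow> 'k" assume g: "g \<in> carrier G" and f: "f \<in> Lp_functions p ?K"
    have uv: "T g (\<lambda>x. f (\<iota> x)) \<in> Lp_functions p M" "S g (\<lambda>x. f (\<kappa> x)) \<in> Lp_functions p N"
      using f g by (auto simp: Lp MD(1) ND(1))
    show "?TS g f \<in> Lp_functions p ?K"
      by (rule Lp_gl[OF uv])
    show "Lp_mass p ?K (?TS g f) = Lp_mass p ?K f"
      using f g MD(2) ND(2) by (simp add: mass_gl[OF uv] mass Lp_functions_measurable) (simp add: Lp)
  next
    fix g assume g: "g \<in> carrier G"
    show "B g \<in> Lp_functions p ?K" unfolding B_def by (rule Lp_gl[OF MD(8)[OF g] ND(8)[OF g]])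
  qed
qed

section \<open>Coordinatewise actions\<close>

lemma measurable_countable_slices_iff:
  assumes "countable I"
  shows "f \<in> measurable (M \<Otimes>\<^sub>M count_space I) K \<longleftrightarrow> (\<forall>i\<in>I. (\<lambda>x. f (x, i)) \<in> measurable M K)"
proof
  assume "f \<in> measurable (M \<Otimes>\<^sub>M count_space I) K"
  then show "\<forall>i\<in>I. (\<lambda>x. f (x, i)) \<in> measurable M K"
    by (auto intro: measurable_compose[OF measurable_Pair2'])
next
  assume *: "\<forall>i\<in>I. (\<lambda>x. f (x, i)) \<in> measurable M K"
  have "(\<lambda>z. (\<lambda>i z. f (fst z, i)) (snd z) z) \<in> measurable (M \<Otimes>\<^sub>M count_space I) K"
    by (rule measurable_compose_countable'[where I = I])
       (use * assms in \<open>auto intro: measurable_compose[OF measurable_fst]\<close>)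
  then show "f \<in> measurable (M \<Otimes>\<^sub>M count_space I) K" by simp
qed

lemma nn_integral_countable_slices:
  assumes I: "countable I" and f: "f \<in> borel_measurable (M \<Otimes>\<^sub>M count_space I)"
  shows "(\<integral>\<^sup>+z. f z \<partial>(M \<Otimes>\<^sub>M count_space I)) = (\<integral>\<^sup>+i. (\<integral>\<^sup>+x. f (x, i) \<partial>M) \<partial>count_space I)"
proof -
  interpret sigma_finite_measure "count_space I" by (rule sigma_finite_measure_count_space_countable[OF I])
  have "(\<integral>\<^sup>+z. f z \<partial>(M \<Otimes>\<^sub>M count_space I)) = (\<integral>\<^sup>+x. \<integral>\<^sup>+i. f (x, i) \<partial>count_space I \<partial>M)"
    by (rule nn_integral_fst[symmetric, OF f])
  also have "\<dots> = (\<integral>\<^sup>+i. (\<integral>\<^sup>+x. f (x, i) \<partial>M) \<partial>count_space I)"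
    using f I by (intro nn_integral_count_space_nn_integral) (simp_all add: measurable_countable_slices_iff)
  finally show ?thesis .
qed

lemma AE_countable_slices_iff:
  assumes I: "countable I"
  shows "(AE z in M \<Otimes>\<^sub>M count_space I. P z) \<longleftrightarrow> (\<forall>i\<in>I. AE x in M. P (x, i))"
proof (intro iffI ballI)
  fix i assume P: "AE z in M \<Otimes>\<^sub>M count_space I. P z" and i: "i \<in> I"
  from P obtain A where A: "{z \<in> space (M \<Otimes>\<^sub>M count_space I). \<not> P z} \<subseteq> A"
    "emeasure (M \<Otimes>\<^sub>M count_space I) A = 0" "A \<in> sets (M \<Otimes>\<^sub>M count_space I)"
    by (rule AE_E)
  have "(\<integral>\<^sup>+i. (\<integral>\<^sup>+x. indicator A (x, i) \<partial>M) \<partial>count_space I) = 0"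
    using A(2,3) by (subst nn_integral_countable_slices[OF I, symmetric]) auto
  then have "(\<integral>\<^sup>+x. indicator A (x, i) \<partial>M) = 0"
    using i nn_integral_ge_point[OF i, of "\<lambda>i. \<integral>\<^sup>+x. indicator A (x, i) \<partial>M"] by simp
  moreover have "(\<lambda>x. indicator A (x, i) :: ennreal) \<in> borel_measurable M"
    using A(3) i measurable_countable_slices_iff[OF I, of "indicator A :: _ \<Rightarrow> ennreal" M borel] by simp
  ultimately have "AE x in M. indicator A (x, i) = (0 :: ennreal)"
    by (simp add: nn_integral_0_iff_AE)
  then show "AE x in M. P (x, i)"
    using AE_space by eventually_elim (use A(1) i in \<open>auto simp: space_pair_measure indicator_def split: if_splits\<close>)
next
  assume P: "\<forall>i\<in>I. AE x in M. P (x, i)"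
  have "AE x in M. \<forall>i\<in>I. P (x, i)" using P by (simp add: AE_ball_countable[OF I])
  then obtain A where A: "{x \<in> space M. \<not> (\<forall>i\<in>I. P (x, i))} \<subseteq> A" "emeasure M A = 0" "A \<in> sets M"
    by (rule AE_E)
  interpret sigma_finite_measure "count_space I" by (rule sigma_finite_measure_count_space_countable[OF I])
  show "AE z in M \<Otimes>\<^sub>M count_space I. P z"
    by (rule AE_I[where N = "A \<times> I"]) (use A in \<open>auto simp: emeasure_pair_measure_Times space_pair_measure\<close>)
qed

text \<open>
  The hypotheses on \<open>w\<close> say that \<open>g \<mapsto> w g\<close> is a cocycle with values in the finitely supported families
  in \<open>H\<close>. The translation part has finite mass because \<open>b \<one>\<close> vanishes, so that only the coordinates in
  the finite support of \<open>w g\<close> contribute.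
\<close>

lemma Lp_action_coordinatewise:
  fixes \<Gamma> :: "('c, 'd) monoid_scheme" and H :: "('h, 'e) monoid_scheme" and M :: "'x measure"
    and b :: "'h \<Rightarrow> 'x \<Rightarrow> 'k::{real_normed_field, euclidean_space}" and I :: "'i set"
  assumes H: "Lp_action H p M T b" and \<Gamma>: "group \<Gamma>" and gH: "group H" and I: "countable I"
    and act: "\<And>g i. g \<in> carrier \<Gamma> \<Longrightarrow> i \<in> I \<Longrightarrow> act g i \<in> I"
    and act_one: "\<And>i. i \<in> I \<Longrightarrow> act \<one>\<^bsub>\<Gamma>\<^esub> i = i"
    and act_mult: "\<And>g h i. g \<in> carrier \<Gamma> \<Longrightarrow> h \<in> carrier \<Gamma> \<Longrightarrow> i \<in> I \<Longrightarrow> act (g \<otimes>\<^bsub>\<Gamma>\<^esub> h) i = act g (act h i)"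
    and w: "\<And>g i. g \<in> carrier \<Gamma> \<Longrightarrow> i \<in> I \<Longrightarrow> w g i \<in> carrier H"
    and w_one: "\<And>i. i \<in> I \<Longrightarrow> w \<one>\<^bsub>\<Gamma>\<^esub> i = \<one>\<^bsub>H\<^esub>"
    and w_mult: "\<And>g h i. g \<in> carrier \<Gamma> \<Longrightarrow> h \<in> carrier \<Gamma> \<Longrightarrow> i \<in> I \<Longrightarrow>
        w (g \<otimes>\<^bsub>\<Gamma>\<^esub> h) i = w g i \<otimes>\<^bsub>H\<^esub> w h (act (inv\<^bsub>\<Gamma>\<^esub> g) i)"
    and w_fin: "\<And>g. g \<in> carrier \<Gamma> \<Longrightarrow> finite {i \<in> I. w g i \<noteq> \<one>\<^bsub>H\<^esub>}"
  defines "S \<equiv> \<lambda>g f z. T (w g (snd z)) (\<lambda>x. f (x, act (inv\<^bsub>\<Gamma>\<^esub> g) (snd z))) (fst z)"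
    and "c \<equiv> \<lambda>g z. b (w g (snd z)) (fst z)"
  shows "Lp_action \<Gamma> p (M \<Otimes>\<^sub>M count_space I) S c"
    and "\<And>g i. g \<in> carrier \<Gamma> \<Longrightarrow> i \<in> I \<Longrightarrow> Lp_mass p M (b (w g i)) \<le> Lp_mass p (M \<Otimes>\<^sub>M count_space I) (c g)"
proof -
  interpret \<Gamma>: group \<Gamma> by fact
  interpret H: group H by fact
  let ?N = "M \<Otimes>\<^sub>M count_space I"
  note D = Lp_actionD[OF H]
  note AE_iff = AE_countable_slices_iff[OF I] and meas_iff = measurable_countable_slices_iff[OF I]
  have mass: "Lp_mass p ?N f = (\<integral>\<^sup>+i. Lp_mass p M (\<lambda>x. f (x, i)) \<partial>count_space I)"
    if "f \<in> borel_measurable ?N" for f :: "_ \<Rightarrow> 'k"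
    unfolding Lp_mass_def by (rule nn_integral_countable_slices[OF I]) (use that in measurable)
  have slice_mass: "Lp_mass p M (\<lambda>x. f (x, i)) \<le> Lp_mass p ?N f"
    if "f \<in> borel_measurable ?N" "i \<in> I" for f :: "_ \<Rightarrow> 'k" and i
    unfolding mass[OF that(1)] by (rule nn_integral_ge_point[OF that(2)])
  have slice: "(\<lambda>x. f (x, i)) \<in> Lp_functions p M" if "f \<in> Lp_functions p ?N" "i \<in> I" for f :: "_ \<Rightarrow> 'k" and i
    using that slice_mass[of f i] by (auto simp: Lp_functions_iff_mass meas_iff intro: le_less_trans)
  have ai: "act (inv\<^bsub>\<Gamma>\<^esub> g) i \<in> I" if "g \<in> carrier \<Gamma>" "i \<in> I" for g i using act that by simp
  have bij: "bij_betw (act (inv\<^bsub>\<Gamma>\<^esub> g)) I I" if g: "g \<in> carrier \<Gamma>" for g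
  proof (rule bij_betw_byWitness[where f' = "act g"])
    show "\<forall>i\<in>I. act g (act (inv\<^bsub>\<Gamma>\<^esub> g) i) = i" "\<forall>i\<in>I. act (inv\<^bsub>\<Gamma>\<^esub> g) (act g i) = i"
      using g by (auto simp: act_one simp flip: act_mult)
  qed (use g act in auto)
  have meas_S: "S g f \<in> borel_measurable ?N" if "g \<in> carrier \<Gamma>" "f \<in> Lp_functions p ?N" for g f
    unfolding meas_iff S_def using that
    by (auto intro!: Lp_functions_measurable D(1) slice w ai)
  have mass_S: "Lp_mass p ?N (S g f) = Lp_mass p ?N f" if g: "g \<in> carrier \<Gamma>" and f: "f \<in> Lp_functions p ?N" for g f
  proof -
    have "Lp_mass p ?N (S g f) = (\<integral>\<^sup>+i. Lp_mass p M (\<lambda>x. f (x, act (inv\<^bsub>\<Gamma>\<^esub> g) i)) \<partial>count_space I)"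
      unfolding mass[OF meas_S[OF g f]]
      by (intro nn_integral_cong) (use g f in \<open>auto simp: S_def intro!: D(2) slice w ai\<close>)
    also have "\<dots> = (\<integral>\<^sup>+i. Lp_mass p M (\<lambda>x. f (x, i)) \<partial>count_space I)"
      by (rule nn_integral_bij_count_space[OF bij[OF g]])
    finally show ?thesis using f by (simp add: mass Lp_functions_measurable)
  qed
  have meas_c: "c g \<in> borel_measurable ?N" if "g \<in> carrier \<Gamma>" for g
    unfolding meas_iff c_def using that by (auto intro!: Lp_functions_measurable D(8) w)
  have fin_c: "Lp_mass p ?N (c g) < \<infinity>" if g: "g \<in> carrier \<Gamma>" for g
  proof -
    have zero: "Lp_mass p M (b \<one>\<^bsub>H\<^esub>) = 0"
      using Lp_mass_cong_AE[of "b \<one>\<^bsub>H\<^esub>" "\<lambda>_. 0" M p] D(9) by (simp add: Lp_mass_def)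
    have "Lp_mass p ?N (c g) = (\<Sum>i\<in>{i \<in> I. w g i \<noteq> \<one>\<^bsub>H\<^esub>}. Lp_mass p M (b (w g i)))"
      unfolding mass[OF meas_c[OF g]]
      by (subst nn_integral_count_space'[where A = "{i \<in> I. w g i \<noteq> \<one>\<^bsub>H\<^esub>}"])
         (use w_fin[OF g] zero in \<open>auto simp: c_def\<close>)
    also have "\<dots> < \<infinity>"
      using D(8)[OF w[OF g]] w_fin[OF g] by (simp add: Lp_functions_iff_mass)
    finally show ?thesis .
  qed
  show "Lp_mass p M (b (w g i)) \<le> Lp_mass p ?N (c g)" if "g \<in> carrier \<Gamma>" "i \<in> I" for g i
    using slice_mass[OF meas_c[OF that(1)] that(2)] by (simp add: c_def)
  show "Lp_action \<Gamma> p ?N S c"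
    unfolding Lp_action_def
  proof (intro conjI ballI allI impI)
    fix g and f f' :: "_ \<Rightarrow> 'k" assume g: "g \<in> carrier \<Gamma>" and f: "f \<in> Lp_functions p ?N" "f' \<in> Lp_functions p ?N"
    show "AE z in ?N. S g (\<lambda>z. f z + f' z) z = S g f z + S g f' z"
      unfolding AE_iff by (auto simp: S_def intro!: D(4) slice f w ai g)
    assume "AE z in ?N. f z = f' z"
    then have eq: "\<And>i. i \<in> I \<Longrightarrow> AE x in M. f (x, i) = f' (x, i)" unfolding AE_iff by blast
    show "AE z in ?N. S g f z = S g f' z"
      unfolding AE_iff by (simp add: S_def) (intro ballI D(3) slice f w ai g eq)
  next
    fix g a and f :: "_ \<Rightarrow> 'k" assume g: "g \<in> carrier \<Gamma>" and f: "f \<in> Lp_functions p ?N"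
    show "AE z in ?N. S g (\<lambda>z. a * f z) z = a * S g f z"
      unfolding AE_iff by (simp add: S_def) (intro ballI D(5) slice f w ai g)
    show "S g f \<in> Lp_functions p ?N"
      using g f mass_S[OF g f] meas_S[OF g f] by (simp add: Lp_functions_iff_mass)
    show "Lp_mass p ?N (S g f) = Lp_mass p ?N f" by (rule mass_S[OF g f])
  next
    fix f :: "_ \<Rightarrow> 'k" assume f: "f \<in> Lp_functions p ?N"
    show "AE z in ?N. S \<one>\<^bsub>\<Gamma>\<^esub> f z = f z"
      unfolding AE_iff by (simp add: S_def w_one act_one) (intro ballI D(6) slice f)
  next
    fix g h and f :: "_ \<Rightarrow> 'k" assume g: "g \<in> carrier \<Gamma>" and h: "h \<in> carrier \<Gamma>" and f: "f \<in> Lp_functions p ?N"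
    show "AE z in ?N. S (g \<otimes>\<^bsub>\<Gamma>\<^esub> h) f z = S g (S h f) z"
      unfolding AE_iff
    proof
      fix i assume i: "i \<in> I"
      have "AE x in M. T (w g i \<otimes>\<^bsub>H\<^esub> w h (act (inv\<^bsub>\<Gamma>\<^esub> g) i)) (\<lambda>x. f (x, act (inv\<^bsub>\<Gamma>\<^esub> h) (act (inv\<^bsub>\<Gamma>\<^esub> g) i))) x
         = T (w g i) (T (w h (act (inv\<^bsub>\<Gamma>\<^esub> g) i)) (\<lambda>x. f (x, act (inv\<^bsub>\<Gamma>\<^esub> h) (act (inv\<^bsub>\<Gamma>\<^esub> g) i)))) x"
        by (intro D(7) slice f w ai g h i)
      then show "AE x in M. S (g \<otimes>\<^bsub>\<Gamma>\<^esub> h) f (x, i) = S g (S h f) (x, i)"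
        using g h i by (simp add: S_def w_mult \<Gamma>.inv_mult_group act_mult)
    qed
  next
    fix g assume g: "g \<in> carrier \<Gamma>"
    show "c g \<in> Lp_functions p ?N" using meas_c[OF g] fin_c[OF g] by (simp add: Lp_functions_iff_mass)
  next
    show "AE z in ?N. c \<one>\<^bsub>\<Gamma>\<^esub> z = 0"
      unfolding AE_iff using D(9) by (simp add: c_def w_one)
  next
    fix g h assume g: "g \<in> carrier \<Gamma>" and h: "h \<in> carrier \<Gamma>"
    show "AE z in ?N. c (g \<otimes>\<^bsub>\<Gamma>\<^esub> h) z = S g (c h) z + c g z"
      unfolding AE_iff
    proof
      fix i assume i: "i \<in> I"
      show "AE x in M. c (g \<otimes>\<^bsub>\<Gamma>\<^esub> h) (x, i) = S g (c h) (x, i) + c g (x, i)"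
        using D(10)[OF w[OF g i] w[OF h ai[OF g i]]] g h i by (simp add: S_def c_def w_mult)
    qed
  qed
qed

section \<open>Hilbert coordinates of conditionally negative definite kernels\<close>

definition psd_kernel :: "(nat \<Rightarrow> nat \<Rightarrow> real) \<Rightarrow> bool" where
  "psd_kernel K \<longleftrightarrow> (\<forall>i j. K i j = K j i) \<and>
     (\<forall>F x. finite F \<longrightarrow> 0 \<le> (\<Sum>i\<in>F. \<Sum>j\<in>F. x i * x j * K i j))"

lemma psd_kernelD:
  "psd_kernel K \<Longrightarrow> finite F \<Longrightarrow> 0 \<le> (\<Sum>i\<in>F. \<Sum>j\<in>F. x i * x j * K i j)"
  unfolding psd_kernel_def by simp

lemma psd_kernel_diagonal: "psd_kernel K \<Longrightarrow> 0 \<le> K k k"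
  unfolding psd_kernel_def by (elim conjE allE[of _ "{k}"] allE[of _ "\<lambda>_. 1"]) simp

text \<open>
  On the vector that is \<open>1\<close> at \<open>i\<close> and \<open>t\<close> at \<open>k\<close> the quadratic form is \<open>K i i + 2 * t * K i k\<close>; it is
  affine in \<open>t\<close> and bounded below, hence constant.
\<close>

lemma psd_kernel_zero_pivot:
  assumes K: "psd_kernel K" and z: "K k k = 0"
  shows "K i k = 0"
proof (rule ccontr)
  assume nz: "K i k \<noteq> 0"
  with z have ik: "i \<noteq> k" by auto
  \<comment> \<open>The value of \<open>t\<close> at which the quadratic form equals \<open>-1\<close>.\<close>
  define t where "t = - (K i i + 1) / (2 * K i k)"
  have sym: "K k i = K i k" using K by (simp add: psd_kernel_def)
  have "0 \<le> (\<Sum>a\<in>{i, k}. \<Sum>b\<in>{i, k}. (if a = i then 1 else t) * (if b = i then 1 else t) * K a b)"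
    using K unfolding psd_kernel_def by (elim conjE allE[of _ "{i, k}"] allE[of _ "\<lambda>a. if a = i then 1 else t"]) simp
  also have "\<dots> = K i i + 2 * t * K i k"
    using ik z sym by (simp add: algebra_simps)
  also have "\<dots> = -1" using nz by (simp add: t_def field_simps)
  finally show False by simp
qed

text \<open>
  The form of the Schur complement at \<open>x\<close> is the minimum of the form of \<open>K\<close> over all vectors that differ
  from \<open>x\<close> by a multiple of the \<open>k\<close>-th unit vector; the minimum is attained when \<open>B / K k k\<close> times that
  unit vector is subtracted.
\<close>

lemma psd_kernel_Schur_complement:
  assumes K: "psd_kernel K"
  shows "psd_kernel (\<lambda>i j. K i j - K i k * K j k / K k k)"
proof (cases "K k k = 0")
  case True then show ?thesis using K by simp
next
  case False
  with psd_kernel_diagonal[OF K] have pos: "K k k > 0" by (simp add: order_less_le)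
  have sym: "\<And>i j. K i j = K j i" using K by (simp add: psd_kernel_def)
  show ?thesis unfolding psd_kernel_def
  proof (intro conjI allI impI)
    show "K i j - K i k * K j k / K k k = K j i - K j k * K i k / K k k" for i j
      by (simp add: sym[of i j])
    fix F :: "nat set" and x :: "nat \<Rightarrow> real" assume F: "finite F"
    define G where "G = insert k F"
    define u where "u i = (if i \<in> F then x i else 0)" for i
    define B where "B = (\<Sum>i\<in>G. u i * K i k)"
    define d where "d i = (if i = k then B / K k k else 0)" for i
    have G: "finite G" "k \<in> G" "F \<subseteq> G" using F by (auto simp: G_def)
    have FG: "(\<Sum>i\<in>F. x i * f i) = (\<Sum>i\<in>G. u i * f i)" for f :: "nat \<Rightarrow> real"
      using G by (intro sum.mono_neutral_cong_left) (auto simp: u_def G_def)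
    have dG: "(\<Sum>i\<in>G. d i * f i) = B / K k k * f k" for f :: "nat \<Rightarrow> real"
      using G by (simp add: d_def if_distrib[of "\<lambda>c. c * _"] cong: if_cong)
    have "0 \<le> (\<Sum>i\<in>G. \<Sum>j\<in>G. (u i - d i) * (u j - d j) * K i j)"
      using psd_kernelD[OF K G(1), of "\<lambda>i. u i - d i"] .
    also have "\<dots> = (\<Sum>i\<in>G. u i * (\<Sum>j\<in>G. u j * K i j)) - (\<Sum>i\<in>G. u i * (\<Sum>j\<in>G. d j * K i j))
        - (\<Sum>i\<in>G. d i * (\<Sum>j\<in>G. u j * K i j)) + (\<Sum>i\<in>G. d i * (\<Sum>j\<in>G. d j * K i j))"
      by (simp add: sum_distrib_left sum_subtractf sum.distrib algebra_simps)
    also have "(\<Sum>i\<in>G. u i * (\<Sum>j\<in>G. d j * K i j)) = B / K k k * B"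
      by (simp add: dG) (simp add: B_def sum_distrib_left sum_divide_distrib algebra_simps)
    also have "(\<Sum>i\<in>G. d i * (\<Sum>j\<in>G. u j * K i j)) = B / K k k * B"
    proof -
      have "(\<Sum>j\<in>G. u j * K k j) = B" unfolding B_def by (intro sum.cong refl) (metis sym)
      then show ?thesis by (simp add: dG)
    qed
    also have "(\<Sum>i\<in>G. d i * (\<Sum>j\<in>G. d j * K i j)) = B / K k k * B"
      using pos by (simp only: dG) simp
    also have "(\<Sum>i\<in>G. u i * (\<Sum>j\<in>G. u j * K i j)) - B / K k k * B - B / K k k * B + B / K k k * B
       = (\<Sum>i\<in>G. u i * (\<Sum>j\<in>G. u j * K i j)) - (\<Sum>i\<in>G. u i * (\<Sum>j\<in>G. u j * (K i k * K j k / K k k)))"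
    proof -
      have "(\<Sum>j\<in>G. u j * (K i k * K j k / K k k)) = K i k * (B / K k k)" for i
        unfolding B_def sum_divide_distrib sum_distrib_left by (simp add: mult_ac)
      then have "(\<Sum>i\<in>G. u i * (\<Sum>j\<in>G. u j * (K i k * K j k / K k k))) = (\<Sum>i\<in>G. (u i * K i k) * (B / K k k))"
        by (simp only: mult.assoc)
      also have "\<dots> = B * (B / K k k)"
        by (subst sum_distrib_right[symmetric]) (simp only: B_def)
      finally show ?thesis by simp
    qed
    also have "\<dots> = (\<Sum>i\<in>F. x i * (\<Sum>j\<in>F. x j * (K i j - K i k * K j k / K k k)))"
      by (simp only: FG sum_subtractf right_diff_distrib)
    also have "\<dots> = (\<Sum>i\<in>F. \<Sum>j\<in>F. x i * x j * (K i j - K i k * K j k / K k k))"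
      by (simp add: sum_distrib_left mult.assoc)
    finally show "0 \<le> \<dots>" .
  qed
qed

text \<open>
  What remains of \<open>K\<close> after the pivots before \<open>k\<close> have been eliminated. At a zero pivot the convention
  \<open>x / 0 = 0\<close> makes the elimination do nothing, which is correct since the row and the column of that
  pivot already vanish.
\<close>

fun schur :: "(nat \<Rightarrow> nat \<Rightarrow> real) \<Rightarrow> nat \<Rightarrow> nat \<Rightarrow> nat \<Rightarrow> real" where
  "schur K 0 i j = K i j"
| "schur K (Suc k) i j = schur K k i j - schur K k i k * schur K k j k / schur K k k k"

text \<open>
  Elimination of the pivots one after the other: each step splits off one column \<open>c\<close>, and row \<open>i\<close> of the
  remainder is zero as soon as pivot \<open>i\<close> has been eliminated.
\<close>

lemma psd_kernel_Cholesky: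
  assumes K: "psd_kernel K"
  obtains c :: "nat \<Rightarrow> nat \<Rightarrow> real" where
    "\<And>i k. i < k \<Longrightarrow> c i k = 0"
    "\<And>i j n. i < n \<Longrightarrow> K i j = (\<Sum>k<n. c i k * c j k)"
proof -
  let ?S = "schur K"
  have psd: "psd_kernel (?S k)" for k
  proof (induction k)
    case 0
    have "?S 0 = K" by (intro ext) simp
    then show ?case using K by simp
  next
    case (Suc k)
    have "?S (Suc k) = (\<lambda>i j. ?S k i j - ?S k i k * ?S k j k / ?S k k k)" by (intro ext) simp
    then show ?case using psd_kernel_Schur_complement[OF Suc] by simp
  qed
  have sym: "?S k i j = ?S k j i" for k i j using psd[of k] by (simp add: psd_kernel_def)
  have zero: "i < k \<Longrightarrow> ?S k i j = 0" for i j k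
  proof (induction k arbitrary: i j)
    case (Suc k)
    show ?case
    proof (cases "i < k")
      case True then show ?thesis using Suc.IH by simp
    next
      case False
      then have "i = k" using Suc.prems by simp
      then show ?thesis
        using psd_kernel_zero_pivot[OF psd[of k], where k = k and i = j] sym[of k k j] by (cases "?S k k k = 0") auto
    qed
  qed simp
  define c where "c i k = ?S k i k / sqrt (?S k k k)" for i k
  have cc: "c i k * c j k = ?S k i k * ?S k j k / ?S k k k" for i j k
    using psd_kernel_diagonal[OF psd, of k k] by (simp add: c_def)
  have dec: "K i j = (\<Sum>k<n. c i k * c j k) + ?S n i j" for i j n
    by (induction n) (auto simp: cc)
  show ?thesis
  proof (rule that)
    show "c i k = 0" if "i < k" for i k using zero[OF that] by (simp add: c_def)
    show "K i j = (\<Sum>k<n. c i k * c j k)" if "i < n" for i j n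
      using dec[of i j n] zero[OF that] by simp
  qed
qed

text \<open>
  Schoenberg's embedding into a Hilbert space. After choice of a base point, twice the prospective inner
  products \<open>\<psi> x o + \<psi> y o - \<psi> x y\<close> form a positive semidefinite kernel, because any system of weights
  becomes one of total weight zero when the missing weight is put on the base point. The Cholesky factor
  gives finitely many coordinates for every point, so that Gaussian variables indexed by \<open>X\<close> will be
  finite sums.
\<close>

lemma cond_neg_def_kernel_coordinates:
  assumes X: "countable X" and \<psi>: "cond_neg_def_kernel X \<psi>"
  shows "\<exists>(a :: 'x \<Rightarrow> nat \<Rightarrow> real) (N :: 'x \<Rightarrow> nat). (\<forall>x. \<forall>k\<ge>N x. a x k = 0) \<and>
    (\<forall>x\<in>X. \<forall>y\<in>X. \<forall>n. N x \<le> n \<longrightarrow> N y \<le> n \<longrightarrow> (\<Sum>k<n. (a x k - a y k)\<^sup>2) = \<psi> x y)"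
proof (cases "X = {}")
  case True then show ?thesis by (intro exI[of _ "\<lambda>_ _. 0"] exI[of _ "\<lambda>_. 0"]) simp
next
  case False
  then obtain o' where o: "o' \<in> X" by auto
  have diag: "\<And>x. x \<in> X \<Longrightarrow> \<psi> x x = 0" and sym: "\<And>x y. x \<in> X \<Longrightarrow> y \<in> X \<Longrightarrow> \<psi> x y = \<psi> y x"
    and neg: "\<And>F c. finite F \<Longrightarrow> F \<subseteq> X \<Longrightarrow> sum c F = 0 \<Longrightarrow> (\<Sum>i\<in>F. \<Sum>j\<in>F. c i * c j * \<psi> i j) \<le> 0"
    using \<psi> unfolding cond_neg_def_kernel_def by blast+
  define e where "e = to_nat_on X"
  define f where "f = from_nat_into X"
  have fX: "f n \<in> X" for n using False by (simp add: f_def from_nat_into)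
  have fe: "x \<in> X \<Longrightarrow> f (e x) = x" for x using X by (simp add: f_def e_def)
  \<comment> \<open>The points of \<open>X\<close> are listed by \<open>f\<close>, with repetitions if \<open>X\<close> is finite; then several indices of a
      sum belong to the same point, and their weights are collected in \<open>v\<close>.\<close>
  define K where "K i j = \<psi> (f i) o' + \<psi> (f j) o' - \<psi> (f i) (f j)" for i j
  have "psd_kernel K" unfolding psd_kernel_def
  proof (intro conjI allI impI)
    show "K i j = K j i" for i j using sym[OF fX fX, of i j] by (simp add: K_def)
    fix F :: "nat set" and x :: "nat \<Rightarrow> real" assume F: "finite F"
    define E where "E = insert o' (f ` F)"
    define s where "s = sum x F"
    define v where "v z = (\<Sum>i\<in>{i\<in>F. f i = z}. x i)" for z
    define w where "w z = v z - (if z = o' then s else 0)" for z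
    have E: "finite E" "E \<subseteq> X" "o' \<in> E" "f ` F \<subseteq> E" using F fX o by (auto simp: E_def)
    have v: "(\<Sum>z\<in>E. v z * h z) = (\<Sum>i\<in>F. x i * h (f i))" for h :: "_ \<Rightarrow> real"
    proof -
      have "(\<Sum>z\<in>E. v z * h z) = (\<Sum>z\<in>E. \<Sum>i\<in>{i\<in>F. f i = z}. x i * h (f i))"
        unfolding v_def sum_distrib_right by (intro sum.cong refl) auto
      also have "\<dots> = (\<Sum>i\<in>F. x i * h (f i))" using F E by (intro sum.group) auto
      finally show ?thesis .
    qed
    have w: "(\<Sum>z\<in>E. w z * h z) = (\<Sum>i\<in>F. x i * h (f i)) - s * h o'" for h :: "_ \<Rightarrow> real"
      using E by (simp add: w_def left_diff_distrib sum_subtractf v if_distrib[of "\<lambda>c. c * _"] cong: if_cong)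
    have "(\<Sum>z\<in>E. w z) = 0" using w[of "\<lambda>_. 1"] by (simp add: s_def)
    then have "(\<Sum>y\<in>E. \<Sum>z\<in>E. w y * w z * \<psi> y z) \<le> 0" by (rule neg[OF E(1,2)])
    also have "(\<Sum>y\<in>E. \<Sum>z\<in>E. w y * w z * \<psi> y z) = (\<Sum>y\<in>E. w y * (\<Sum>z\<in>E. w z * \<psi> y z))"
      by (simp add: sum_distrib_left mult.assoc)
    also have "\<dots> = (\<Sum>i\<in>F. x i * ((\<Sum>j\<in>F. x j * \<psi> (f i) (f j)) - s * \<psi> (f i) o'))
        - s * ((\<Sum>j\<in>F. x j * \<psi> o' (f j)) - s * \<psi> o' o')"
      by (simp only: w)
    also have "\<dots> = (\<Sum>i\<in>F. \<Sum>j\<in>F. x i * x j * \<psi> (f i) (f j)) - 2 * (s * (\<Sum>i\<in>F. x i * \<psi> (f i) o'))"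
      using diag[OF o] sym[OF o fX]
      by (simp add: right_diff_distrib sum_subtractf sum_distrib_left algebra_simps)
    also have "\<dots> = - (\<Sum>i\<in>F. \<Sum>j\<in>F. x i * x j * K i j)"
    proof -
      have 1: "(\<Sum>i\<in>F. \<Sum>j\<in>F. x i * x j * \<psi> (f i) o') = s * (\<Sum>i\<in>F. x i * \<psi> (f i) o')"
        unfolding s_def sum_product by (subst sum.swap) (simp add: mult_ac)
      have 2: "(\<Sum>i\<in>F. \<Sum>j\<in>F. x i * x j * \<psi> (f j) o') = s * (\<Sum>i\<in>F. x i * \<psi> (f i) o')"
        unfolding s_def sum_product by (simp add: mult_ac)
      have "(\<Sum>i\<in>F. \<Sum>j\<in>F. x i * x j * K i j) = (\<Sum>i\<in>F. \<Sum>j\<in>F. x i * x j * \<psi> (f i) o')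
         + (\<Sum>i\<in>F. \<Sum>j\<in>F. x i * x j * \<psi> (f j) o') - (\<Sum>i\<in>F. \<Sum>j\<in>F. x i * x j * \<psi> (f i) (f j))"
        by (simp add: K_def right_diff_distrib distrib_left sum_subtractf sum.distrib)
      then show ?thesis unfolding 1 2 by simp
    qed
    finally show "0 \<le> (\<Sum>i\<in>F. \<Sum>j\<in>F. x i * x j * K i j)" by simp
  qed
  from psd_kernel_Cholesky[OF this] obtain c where c0: "\<And>i k. i < k \<Longrightarrow> c i k = 0" and cK: "\<And>i j n. i < n \<Longrightarrow> K i j = (\<Sum>k<n. c i k * c j k)"
    by metis
  show ?thesis
  proof (intro exI[of _ "\<lambda>x k. c (e x) k / sqrt 2"] exI[of _ "\<lambda>x. Suc (e x)"] conjI allI ballI impI)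
    show "c (e x) k / sqrt 2 = 0" if "Suc (e x) \<le> k" for x k using c0 that by simp
    fix x y n assume x: "x \<in> X" and y: "y \<in> X" and "Suc (e x) \<le> n" "Suc (e y) \<le> n"
    then have n: "e x < n" "e y < n" by auto
    have "(\<Sum>k<n. (c (e x) k / sqrt 2 - c (e y) k / sqrt 2)\<^sup>2) =
      (\<Sum>k<n. (c (e x) k * c (e x) k - 2 * (c (e x) k * c (e y) k) + c (e y) k * c (e y) k) / 2)"
      by (intro sum.cong refl) (simp add: power2_eq_square field_simps flip: real_sqrt_mult)
    also have "\<dots> = (K (e x) (e x) - 2 * K (e x) (e y) + K (e y) (e y)) / 2"
      using n by (simp add: cK[of _ n] sum_subtractf sum.distrib sum_distrib_left flip: sum_divide_distrib)
    also have "\<dots> = \<psi> x y"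
      using x y diag by (simp add: K_def fe)
    finally show "(\<Sum>k<n. (c (e x) k / sqrt 2 - c (e y) k / sqrt 2)\<^sup>2) = \<psi> x y" .
  qed
qed

section \<open>Uniqueness of joint laws\<close>

text \<open>
  The measures with densities \<open>U\<close> and \<open>V\<close> have the same total mass, the value of the transform at \<open>0\<close>.
  Unless it is zero, they can be normalised to probability measures, to which the uniqueness theorem for
  characteristic functions applies. The bound \<open>2\<close> is that of the weights in the next lemma.
\<close>

lemma weighted_Levy_uniqueness:
  fixes Y U :: "'a \<Rightarrow> real" and Z V :: "'b \<Rightarrow> real"
  assumes P: "prob_space P" and Q: "prob_space Q"
    and [measurable]: "Y \<in> borel_measurable P" "U \<in> borel_measurable P" "Z \<in> borel_measurable Q" "V \<in> borel_measurable Q"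
    and U: "\<And>\<omega>. 0 \<le> U \<omega>" "\<And>\<omega>. U \<omega> \<le> 2" and V: "\<And>\<omega>. 0 \<le> V \<omega>" "\<And>\<omega>. V \<omega> \<le> 2"
    and eq: "\<And>s. (CLINT \<omega>|P. U \<omega> * iexp (s * Y \<omega>)) = (CLINT \<omega>|Q. V \<omega> * iexp (s * Z \<omega>))"
    and A: "A \<in> sets borel"
  shows "(LINT \<omega>|P. U \<omega> * indicator A (Y \<omega>)) = (LINT \<omega>|Q. V \<omega> * indicator A (Z \<omega>))"
proof -
  interpret P: prob_space P by fact
  interpret Q: prob_space Q by fact
  have [measurable]: "A \<in> sets borel" by fact
  have iU: "integrable P U" by (rule P.integrable_const_bound[where B=2]) (use U in auto)
  have iV: "integrable Q V" by (rule Q.integrable_const_bound[where B=2]) (use V in auto)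
  define a where "a = (LINT \<omega>|P. U \<omega>)"
  have a': "a = (LINT \<omega>|Q. V \<omega>)" using eq[of 0] by (simp add: a_def)
  have a0: "a \<ge> 0" using U by (simp add: a_def)
  show ?thesis
  proof (cases "a = 0")
    case True
    have "AE \<omega> in P. U \<omega> = 0" using True integral_nonneg_eq_0_iff_AE[OF iU] U by (simp add: a_def)
    then have 1: "(LINT \<omega>|P. U \<omega> * indicator A (Y \<omega>)) = 0"
      by (intro integral_eq_zero_AE) auto
    have "AE \<omega> in Q. V \<omega> = 0" using True integral_nonneg_eq_0_iff_AE[OF iV] V by (simp add: a')
    then have 2: "(LINT \<omega>|Q. V \<omega> * indicator A (Z \<omega>)) = 0"
      by (intro integral_eq_zero_AE) auto
    show ?thesis using 1 2 by simp
  next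
    case False
    with a0 have a: "a > 0" by simp
    define M1 where "M1 = distr (density P (\<lambda>\<omega>. U \<omega> / a)) borel Y"
    define M2 where "M2 = distr (density Q (\<lambda>\<omega>. V \<omega> / a)) borel Z"
    have int1: "integral\<^sup>L M1 f = (LINT \<omega>|P. (U \<omega> / a) *\<^sub>R f (Y \<omega>))" if [measurable]: "f \<in> borel_measurable borel"
      for f :: "real \<Rightarrow> 'c::{banach, second_countable_topology}"
      unfolding M1_def using U a by (subst integral_distr) (auto intro!: integral_density)
    have int2: "integral\<^sup>L M2 f = (LINT \<omega>|Q. (V \<omega> / a) *\<^sub>R f (Z \<omega>))" if [measurable]: "f \<in> borel_measurable borel"
      for f :: "real \<Rightarrow> 'c::{banach, second_countable_topology}"
      unfolding M2_def using V a by (subst integral_distr) (auto intro!: integral_density)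
    have p1: "prob_space (density P (\<lambda>\<omega>. U \<omega> / a))"
    proof (rule prob_spaceI)
      have "emeasure (density P (\<lambda>\<omega>. U \<omega> / a)) (space P) = (\<integral>\<^sup>+\<omega>. ennreal (U \<omega> / a) \<partial>P)"
        by (subst emeasure_density) (auto intro!: nn_integral_cong)
      also have "\<dots> = ennreal (LINT \<omega>|P. U \<omega> / a)"
        using iU U a by (intro nn_integral_eq_integral) auto
      also have "(LINT \<omega>|P. U \<omega> / a) = 1" using a by (simp add: a_def)
      finally show "emeasure (density P (\<lambda>\<omega>. U \<omega> / a)) (space (density P (\<lambda>\<omega>. U \<omega> / a))) = 1" by simp
    qed
    have p2: "prob_space (density Q (\<lambda>\<omega>. V \<omega> / a))"
    proof (rule prob_spaceI)
      have "emeasure (density Q (\<lambda>\<omega>. V \<omega> / a)) (space Q) = (\<integral>\<^sup>+\<omega>. ennreal (V \<omega> / a) \<partial>Q)"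
        by (subst emeasure_density) (auto intro!: nn_integral_cong)
      also have "\<dots> = ennreal (LINT \<omega>|Q. V \<omega> / a)"
        using iV V a by (intro nn_integral_eq_integral) auto
      also have "(LINT \<omega>|Q. V \<omega> / a) = 1" using a by (simp add: a')
      finally show "emeasure (density Q (\<lambda>\<omega>. V \<omega> / a)) (space (density Q (\<lambda>\<omega>. V \<omega> / a))) = 1" by simp
    qed
    have rd: "real_distribution M1" "real_distribution M2"
      unfolding M1_def M2_def using p1 p2
      by (auto intro!: prob_space.real_distribution_distr)
    have "char M1 = char M2"
    proof
      fix s
      have "char M1 s = (CLINT \<omega>|P. (U \<omega> * iexp (s * Y \<omega>)) / a)"
        by (simp add: char_def int1 scaleR_conv_of_real)
      also have "\<dots> = (CLINT \<omega>|Q. (V \<omega> * iexp (s * Z \<omega>)) / a)" using eq[of s] by simp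
      also have "\<dots> = char M2 s"
        by (simp add: char_def int2 scaleR_conv_of_real)
      finally show "char M1 s = char M2 s" .
    qed
    with rd have "M1 = M2" by (rule Levy_uniqueness)
    have "(LINT \<omega>|P. (U \<omega> / a) *\<^sub>R (indicator A (Y \<omega>) :: real)) = integral\<^sup>L M1 (indicator A)"
      by (rule int1[symmetric]) measurable
    also have "\<dots> = integral\<^sup>L M2 (indicator A)" by (simp only: \<open>M1 = M2\<close>)
    also have "\<dots> = (LINT \<omega>|Q. (V \<omega> / a) *\<^sub>R (indicator A (Z \<omega>) :: real))"
      by (rule int2) measurable
    finally show ?thesis using a by simp
  qed
qed

text \<open>
  The exponentials of the coordinates in \<open>K\<close> are replaced by indicator functions, one coordinate at a time,
  by the uniqueness theorem on the line. That theorem needs nonnegative weights, whereas the remaining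
  exponential factor is complex: it is recovered from the weights \<open>1 + Re (z * iexp \<theta>)\<close> with \<open>cmod z = 1\<close>,
  where \<open>z = 1\<close> gives the real part and \<open>z = -\<i>\<close> the imaginary part.
\<close>

lemma joint_Levy_uniqueness:
  fixes Y :: "'i \<Rightarrow> 'a \<Rightarrow> real" and Z :: "'i \<Rightarrow> 'b \<Rightarrow> real"
  assumes P: "prob_space P" and Q: "prob_space Q" and J: "finite J"
    and Y [measurable]: "\<And>j. j \<in> J \<Longrightarrow> Y j \<in> borel_measurable P"
    and Z [measurable]: "\<And>j. j \<in> J \<Longrightarrow> Z j \<in> borel_measurable Q"
    and eq: "\<And>t. (CLINT \<omega>|P. iexp (\<Sum>j\<in>J. t j * Y j \<omega>)) = (CLINT \<omega>|Q. iexp (\<Sum>j\<in>J. t j * Z j \<omega>))"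
    and A: "\<And>j. j \<in> J \<Longrightarrow> A j \<in> sets borel"
  shows "measure P {\<omega> \<in> space P. \<forall>j\<in>J. Y j \<omega> \<in> A j} = measure Q {\<omega> \<in> space Q. \<forall>j\<in>J. Z j \<omega> \<in> A j}"
proof -
  interpret P: prob_space P by fact
  interpret Q: prob_space Q by fact
  define IY where "IY K \<omega> = (\<Prod>j\<in>K. indicator (A j) (Y j \<omega>) :: real)" for K \<omega>
  define IZ where "IZ K \<omega> = (\<Prod>j\<in>K. indicator (A j) (Z j \<omega>) :: real)" for K \<omega>
  have IY: "0 \<le> IY K \<omega>" "IY K \<omega> \<le> 1" and IZ: "0 \<le> IZ K \<omega>'" "IZ K \<omega>' \<le> 1" for K \<omega> \<omega>'
    unfolding IY_def IZ_def by (auto intro!: prod_nonneg prod_le_1)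
  have mY: "IY K \<in> borel_measurable P" and mZ: "IZ K \<in> borel_measurable Q" if "K \<subseteq> J" for K
    unfolding IY_def IZ_def using that
    by (intro borel_measurable_prod measurable_compose[OF Y borel_measurable_indicator[OF A]]
          measurable_compose[OF Z borel_measurable_indicator[OF A]]; blast)+
  have main: "(CLINT \<omega>|P. IY K \<omega> * iexp (\<Sum>j\<in>J-K. t j * Y j \<omega>)) = (CLINT \<omega>|Q. IZ K \<omega> * iexp (\<Sum>j\<in>J-K. t j * Z j \<omega>))"
    if "K \<subseteq> J" for K t
    using finite_subset[OF that J] that
  proof (induction K arbitrary: t rule: finite_induct)
    case empty
    then show ?case using eq[of t] by (simp add: IY_def IZ_def)
  next
    case (insert k K)
    then have k: "k \<in> J" "k \<notin> K" "K \<subseteq> J" by auto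
    note [measurable] = mY[OF k(3)] mZ[OF k(3)] Y[OF k(1)] Z[OF k(1)] A[OF k(1)]
    define R where "R = J - insert k K"
    have R: "finite R" "k \<notin> R" "J - K = insert k R" "R \<subseteq> J" using J k by (auto simp: R_def)
    define \<theta> where "\<theta> \<omega> = (\<Sum>j\<in>R. t j * Y j \<omega>)" for \<omega>
    define \<phi> where "\<phi> \<omega> = (\<Sum>j\<in>R. t j * Z j \<omega>)" for \<omega>
    have [measurable]: "\<theta> \<in> borel_measurable P" "\<phi> \<in> borel_measurable Q"
      unfolding \<theta>_def \<phi>_def using R by (auto intro!: borel_measurable_sum)
    have IH: "(CLINT \<omega>|P. IY K \<omega> * iexp (s * Y k \<omega> + r * \<theta> \<omega>)) = (CLINT \<omega>|Q. IZ K \<omega> * iexp (s * Z k \<omega> + r * \<phi> \<omega>))"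
      for s r
    proof -
      let ?t = "\<lambda>j. if j = k then s else r * t j"
      have 1: "(\<Sum>j\<in>J-K. ?t j * Y j \<omega>) = s * Y k \<omega> + r * \<theta> \<omega>" for \<omega>
        unfolding R(3) using R(1,2) by (auto simp: \<theta>_def sum_distrib_left mult.assoc intro!: sum.cong)
      have 2: "(\<Sum>j\<in>J-K. ?t j * Z j \<omega>) = s * Z k \<omega> + r * \<phi> \<omega>" for \<omega>
        unfolding R(3) using R(1,2) by (auto simp: \<phi>_def sum_distrib_left mult.assoc intro!: sum.cong)
      show ?thesis using insert.IH[OF k(3), of ?t] unfolding 1 2 .
    qed
    have intP: "integrable P (\<lambda>\<omega>. IY K \<omega> * iexp (s * Y k \<omega> + r * \<theta> \<omega>))" for s r
      by (rule P.integrable_const_bound[where B=1]) (use IY in \<open>auto simp: norm_mult\<close>)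
    have intQ: "integrable Q (\<lambda>\<omega>. IZ K \<omega> * iexp (s * Z k \<omega> + r * \<phi> \<omega>))" for s r
      by (rule Q.integrable_const_bound[where B=1]) (use IZ in \<open>auto simp: norm_mult\<close>)
    have plain: "(LINT \<omega>|P. IY K \<omega> * indicator (A k) (Y k \<omega>)) = (LINT \<omega>|Q. IZ K \<omega> * indicator (A k) (Z k \<omega>))"
      by (rule weighted_Levy_uniqueness[OF P Q])
         (use IY IZ IH[of _ 0] in \<open>auto intro: order_trans[of _ 1] simp: mult.commute\<close>)
    have phase: "(LINT \<omega>|P. IY K \<omega> * Re (z * iexp (\<theta> \<omega>)) * indicator (A k) (Y k \<omega>))
               = (LINT \<omega>|Q. IZ K \<omega> * Re (z * iexp (\<phi> \<omega>)) * indicator (A k) (Z k \<omega>))"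
      if z: "cmod z = 1" for z
    proof -
      have Re_le: "\<bar>Re (z * iexp x)\<bar> \<le> 1" for x
        using abs_Re_le_cmod[of "z * iexp x"] z by (simp add: norm_mult)
      have bound: "0 \<le> a * (1 + Re (z * iexp x))" "a * (1 + Re (z * iexp x)) \<le> 2" if "0 \<le> a" "a \<le> 1" for a x
        using that Re_le[of x] mult_mono[of a 1 "1 + Re (z * iexp x)" 2] by (auto intro!: mult_nonneg_nonneg)
      have expand: "complex_of_real (a * (1 + Re (z * iexp x))) * iexp (s * y) =
         a * iexp (s * y + 0 * x) + z / 2 * (a * iexp (s * y + 1 * x)) + cnj z / 2 * (a * iexp (s * y + (-1) * x))"
        for a x s y
      proof -
        have "complex_of_real (Re (z * iexp x)) = (z * iexp x + cnj (z * iexp x)) / 2"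
          by (simp add: complex_eq_iff)
        also have "cnj (z * iexp x) = cnj z * iexp (- x)" by (simp add: exp_cnj)
        finally have "complex_of_real (Re (z * iexp x)) = (z * iexp x + cnj z * iexp (- x)) / 2" .
        moreover define W where "W = Re (z * iexp x)"
        ultimately have W: "complex_of_real W = (z * iexp x + cnj z * iexp (- x)) / 2" by simp
        have e: "iexp (s * y + 0 * x) = iexp (s * y)" "iexp (s * y + 1 * x) = iexp (s * y) * iexp x"
          "iexp (s * y + (-1) * x) = iexp (s * y) * iexp (- x)"
          by (simp_all add: exp_add[symmetric] algebra_simps)
        have ring: "a' * (1 + (z * X + cnj z * X') / 2) * S = a' * S + z / 2 * (a' * (S * X)) + cnj z / 2 * (a' * (S * X'))"
          for a' S X X' :: complex by (simp add: field_simps)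
        have "complex_of_real (a * (1 + Re (z * iexp x))) * iexp (s * y)
            = of_real a * (1 + complex_of_real W) * iexp (s * y)"
          by (simp add: W_def)
        also have "\<dots> = a * iexp (s * y) + z / 2 * (a * (iexp (s * y) * iexp x)) + cnj z / 2 * (a * (iexp (s * y) * iexp (- x)))"
          unfolding W by (rule ring)
        finally show ?thesis by (simp only: e)
      qed
      have "(LINT \<omega>|P. (IY K \<omega> * (1 + Re (z * iexp (\<theta> \<omega>)))) * indicator (A k) (Y k \<omega>))
         = (LINT \<omega>|Q. (IZ K \<omega> * (1 + Re (z * iexp (\<phi> \<omega>)))) * indicator (A k) (Z k \<omega>))"
      proof (rule weighted_Levy_uniqueness[OF P Q])
        show "(CLINT \<omega>|P. complex_of_real (IY K \<omega> * (1 + Re (z * iexp (\<theta> \<omega>)))) * iexp (s * Y k \<omega>))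
            = (CLINT \<omega>|Q. complex_of_real (IZ K \<omega> * (1 + Re (z * iexp (\<phi> \<omega>)))) * iexp (s * Z k \<omega>))" for s
          unfolding expand using IH[of s 0] IH[of s 1] IH[of s "-1"] intP[of s 0] intP[of s 1] intP[of s "-1"]
            intQ[of s 0] intQ[of s 1] intQ[of s "-1"]
          by simp
      qed (use bound IY IZ in auto)
      moreover have "(LINT \<omega>|P. (IY K \<omega> * (1 + Re (z * iexp (\<theta> \<omega>)))) * indicator (A k) (Y k \<omega>))
         = (LINT \<omega>|P. IY K \<omega> * indicator (A k) (Y k \<omega>)) + (LINT \<omega>|P. IY K \<omega> * Re (z * iexp (\<theta> \<omega>)) * indicator (A k) (Y k \<omega>))"
      proof (subst Bochner_Integration.integral_add[symmetric])
        show "integrable P (\<lambda>\<omega>. IY K \<omega> * indicator (A k) (Y k \<omega>))"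
          by (rule P.integrable_const_bound[where B=1]) (use IY in \<open>auto simp: indicator_def\<close>)
        show "integrable P (\<lambda>\<omega>. IY K \<omega> * Re (z * iexp (\<theta> \<omega>)) * indicator (A k) (Y k \<omega>))"
          by (rule P.integrable_const_bound[where B=1])
            (use IY Re_le in \<open>auto simp: indicator_def abs_mult intro!: mult_le_one\<close>)
      qed (simp add: algebra_simps)
      moreover have "(LINT \<omega>|Q. (IZ K \<omega> * (1 + Re (z * iexp (\<phi> \<omega>)))) * indicator (A k) (Z k \<omega>))
         = (LINT \<omega>|Q. IZ K \<omega> * indicator (A k) (Z k \<omega>)) + (LINT \<omega>|Q. IZ K \<omega> * Re (z * iexp (\<phi> \<omega>)) * indicator (A k) (Z k \<omega>))"
      proof (subst Bochner_Integration.integral_add[symmetric])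
        show "integrable Q (\<lambda>\<omega>. IZ K \<omega> * indicator (A k) (Z k \<omega>))"
          by (rule Q.integrable_const_bound[where B=1]) (use IZ in \<open>auto simp: indicator_def\<close>)
        show "integrable Q (\<lambda>\<omega>. IZ K \<omega> * Re (z * iexp (\<phi> \<omega>)) * indicator (A k) (Z k \<omega>))"
          by (rule Q.integrable_const_bound[where B=1])
            (use IZ Re_le in \<open>auto simp: indicator_def abs_mult intro!: mult_le_one\<close>)
      qed (simp add: algebra_simps)
      ultimately show ?thesis using plain by simp
    qed
    have iP: "integrable P (\<lambda>\<omega>. IY (insert k K) \<omega> * iexp (\<theta> \<omega>))"
      by (rule P.integrable_const_bound[where B=1])
        (use IY mY[of "insert k K"] insert.prems in \<open>auto simp: norm_mult\<close>)
    have iQ: "integrable Q (\<lambda>\<omega>. IZ (insert k K) \<omega> * iexp (\<phi> \<omega>))"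
      by (rule Q.integrable_const_bound[where B=1])
        (use IZ mZ[of "insert k K"] insert.prems in \<open>auto simp: norm_mult\<close>)
    have split: "IY (insert k K) \<omega> = IY K \<omega> * indicator (A k) (Y k \<omega>)"
       "IZ (insert k K) \<omega>' = IZ K \<omega>' * indicator (A k) (Z k \<omega>')" for \<omega> \<omega>'
      using insert.hyps by (auto simp: IY_def IZ_def)
    have "(CLINT \<omega>|P. IY (insert k K) \<omega> * iexp (\<theta> \<omega>)) = (CLINT \<omega>|Q. IZ (insert k K) \<omega> * iexp (\<phi> \<omega>))"
    proof (rule complex_eqI)
      show "Re (CLINT \<omega>|P. IY (insert k K) \<omega> * iexp (\<theta> \<omega>)) = Re (CLINT \<omega>|Q. IZ (insert k K) \<omega> * iexp (\<phi> \<omega>))"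
        using phase[of 1] iP iQ by (simp add: split mult_ac flip: integral_Re)
      show "Im (CLINT \<omega>|P. IY (insert k K) \<omega> * iexp (\<theta> \<omega>)) = Im (CLINT \<omega>|Q. IZ (insert k K) \<omega> * iexp (\<phi> \<omega>))"
        using phase[of "- \<i>"] iP iQ by (simp add: split mult_ac flip: integral_Im)
    qed
    then show ?case by (simp add: \<theta>_def \<phi>_def R_def)
  qed
  have "(LINT \<omega>|P. IY J \<omega>) = (LINT \<omega>|Q. IZ J \<omega>)"
    using main[of J] by simp
  moreover have "IY J \<omega> = indicator {\<omega> \<in> space P. \<forall>j\<in>J. Y j \<omega> \<in> A j} \<omega>" if "\<omega> \<in> space P" for \<omega>
    using J that by (auto simp: IY_def indicator_def prod_zero_iff intro!: prod.neutral)
  moreover have "IZ J \<omega> = indicator {\<omega> \<in> space Q. \<forall>j\<in>J. Z j \<omega> \<in> A j} \<omega>" if "\<omega> \<in> space Q" for \<omega>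
    using J that by (auto simp: IZ_def indicator_def prod_zero_iff intro!: prod.neutral)
  moreover have "{\<omega> \<in> space P. R \<omega>} \<inter> space P = {\<omega> \<in> space P. R \<omega>}" for R by auto
  moreover have "{\<omega> \<in> space Q. R \<omega>} \<inter> space Q = {\<omega> \<in> space Q. R \<omega>}" for R by auto
  ultimately show ?thesis
    by (simp cong: Bochner_Integration.integral_cong)
qed

section \<open>Gaussian walls\<close>

abbreviation white_noise :: "(nat \<Rightarrow> real) measure" where
  "white_noise \<equiv> PiM UNIV (\<lambda>_. std_normal_distribution)"

lemma prob_space_std_normal: "prob_space std_normal_distribution"
  using prob_space_normal_density[of 1 0] by simp

lemma prob_space_white_noise: "prob_space white_noise"
  by (intro prob_space_PiM prob_space_std_normal)

lemma measurable_white_noise_component [measurable]: "(\<lambda>\<omega>. \<omega> k) \<in> borel_measurable white_noise"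
  using measurable_component_singleton[of k UNIV "\<lambda>_. std_normal_distribution"]
  by (simp cong: measurable_cong_sets)

lemma distr_white_noise_component: "distr white_noise borel (\<lambda>\<omega>. \<omega> k) = std_normal_distribution"
proof -
  have "distr white_noise borel (\<lambda>\<omega>. \<omega> k) = distr white_noise std_normal_distribution (\<lambda>\<omega>. \<omega> k)"
    by (intro distr_cong) auto
  also have "\<dots> = std_normal_distribution"
    by (rule distr_PiM_component) (auto intro: prob_space_std_normal)
  finally show ?thesis .
qed

lemma indep_vars_white_noise: "prob_space.indep_vars white_noise (\<lambda>_. borel) (\<lambda>k \<omega>. \<omega> k) UNIV"
proof -
  interpret prob_space white_noise by (rule prob_space_white_noise)
  have "distr white_noise (PiM UNIV (\<lambda>_. borel)) (\<lambda>\<omega>. \<lambda>k\<in>UNIV. \<omega> k) = white_noise"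
    unfolding restrict_UNIV by (intro distr_id2 sets_PiM_cong) auto
  then show ?thesis
    by (subst indep_vars_iff_distr_eq_PiM) (auto simp: distr_white_noise_component)
qed

lemma measurable_white_noise_combination [measurable]:
  "(\<lambda>\<omega>. \<Sum>k<n. d k * \<omega> k) \<in> borel_measurable white_noise"
  by (intro borel_measurable_sum borel_measurable_times borel_measurable_const measurable_white_noise_component)

lemma white_noise_characteristic:
  "(CLINT \<omega>|white_noise. iexp (\<Sum>k<n. d k * \<omega> k)) = complex_of_real (exp (- (\<Sum>k<n. (d k)\<^sup>2) / 2))"
proof -
  interpret prob_space white_noise by (rule prob_space_white_noise)
  have ind: "indep_vars (\<lambda>_. borel) (\<lambda>k \<omega>. d k * \<omega> k) {..<n}"
    by (rule indep_vars_compose2[OF indep_vars_subset[OF indep_vars_white_noise subset_UNIV]]) auto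
  have "(CLINT \<omega>|white_noise. iexp (\<Sum>k<n. d k * \<omega> k)) = char (distr white_noise borel (\<lambda>\<omega>. \<Sum>k<n. d k * \<omega> k)) 1"
    unfolding char_def by (subst integral_distr) auto
  also have "\<dots> = (\<Prod>k<n. char (distr white_noise borel (\<lambda>\<omega>. d k * \<omega> k)) 1)"
    by (rule char_distr_sum[OF ind])
  also have "\<dots> = (\<Prod>k<n. complex_of_real (exp (- (d k)\<^sup>2 / 2)))"
  proof (intro prod.cong refl)
    fix k
    have "char (distr white_noise borel (\<lambda>\<omega>. d k * \<omega> k)) 1 = (CLINT \<omega>|white_noise. iexp (d k * \<omega> k))"
      unfolding char_def by (subst integral_distr) auto
    also have "\<dots> = char (distr white_noise borel (\<lambda>\<omega>. \<omega> k)) (d k)"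
      unfolding char_def by (subst integral_distr) auto
    also have "\<dots> = complex_of_real (exp (- (d k)\<^sup>2 / 2))"
      by (simp add: distr_white_noise_component char_std_normal_distribution)
    finally show "char (distr white_noise borel (\<lambda>\<omega>. d k * \<omega> k)) 1 = complex_of_real (exp (- (d k)\<^sup>2 / 2))" .
  qed
  also have "(\<Prod>k<n. complex_of_real (exp (- (d k)\<^sup>2 / 2))) = complex_of_real (exp (- (\<Sum>k<n. (d k)\<^sup>2) / 2))"
    by (simp add: exp_sum[symmetric] sum_divide_distrib sum_negf flip: of_real_prod)
  finally show ?thesis .
qed

lemma distr_white_noise_combination:
  "distr white_noise borel (\<lambda>\<omega>. \<Sum>k<n. d k * \<omega> k)
     = distr std_normal_distribution borel (\<lambda>u. sqrt (\<Sum>k<n. (d k)\<^sup>2) * u)" (is "?L = ?R")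
proof (rule Levy_uniqueness)
  show "real_distribution ?L"
    by (rule prob_space.real_distribution_distr[OF prob_space_white_noise measurable_white_noise_combination])
  show "real_distribution ?R"
    by (rule prob_space.real_distribution_distr[OF prob_space_std_normal]) simp
  show "char ?L = char ?R"
  proof
    fix s
    have "char ?L s = (CLINT \<omega>|white_noise. iexp (\<Sum>k<n. (s * d k) * \<omega> k))"
      unfolding char_def by (subst integral_distr) (auto simp: sum_distrib_left mult.assoc)
    also have "\<dots> = complex_of_real (exp (- ((s * sqrt (\<Sum>k<n. (d k)\<^sup>2))\<^sup>2) / 2))"
      unfolding white_noise_characteristic
      by (simp add: power_mult_distrib sum_nonneg flip: sum_distrib_left)
    also have "\<dots> = char std_normal_distribution (s * sqrt (\<Sum>k<n. (d k)\<^sup>2))"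
      by (simp add: char_std_normal_distribution)
    also have "\<dots> = char ?R s"
      unfolding char_def by (subst integral_distr) (auto simp: mult.assoc)
    finally show "char ?L s = char ?R s" .
  qed
qed

text \<open>
  The characteristic function of a finite linear combination is a function of its variance, which is
  computed from the inner products of the coefficient vectors.
\<close>

lemma gaussian_family_law_unique:
  fixes a a' :: "'x \<Rightarrow> nat \<Rightarrow> real"
  assumes zero: "\<And>x k. N x \<le> k \<Longrightarrow> a x k = 0" "\<And>x k. N x \<le> k \<Longrightarrow> a' x k = 0"
    and gram: "\<And>x y n. x \<in> X \<Longrightarrow> y \<in> X \<Longrightarrow> N x \<le> n \<Longrightarrow> N y \<le> n \<Longrightarrow>
        (\<Sum>k<n. a x k * a y k) = (\<Sum>k<n. a' x k * a' y k)"
  shows "distr white_noise (PiM X (\<lambda>_. borel)) (\<lambda>\<omega>. \<lambda>x\<in>X. \<Sum>k<N x. a x k * \<omega> k)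
       = distr white_noise (PiM X (\<lambda>_. borel)) (\<lambda>\<omega>. \<lambda>x\<in>X. \<Sum>k<N x. a' x k * \<omega> k)"
proof (rule measure_eqI_PiM_infinite)
  interpret prob_space white_noise by (rule prob_space_white_noise)
  let ?D = "\<lambda>a. distr white_noise (PiM X (\<lambda>_. borel)) (\<lambda>\<omega>. \<lambda>x\<in>X. \<Sum>k<N x. a x k * \<omega> k)"
  define V where "V a x \<omega> = (\<Sum>k<N x. a x k * \<omega> k)" for a :: "'x \<Rightarrow> nat \<Rightarrow> real" and x and \<omega> :: "nat \<Rightarrow> real"
  have V [measurable]: "V a x \<in> borel_measurable white_noise" for a x unfolding V_def by measurable
  have char_V: "(CLINT \<omega>|white_noise. iexp (\<Sum>x\<in>J. t x * V a x \<omega>))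
      = complex_of_real (exp (- (\<Sum>x\<in>J. \<Sum>y\<in>J. t x * t y * (\<Sum>k<n. a x k * a y k)) / 2))"
    if z: "\<And>x k. N x \<le> k \<Longrightarrow> a x k = 0" and n: "\<And>x. x \<in> J \<Longrightarrow> N x \<le> n" for J t a n
  proof -
    have V_n: "V a x \<omega> = (\<Sum>k<n. a x k * \<omega> k)" if "x \<in> J" for x \<omega>
      unfolding V_def using n[OF that] z by (intro sum.mono_neutral_left) auto
    have "(\<Sum>x\<in>J. t x * V a x \<omega>) = (\<Sum>k<n. (\<Sum>x\<in>J. t x * a x k) * \<omega> k)" for \<omega>
    proof -
      have "(\<Sum>x\<in>J. t x * V a x \<omega>) = (\<Sum>x\<in>J. \<Sum>k<n. t x * a x k * \<omega> k)"
        by (intro sum.cong refl) (simp add: V_n sum_distrib_left mult.assoc)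
      also have "\<dots> = (\<Sum>k<n. (\<Sum>x\<in>J. t x * a x k) * \<omega> k)"
        by (subst sum.swap) (simp add: sum_distrib_right)
      finally show ?thesis .
    qed
    then have "(CLINT \<omega>|white_noise. iexp (\<Sum>x\<in>J. t x * V a x \<omega>))
      = complex_of_real (exp (- (\<Sum>k<n. (\<Sum>x\<in>J. t x * a x k)\<^sup>2) / 2))"
      by (simp only: white_noise_characteristic)
    also have "(\<Sum>k<n. (\<Sum>x\<in>J. t x * a x k)\<^sup>2) = (\<Sum>k<n. \<Sum>x\<in>J. \<Sum>y\<in>J. t x * t y * (a x k * a y k))"
      by (intro sum.cong refl) (simp add: power2_eq_square sum_product mult_ac)
    also have "\<dots> = (\<Sum>x\<in>J. \<Sum>y\<in>J. t x * t y * (\<Sum>k<n. a x k * a y k))"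
      by (subst sum.swap, rule sum.cong[OF refl], subst sum.swap) (simp add: sum_distrib_left)
    finally show ?thesis .
  qed
  have mV: "(\<lambda>\<omega>. \<lambda>x\<in>X. \<Sum>k<N x. a x k * \<omega> k) \<in> measurable white_noise (PiM X (\<lambda>_. borel))" for a
    by (rule measurable_restrict) measurable
  show "finite_measure (?D a)"
    by (rule finite_measure_distr[OF mV])
  fix A :: "'x \<Rightarrow> real set" and J
  assume J: "finite J" "J \<subseteq> X" and A: "\<And>i. i \<in> J \<Longrightarrow> A i \<in> sets borel"
  have emb: "emeasure (?D a) (prod_emb X (\<lambda>_. borel) J (Pi\<^sub>E J A)) = measure white_noise {\<omega> \<in> space white_noise. \<forall>x\<in>J. V a x \<omega> \<in> A x}"
    for a
  proof -
    have "prod_emb X (\<lambda>_. borel) J (Pi\<^sub>E J A) \<in> sets (PiM X (\<lambda>_. borel))"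
      using J A by (intro sets_PiM_I) auto
    then have "emeasure (?D a) (prod_emb X (\<lambda>_. borel) J (Pi\<^sub>E J A)) =
       emeasure white_noise ((\<lambda>\<omega>. \<lambda>x\<in>X. \<Sum>k<N x. a x k * \<omega> k) -` prod_emb X (\<lambda>_. borel) J (Pi\<^sub>E J A) \<inter> space white_noise)"
      by (rule emeasure_distr[OF mV])
    also have "(\<lambda>\<omega>. \<lambda>x\<in>X. \<Sum>k<N x. a x k * \<omega> k) -` prod_emb X (\<lambda>_. borel) J (Pi\<^sub>E J A) \<inter> space white_noise
       = {\<omega> \<in> space white_noise. \<forall>x\<in>J. V a x \<omega> \<in> A x}"
      using J by (auto simp: prod_emb_def V_def Pi_iff PiE_iff restrict_def extensional_def subset_eq)
    finally show ?thesis by (simp only: emeasure_eq_measure)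
  qed
  define n where "n = Max (insert 0 (N ` J))"
  have n: "N x \<le> n" if "x \<in> J" for x using J that by (auto simp: n_def)
  have "measure white_noise {\<omega> \<in> space white_noise. \<forall>x\<in>J. V a x \<omega> \<in> A x}
      = measure white_noise {\<omega> \<in> space white_noise. \<forall>x\<in>J. V a' x \<omega> \<in> A x}"
  proof (rule joint_Levy_uniqueness[OF prob_space_white_noise prob_space_white_noise J(1) V V _ A])
    fix t
    have "(\<Sum>x\<in>J. \<Sum>y\<in>J. t x * t y * (\<Sum>k<n. a x k * a y k)) = (\<Sum>x\<in>J. \<Sum>y\<in>J. t x * t y * (\<Sum>k<n. a' x k * a' y k))"
      using J n by (intro sum.cong refl arg_cong2[where f="(*)"] gram) auto
    then show "(CLINT \<omega>|white_noise. iexp (\<Sum>x\<in>J. t x * V a x \<omega>)) = (CLINT \<omega>|white_noise. iexp (\<Sum>x\<in>J. t x * V a' x \<omega>))"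
      by (simp only: char_V[OF zero(1) n] char_V[OF zero(2) n])
  qed
  then show "emeasure (?D a) (prod_emb X (\<lambda>_. borel) J (Pi\<^sub>E J A)) =
     emeasure (?D a')
       (prod_emb X (\<lambda>_. borel) J (Pi\<^sub>E J A))"
    by (simp only: emb)
qed auto

abbreviation wall_const :: real where "wall_const \<equiv> sqrt (2 / pi) / 2"

lemma std_normal_positive_part:
  "(\<integral>\<^sup>+u. ennreal (max 0 (s * u)) \<partial>std_normal_distribution) = ennreal (\<bar>s\<bar> * wall_const)"
proof -
  have i1: "integrable std_normal_distribution (\<lambda>u. u)"
    using integrable_std_normal_distribution_moment[of 1] by simp
  have e1: "(LINT u|std_normal_distribution. u) = 0"
    using integral_std_normal_distribution_moment_odd[of 1] by simp
  have e2: "(LINT u|std_normal_distribution. \<bar>u\<bar>) = sqrt (2 / pi)"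
    using std_normal_distribution_odd_moments_abs[of 0] by simp
  have nonneg: "0 \<le> \<bar>s\<bar> * \<bar>u\<bar> + s * u" for u :: real
    using abs_ge_minus_self[of "s * u"] by (simp add: abs_mult)
  have m: "max 0 (s * u) = (\<bar>s\<bar> * \<bar>u\<bar> + s * u) / 2" for u :: real
    by (auto simp: max_def abs_mult[symmetric])
  have "(\<integral>\<^sup>+u. ennreal (max 0 (s * u)) \<partial>std_normal_distribution) = ennreal (LINT u|std_normal_distribution. max 0 (s * u))"
    by (intro nn_integral_eq_integral) (use i1 nonneg in \<open>auto simp: m\<close>)
  also have "(LINT u|std_normal_distribution. max 0 (s * u)) = \<bar>s\<bar> * wall_const"
    unfolding m using i1 by (simp add: e1 e2)
  finally show ?thesis .
qed

text \<open>
  With coordinates \<open>a x\<close> of the points in a Hilbert space, \<open>Y\<^sub>x\<close> is the Gaussian variable \<open>V x\<close> with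
  coefficients \<open>a x\<close>, and \<open>m\<close> is the law of \<open>(Y\<^sub>x + t)\<^sub>x\<close> for \<open>t\<close> distributed by Lebesgue measure. Only
  the differences of the \<open>Y\<^sub>x\<close> have a meaning in terms of \<open>\<psi>\<close>, but by translation invariance in \<open>t\<close> only
  they matter.
\<close>

lemma cond_neg_def_kernel_walls:
  fixes \<psi> :: "'x \<Rightarrow> 'x \<Rightarrow> real"
  assumes X: "countable X" and \<psi>: "cond_neg_def_kernel X \<psi>"
  shows "\<exists>m :: ('x \<Rightarrow> real) measure. sets m = sets (PiM X (\<lambda>_. borel)) \<and>
    (\<forall>\<sigma>\<in>X \<rightarrow> X. (\<forall>x\<in>X. \<forall>y\<in>X. \<psi> (\<sigma> x) (\<sigma> y) = \<psi> x y) \<longrightarrow> distr m m (\<lambda>z. \<lambda>x\<in>X. z (\<sigma> x)) = m) \<and>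
    (\<forall>x\<in>X. \<forall>y\<in>X. emeasure m {z \<in> space m. 0 \<le> z x \<and> z y < 0} = ennreal (sqrt (\<psi> x y) * wall_const))"
proof -
  from cond_neg_def_kernel_coordinates[OF X \<psi>] obtain a :: "'x \<Rightarrow> nat \<Rightarrow> real" and N :: "'x \<Rightarrow> nat" where
    zero': "\<forall>x. \<forall>k\<ge>N x. a x k = 0" and
    dist': "\<forall>x\<in>X. \<forall>y\<in>X. \<forall>n. N x \<le> n \<longrightarrow> N y \<le> n \<longrightarrow> (\<Sum>k<n. (a x k - a y k)\<^sup>2) = \<psi> x y"
    by (elim exE conjE)
  have zero: "a x k = 0" if "N x \<le> k" for x k using zero' that by simp
  have dist: "(\<Sum>k<n. (a x k - a y k)\<^sup>2) = \<psi> x y" if "x \<in> X" "y \<in> X" "N x \<le> n" "N y \<le> n" for x y n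
    using dist' that by simp
  interpret W: prob_space white_noise by (rule prob_space_white_noise)
  let ?P = "PiM X (\<lambda>_. borel :: real measure)"
  define V where "V x \<omega> = (\<Sum>k<N x. a x k * \<omega> k)" for x and \<omega> :: "nat \<Rightarrow> real"
  have V [measurable]: "V x \<in> borel_measurable white_noise" for x unfolding V_def by measurable
  define \<Phi> where "\<Phi> \<sigma> = (\<lambda>(\<omega>, t). \<lambda>x\<in>X. V (\<sigma> x) \<omega> + t)" for \<sigma> :: "'x \<Rightarrow> 'x"
  have \<Phi> [measurable]: "\<Phi> \<sigma> \<in> measurable (white_noise \<Otimes>\<^sub>M lborel) ?P" for \<sigma>
    unfolding \<Phi>_def split_beta' by (rule measurable_restrict) measurable
  define m where "m = distr (white_noise \<Otimes>\<^sub>M lborel) ?P (\<Phi> id)"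
  have V_diff: "V x \<omega> - V y \<omega> = (\<Sum>k<n. (a x k - a y k) * \<omega> k)" if "N x \<le> n" "N y \<le> n" for x y n \<omega>
  proof -
    have "V x \<omega> = (\<Sum>k<n. a x k * \<omega> k)" "V y \<omega> = (\<Sum>k<n. a y k * \<omega> k)"
      unfolding V_def using that zero by (intro sum.mono_neutral_left; auto)+
    then show ?thesis by (simp add: sum_subtractf left_diff_distrib)
  qed
  \<comment> \<open>Subtracting the variable at \<open>\<sigma> o'\<close> from all coordinates is, for fixed \<open>\<omega>\<close>, a translation of \<open>t\<close>.\<close>
  have shift_law: "emeasure (distr (white_noise \<Otimes>\<^sub>M lborel) ?P (\<Phi> \<sigma>)) A
     = (\<integral>\<^sup>+y. (\<integral>\<^sup>+t. indicator A (\<lambda>x\<in>X. y x + t) \<partial>lborel)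
          \<partial>distr white_noise ?P (\<lambda>\<omega>. \<lambda>x\<in>X. V (\<sigma> x) \<omega> - V (\<sigma> o') \<omega>))"
    if A [measurable]: "A \<in> sets ?P" for \<sigma> A o'
  proof -
    have [measurable]: "(\<lambda>\<omega>. \<lambda>x\<in>X. V (\<sigma> x) \<omega> - V (\<sigma> o') \<omega>) \<in> measurable white_noise ?P"
      by (rule measurable_restrict) measurable
    have [measurable]: "(\<lambda>z. \<lambda>x\<in>X. fst z x + snd z) \<in> measurable (?P \<Otimes>\<^sub>M lborel) ?P"
      by (rule measurable_restrict) measurable
    have "emeasure (distr (white_noise \<Otimes>\<^sub>M lborel) ?P (\<Phi> \<sigma>)) A
        = (\<integral>\<^sup>+z. indicator A z \<partial>distr (white_noise \<Otimes>\<^sub>M lborel) ?P (\<Phi> \<sigma>))"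
      by simp
    also have "\<dots> = (\<integral>\<^sup>+z. indicator A (\<Phi> \<sigma> z) \<partial>(white_noise \<Otimes>\<^sub>M lborel))"
      by (subst nn_integral_distr) auto
    also have "\<dots> = (\<integral>\<^sup>+\<omega>. \<integral>\<^sup>+t. indicator A (\<Phi> \<sigma> (\<omega>, t)) \<partial>lborel \<partial>white_noise)"
      by (subst lborel.nn_integral_fst[symmetric]) auto
    also have "\<dots> = (\<integral>\<^sup>+\<omega>. \<integral>\<^sup>+t. indicator A (\<lambda>x\<in>X. (V (\<sigma> x) \<omega> - V (\<sigma> o') \<omega>) + t) \<partial>lborel \<partial>white_noise)"
    proof (rule nn_integral_cong)
      fix \<omega> assume \<omega>: "\<omega> \<in> space white_noise"
      have [measurable]: "(\<lambda>t. \<Phi> \<sigma> (\<omega>, t)) \<in> measurable borel ?P"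
        using measurable_compose_Pair1[OF \<omega> \<Phi>[of \<sigma>]] by (simp cong: measurable_cong_sets)
      have "(\<integral>\<^sup>+t. indicator A (\<Phi> \<sigma> (\<omega>, t)) \<partial>lborel)
          = ennreal \<bar>1\<bar> * (\<integral>\<^sup>+t. indicator A (\<Phi> \<sigma> (\<omega>, - V (\<sigma> o') \<omega> + 1 * t)) \<partial>lborel)"
        by (rule nn_integral_real_affine) auto
      also have "\<dots> = (\<integral>\<^sup>+t. indicator A (\<lambda>x\<in>X. (V (\<sigma> x) \<omega> - V (\<sigma> o') \<omega>) + t) \<partial>lborel)"
        by (simp add: \<Phi>_def algebra_simps)
      finally show "(\<integral>\<^sup>+t. indicator A (\<Phi> \<sigma> (\<omega>, t)) \<partial>lborel) = \<dots>" .
    qed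
    also have "\<dots> = (\<integral>\<^sup>+\<omega>. \<integral>\<^sup>+t. indicator A (\<lambda>x\<in>X. (\<lambda>x\<in>X. V (\<sigma> x) \<omega> - V (\<sigma> o') \<omega>) x + t) \<partial>lborel \<partial>white_noise)"
      by (simp cong: restrict_cong)
    also have "\<dots> = (\<integral>\<^sup>+y. (\<integral>\<^sup>+t. indicator A (\<lambda>x\<in>X. y x + t) \<partial>lborel)
          \<partial>distr white_noise ?P (\<lambda>\<omega>. \<lambda>x\<in>X. V (\<sigma> x) \<omega> - V (\<sigma> o') \<omega>))"
    proof -
      have "(\<lambda>z. indicator A (\<lambda>x\<in>X. fst z x + snd z) :: ennreal) \<in> borel_measurable (?P \<Otimes>\<^sub>M lborel)"
        by measurable
      from lborel.borel_measurable_nn_integral_fst[OF this]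
      have [measurable]: "(\<lambda>y. \<integral>\<^sup>+t. indicator A (\<lambda>x\<in>X. y x + t) \<partial>lborel) \<in> borel_measurable ?P" by simp
      show ?thesis by (subst nn_integral_distr) auto
    qed
    finally show ?thesis .
  qed
  show ?thesis
  proof (intro exI[of _ m] conjI ballI impI)
    show sets_m: "sets m = sets ?P" by (simp add: m_def)
    show "distr m m (\<lambda>z. \<lambda>x\<in>X. z (\<sigma> x)) = m"
      if \<sigma>: "\<sigma> \<in> X \<rightarrow> X" and inv: "\<forall>x\<in>X. \<forall>y\<in>X. \<psi> (\<sigma> x) (\<sigma> y) = \<psi> x y" for \<sigma>
    proof -
      have [measurable]: "(\<lambda>z. \<lambda>x\<in>X. z (\<sigma> x)) \<in> measurable ?P ?P"
        using \<sigma> by (intro measurable_restrict measurable_component_singleton) auto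
      have "distr m m (\<lambda>z. \<lambda>x\<in>X. z (\<sigma> x)) = distr m ?P (\<lambda>z. \<lambda>x\<in>X. z (\<sigma> x))"
        by (intro distr_cong sets_m refl)
      also have "\<dots> = distr (white_noise \<Otimes>\<^sub>M lborel) ?P (\<Phi> \<sigma>)"
        unfolding m_def using \<sigma>
        by (subst distr_distr) (auto simp: \<Phi>_def o_def split_beta' intro!: distr_cong restrict_ext)
      also have "\<dots> = m"
      proof (cases "X = {}")
        case True then show ?thesis by (simp add: m_def \<Phi>_def restrict_def)
      next
        case False
        then obtain o' where o: "o' \<in> X" by auto
        define M where "M x = Max {N x, N o', N (\<sigma> x), N (\<sigma> o')}" for x
        have M: "N x \<le> M x" "N o' \<le> M x" "N (\<sigma> x) \<le> M x" "N (\<sigma> o') \<le> M x" for x by (auto simp: M_def)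
        have "distr white_noise ?P (\<lambda>\<omega>. \<lambda>x\<in>X. \<Sum>k<M x. (a (\<sigma> x) k - a (\<sigma> o') k) * \<omega> k)
            = distr white_noise ?P (\<lambda>\<omega>. \<lambda>x\<in>X. \<Sum>k<M x. (a x k - a o' k) * \<omega> k)"
        proof (rule gaussian_family_law_unique)
          fix x y n assume x: "x \<in> X" and y: "y \<in> X" and "M x \<le> n" "M y \<le> n"
          then have n: "N x \<le> n" "N y \<le> n" "N o' \<le> n" "N (\<sigma> x) \<le> n" "N (\<sigma> y) \<le> n" "N (\<sigma> o') \<le> n"
            using M[of x] M[of y] by linarith+
          \<comment> \<open>Polarization: inner products of increments are functions of the distances, hence of \<open>\<psi>\<close>.\<close>
          have polar: "(\<Sum>k<n. (a u k - a w k) * (a v k - a w k))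
             = ((\<Sum>k<n. (a u k - a w k)\<^sup>2) + (\<Sum>k<n. (a v k - a w k)\<^sup>2) - (\<Sum>k<n. (a u k - a v k)\<^sup>2)) / 2" for u v w
            by (simp add: sum.distrib[symmetric] sum_subtractf[symmetric] sum_divide_distrib)
               (intro sum.cong refl, simp add: power2_eq_square field_simps)
          have "\<sigma> x \<in> X" "\<sigma> y \<in> X" "\<sigma> o' \<in> X" using \<sigma> x y o by auto
          then show "(\<Sum>k<n. (a (\<sigma> x) k - a (\<sigma> o') k) * (a (\<sigma> y) k - a (\<sigma> o') k))
              = (\<Sum>k<n. (a x k - a o' k) * (a y k - a o' k))"
            unfolding polar using n x y o by (simp add: dist inv)
        next
          show "a (\<sigma> x) k - a (\<sigma> o') k = 0" "a x k - a o' k = 0" if "M x \<le> k" for x k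
            using zero[OF order_trans[OF M(1) that]] zero[OF order_trans[OF M(2) that]]
              zero[OF order_trans[OF M(3) that]] zero[OF order_trans[OF M(4) that]] by simp_all
        qed
        then have law: "distr white_noise ?P (\<lambda>\<omega>. \<lambda>x\<in>X. V (\<sigma> x) \<omega> - V (\<sigma> o') \<omega>)
            = distr white_noise ?P (\<lambda>\<omega>. \<lambda>x\<in>X. V x \<omega> - V o' \<omega>)"
          by (simp add: V_diff[OF M(1,2)] V_diff[OF M(3,4)])
        show ?thesis
          unfolding m_def
        proof (rule measure_eqI)
          fix A assume "A \<in> sets (distr (white_noise \<Otimes>\<^sub>M lborel) ?P (\<Phi> \<sigma>))"
          then have A: "A \<in> sets ?P" by simp
          show "emeasure (distr (white_noise \<Otimes>\<^sub>M lborel) ?P (\<Phi> \<sigma>)) A = emeasure (distr (white_noise \<Otimes>\<^sub>M lborel) ?P (\<Phi> id)) A"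
            unfolding shift_law[OF A, of \<sigma> o'] shift_law[OF A, of id o'] using law by simp
        qed simp
      qed
      finally show ?thesis .
    qed
    fix x y assume x: "x \<in> X" and y: "y \<in> X"
    define n where "n = max (N x) (N y)"
    have n: "N x \<le> n" "N y \<le> n" by (auto simp: n_def)
    define s where "s = sqrt (\<psi> x y)"
    have s: "s = sqrt (\<Sum>k<n. (a x k - a y k)\<^sup>2)" using dist[OF x y n] by (simp add: s_def)
    let ?A = "{z \<in> space ?P. 0 \<le> z x \<and> z y < 0}"
    have [measurable]: "(\<lambda>z. z x) \<in> borel_measurable ?P" "(\<lambda>z. z y) \<in> borel_measurable ?P"
      using x y by (auto intro!: measurable_component_singleton)
    have A [measurable]: "?A \<in> sets ?P" by measurable
    have "emeasure m {z \<in> space m. 0 \<le> z x \<and> z y < 0} = emeasure m ?A"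
      by (simp add: m_def)
    also have "\<dots> = (\<integral>\<^sup>+z. indicator ?A (\<Phi> id z) \<partial>(white_noise \<Otimes>\<^sub>M lborel))"
      unfolding m_def by (subst nn_integral_indicator[symmetric], simp, subst nn_integral_distr) auto
    also have "\<dots> = (\<integral>\<^sup>+\<omega>. \<integral>\<^sup>+t. indicator ?A (\<Phi> id (\<omega>, t)) \<partial>lborel \<partial>white_noise)"
      by (subst lborel.nn_integral_fst[symmetric]) auto
    also have "\<dots> = (\<integral>\<^sup>+\<omega>. ennreal (max 0 (V x \<omega> - V y \<omega>)) \<partial>white_noise)"
    proof (rule nn_integral_cong)
      fix \<omega> assume \<omega>: "\<omega> \<in> space white_noise"
      have "(\<integral>\<^sup>+t. indicator ?A (\<Phi> id (\<omega>, t)) \<partial>lborel) = (\<integral>\<^sup>+t. indicator {- V x \<omega>..<- V y \<omega>} t \<partial>lborel)"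
        using x y by (intro nn_integral_cong) (auto simp: \<Phi>_def indicator_def space_PiM)
      also have "\<dots> = ennreal (max 0 (V x \<omega> - V y \<omega>))"
        by (cases "V y \<omega> \<le> V x \<omega>") (auto simp: max_def)
      finally show "(\<integral>\<^sup>+t. indicator ?A (\<Phi> id (\<omega>, t)) \<partial>lborel) = ennreal (max 0 (V x \<omega> - V y \<omega>))" .
    qed
    also have "\<dots> = (\<integral>\<^sup>+u. ennreal (max 0 u) \<partial>distr white_noise borel (\<lambda>\<omega>. \<Sum>k<n. (a x k - a y k) * \<omega> k))"
      by (subst nn_integral_distr) (auto simp: V_diff[OF n])
    also have "\<dots> = (\<integral>\<^sup>+u. ennreal (max 0 (s * u)) \<partial>std_normal_distribution)"
      unfolding distr_white_noise_combination s by (subst nn_integral_distr) auto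
    also have "\<dots> = ennreal (sqrt (\<psi> x y) * wall_const)"
    proof -
      have "s \<ge> 0" unfolding s by (simp add: sum_nonneg)
      then have "\<bar>s\<bar> = s" by simp
      then show ?thesis by (simp only: std_normal_positive_part s_def[symmetric])
    qed
    finally show "emeasure m {z \<in> space m. 0 \<le> z x \<and> z y < 0} = ennreal (sqrt (\<psi> x y) * wall_const)" .
  qed
qed

text \<open>
  The commensurated set consists of the half-spaces that contain the base point.
\<close>

lemma Lp_action_gaussian_walls:
  fixes \<Gamma> :: "('c, 'd) monoid_scheme" and \<psi> :: "'x \<Rightarrow> 'x \<Rightarrow> real"
  assumes \<Gamma>: "group \<Gamma>" and p: "p \<ge> 1" and X: "countable X" and \<psi>: "cond_neg_def_kernel X \<psi>" and o': "o' \<in> X"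
    and act: "\<And>g x. g \<in> carrier \<Gamma> \<Longrightarrow> x \<in> X \<Longrightarrow> act g x \<in> X"
    and act_one: "\<And>x. x \<in> X \<Longrightarrow> act \<one>\<^bsub>\<Gamma>\<^esub> x = x"
    and act_mult: "\<And>g h x. g \<in> carrier \<Gamma> \<Longrightarrow> h \<in> carrier \<Gamma> \<Longrightarrow> x \<in> X \<Longrightarrow> act (g \<otimes>\<^bsub>\<Gamma>\<^esub> h) x = act g (act h x)"
    and inv: "\<And>g x y. g \<in> carrier \<Gamma> \<Longrightarrow> x \<in> X \<Longrightarrow> y \<in> X \<Longrightarrow> \<psi> (act g x) (act g y) = \<psi> x y"
  shows "\<exists>(m :: ('x \<Rightarrow> real) measure) T (b :: 'c \<Rightarrow> _ \<Rightarrow> 'k::{real_normed_field, euclidean_space}).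
     space m = (X \<rightarrow>\<^sub>E UNIV) \<and> Lp_action \<Gamma> p m T b \<and>
     (\<forall>g\<in>carrier \<Gamma>. ennreal (sqrt (\<psi> o' (act (inv\<^bsub>\<Gamma>\<^esub> g) o')) * wall_const) \<le> Lp_mass p m (b g))"
proof -
  interpret \<Gamma>: group \<Gamma> by fact
  from cond_neg_def_kernel_walls[OF X \<psi>] obtain m :: "('x \<Rightarrow> real) measure" where
    sets_m: "sets m = sets (PiM X (\<lambda>_. borel))"
    and m_inv': "\<forall>\<sigma>\<in>X \<rightarrow> X. (\<forall>x\<in>X. \<forall>y\<in>X. \<psi> (\<sigma> x) (\<sigma> y) = \<psi> x y) \<longrightarrow> distr m m (\<lambda>z. \<lambda>x\<in>X. z (\<sigma> x)) = m"
    and m_wall': "\<forall>x\<in>X. \<forall>y\<in>X. emeasure m {z \<in> space m. 0 \<le> z x \<and> z y < 0} = ennreal (sqrt (\<psi> x y) * wall_const)"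
    by (elim exE conjE)
  note m_inv = m_inv'[rule_format] and m_wall = m_wall'[rule_format]
  have space_m: "space m = (X \<rightarrow>\<^sub>E UNIV)" using sets_eq_imp_space_eq[OF sets_m] by (simp add: space_PiM)
  have comp [measurable]: "(\<lambda>z. z x) \<in> borel_measurable m" if "x \<in> X" for x
    using measurable_component_singleton[OF that, of "\<lambda>_. borel"] by (simp add: sets_m cong: measurable_cong_sets)
  define \<tau> where "\<tau> = (\<lambda>g z. \<lambda>x\<in>X. z (act (inv\<^bsub>\<Gamma>\<^esub> g) x) :: real)"
  define E where "E = {z \<in> space m. 0 \<le> z o'}"
  have \<tau>_meas: "\<tau> g \<in> measurable m m" if "g \<in> carrier \<Gamma>" for g
  proof -
    have "\<tau> g \<in> measurable m (PiM X (\<lambda>_. borel))"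
      unfolding \<tau>_def using that act by (intro measurable_restrict comp) auto
    then show ?thesis by (simp add: sets_m cong: measurable_cong_sets)
  qed
  have D: "{z \<in> E. \<tau> g z \<notin> E} = {z \<in> space m. 0 \<le> z o' \<and> z (act (inv\<^bsub>\<Gamma>\<^esub> g) o') < 0}" if g: "g \<in> carrier \<Gamma>" for g
    using measurable_space[OF \<tau>_meas[OF g]] o' by (auto simp: E_def \<tau>_def)
  have mass_D: "emeasure m {z \<in> E. \<tau> g z \<notin> E} = ennreal (sqrt (\<psi> o' (act (inv\<^bsub>\<Gamma>\<^esub> g) o')) * wall_const)"
    if g: "g \<in> carrier \<Gamma>" for g
    unfolding D[OF g] using g o' act by (intro m_wall) auto
  let ?T = "\<lambda>g (f :: _ \<Rightarrow> 'k) z. f (\<tau> (inv\<^bsub>\<Gamma>\<^esub> g) z)"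
  let ?b = "\<lambda>g z. indicator E (\<tau> (inv\<^bsub>\<Gamma>\<^esub> g) z) - indicator E z :: 'k"
  have comm: "Lp_action \<Gamma> p m ?T ?b"
    "\<And>g. g \<in> carrier \<Gamma> \<Longrightarrow> emeasure m {z \<in> E. \<tau> g z \<notin> E} \<le> Lp_mass p m (?b g)"
  proof -
    have hyps: "distr m m (\<tau> g) = m" if "g \<in> carrier \<Gamma>" for g
      unfolding \<tau>_def using that act inv by (intro m_inv) auto
    have one: "\<tau> \<one>\<^bsub>\<Gamma>\<^esub> z = z" if "z \<in> space m" for z
      using that by (auto simp: \<tau>_def act_one space_m PiE_iff extensional_def fun_eq_iff)
    have mult: "\<tau> (g \<otimes>\<^bsub>\<Gamma>\<^esub> h) z = \<tau> g (\<tau> h z)" if "g \<in> carrier \<Gamma>" "h \<in> carrier \<Gamma>" for g h z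
      using that act by (auto simp: \<tau>_def fun_eq_iff \<Gamma>.inv_mult_group act_mult)
    have E_sets: "E \<in> sets m" unfolding E_def using o' by measurable
    note L = Lp_action_commensurated_set[OF \<Gamma> p \<tau>_meas hyps one mult E_sets]
    show "Lp_action \<Gamma> p m ?T ?b" by (rule L(1)) (auto simp: mass_D)
    show "emeasure m {z \<in> E. \<tau> g z \<notin> E} \<le> Lp_mass p m (?b g)" if "g \<in> carrier \<Gamma>" for g
      by (rule L(2)) (use that in \<open>auto simp: mass_D\<close>)
  qed
  show ?thesis
    by (intro exI[of _ m] exI[of _ ?T] exI[of _ ?b] conjI ballI space_m comm(1))
       (use comm(2) in \<open>simp add: mass_D\<close>)
qed

section \<open>Permutational wreath products\<close>

locale permutational_wreath =
  fixes G :: "('g, 'a) monoid_scheme" and H :: "('h, 'b) monoid_scheme" and I :: "'i set"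
    and act :: "'g \<Rightarrow> 'i \<Rightarrow> 'i"
  assumes group_G: "group G" and group_H: "group H"
    and act_closed: "g \<in> carrier G \<Longrightarrow> i \<in> I \<Longrightarrow> act g i \<in> I"
    and act_one: "i \<in> I \<Longrightarrow> act \<one>\<^bsub>G\<^esub> i = i"
    and act_mult: "g \<in> carrier G \<Longrightarrow> h \<in> carrier G \<Longrightarrow> i \<in> I \<Longrightarrow> act (g \<otimes>\<^bsub>G\<^esub> h) i = act g (act h i)"
    and countable_I: "countable I" and countable_H: "countable (carrier H)"
begin

abbreviation \<Gamma> where "\<Gamma> \<equiv> permutational_wreath_product H I G act"

definition lamps :: "('i \<Rightarrow> 'h) set" where
  "lamps = {w \<in> I \<rightarrow>\<^sub>E carrier H. finite {i \<in> I. w i \<noteq> \<one>\<^bsub>H\<^esub>}}"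

sublocale G: group G by (rule group_G)
sublocale H: group H by (rule group_H)
sublocale wreath: group \<Gamma>
  by (rule group_permutational_wreath_product[OF group_G group_H act_closed act_one act_mult])

lemma carrier_wreath: "carrier \<Gamma> = lamps \<times> carrier G"
  using group_H by (simp add: permutational_wreath_product_def semidirect_product_def lamps_def carrier_sum_group)

lemma one_wreath: "\<one>\<^bsub>\<Gamma>\<^esub> = (\<lambda>i\<in>I. \<one>\<^bsub>H\<^esub>, \<one>\<^bsub>G\<^esub>)"
  by (simp add: permutational_wreath_product_def semidirect_product_def)

lemma mult_wreath:
  "\<gamma> \<otimes>\<^bsub>\<Gamma>\<^esub> \<delta> = (\<lambda>i\<in>I. fst \<gamma> i \<otimes>\<^bsub>H\<^esub> fst \<delta> (act (inv\<^bsub>G\<^esub> (snd \<gamma>)) i), snd \<gamma> \<otimes>\<^bsub>G\<^esub> snd \<delta>)"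
  by (cases \<gamma>; cases \<delta>) (simp add: permutational_wreath_product_def semidirect_product_def cong: restrict_cong)

lemma snd_wreath: "\<gamma> \<in> carrier \<Gamma> \<Longrightarrow> snd \<gamma> \<in> carrier G"
  by (auto simp: carrier_wreath)

lemma fst_wreath: "\<gamma> \<in> carrier \<Gamma> \<Longrightarrow> fst \<gamma> \<in> lamps"
  by (auto simp: carrier_wreath)

lemma lamps_carrier: "w \<in> lamps \<Longrightarrow> i \<in> I \<Longrightarrow> w i \<in> carrier H"
  by (auto simp: lamps_def)

lemma snd_inv_wreath: "\<gamma> \<in> carrier \<Gamma> \<Longrightarrow> snd (inv\<^bsub>\<Gamma>\<^esub> \<gamma>) = inv\<^bsub>G\<^esub> (snd \<gamma>)"
proof -
  assume \<gamma>: "\<gamma> \<in> carrier \<Gamma>"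
  have "snd (inv\<^bsub>\<Gamma>\<^esub> \<gamma>) \<otimes>\<^bsub>G\<^esub> snd \<gamma> = snd (inv\<^bsub>\<Gamma>\<^esub> \<gamma> \<otimes>\<^bsub>\<Gamma>\<^esub> \<gamma>)" by (simp add: mult_wreath)
  also have "\<dots> = \<one>\<^bsub>G\<^esub>" using \<gamma> by (simp add: one_wreath)
  finally show ?thesis
    using \<gamma> snd_wreath[OF \<gamma>] snd_wreath[OF wreath.inv_closed[OF \<gamma>]] G.inv_equality by metis
qed

lemma countable_lamps: "countable lamps"
proof -
  let ?enc = "\<lambda>w. {(i, w i) |i. i \<in> I \<and> w i \<noteq> \<one>\<^bsub>H\<^esub>}"
  have inj: "inj_on ?enc lamps"
  proof (rule inj_onI, rule ext)
    fix u v i assume u: "u \<in> lamps" and v: "v \<in> lamps" and eq: "?enc u = ?enc v"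
    show "u i = v i"
    proof (cases "i \<in> I")
      case True
      have "(i, u i) \<in> ?enc u \<longleftrightarrow> (i, u i) \<in> ?enc v" "(i, v i) \<in> ?enc u \<longleftrightarrow> (i, v i) \<in> ?enc v"
        using eq by auto
      then show ?thesis using True by auto
    next
      case False
      then show ?thesis using u v by (auto simp: lamps_def PiE_iff extensional_def)
    qed
  qed
  have sub: "?enc ` lamps \<subseteq> {A. finite A \<and> A \<subseteq> I \<times> carrier H}"
  proof safe
    fix w assume w: "w \<in> lamps"
    have "?enc w = (\<lambda>i. (i, w i)) ` {i \<in> I. w i \<noteq> \<one>\<^bsub>H\<^esub>}" by auto
    then show "finite (?enc w)" using w by (simp add: lamps_def)
    fix i assume "i \<in> I" then show "w i \<in> carrier H" using w by (rule lamps_carrier[rotated])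
  qed
  have cnt: "countable {A. finite A \<and> A \<subseteq> I \<times> carrier H}"
    by (intro countable_Collect_finite_subset countable_SIGMA countable_I countable_H)
  show ?thesis by (rule countable_image_inj_on[OF countable_subset[OF sub cnt] inj])
qed

lemma act_inv_cancel:
  assumes "g \<in> carrier G" "i \<in> I"
  shows "act g (act (inv\<^bsub>G\<^esub> g) i) = i" "act (inv\<^bsub>G\<^esub> g) (act g i) = i"
  using assms by (simp_all add: act_one flip: act_mult)

text \<open>
  The point \<open>(y, v)\<close> stands for the half-space of all \<open>i\<close> with \<open>0 \<le> y i\<close> and a configuration \<open>v\<close> of
  lamps. Both are translated by the \<open>G\<close>-component, and the lamps outside the translated half-space are
  then multiplied by the other component. Lamps inside the half-space are carried along unmultiplied, so
  that for a fixed half-space every group element acts by a bijection of all configurations and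
  preserves the product of the law of \<open>y\<close> and the counting measure.
\<close>

definition shift_lamps :: "(('i \<Rightarrow> 'h) \<times> 'g) \<Rightarrow> ('i \<Rightarrow> real) \<times> ('i \<Rightarrow> 'h) \<Rightarrow> ('i \<Rightarrow> real) \<times> ('i \<Rightarrow> 'h)" where
  "shift_lamps \<gamma> = (\<lambda>(y, v).
     (\<lambda>i\<in>I. y (act (inv\<^bsub>G\<^esub> (snd \<gamma>)) i),
      \<lambda>i\<in>I. if 0 \<le> y (act (inv\<^bsub>G\<^esub> (snd \<gamma>)) i) then v (act (inv\<^bsub>G\<^esub> (snd \<gamma>)) i)
             else fst \<gamma> i \<otimes>\<^bsub>H\<^esub> v (act (inv\<^bsub>G\<^esub> (snd \<gamma>)) i)))"

lemma finite_support_translate: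
  assumes "g \<in> carrier G" "v \<in> lamps"
  shows "finite {i \<in> I. v (act (inv\<^bsub>G\<^esub> g) i) \<noteq> \<one>\<^bsub>H\<^esub>}"
proof (rule finite_subset)
  show "{i \<in> I. v (act (inv\<^bsub>G\<^esub> g) i) \<noteq> \<one>\<^bsub>H\<^esub>} \<subseteq> act g ` {i \<in> I. v i \<noteq> \<one>\<^bsub>H\<^esub>}"
  proof
    fix i assume i: "i \<in> {i \<in> I. v (act (inv\<^bsub>G\<^esub> g) i) \<noteq> \<one>\<^bsub>H\<^esub>}"
    then have "act (inv\<^bsub>G\<^esub> g) i \<in> {i \<in> I. v i \<noteq> \<one>\<^bsub>H\<^esub>}" using assms act_closed by auto
    moreover have "i = act g (act (inv\<^bsub>G\<^esub> g) i)" using i assms act_inv_cancel by simp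
    ultimately show "i \<in> act g ` {i \<in> I. v i \<noteq> \<one>\<^bsub>H\<^esub>}" by (rule rev_image_eqI)
  qed
  show "finite (act g ` {i \<in> I. v i \<noteq> \<one>\<^bsub>H\<^esub>})" using assms by (simp add: lamps_def)
qed

lemma translate_lamps:
  assumes "g \<in> carrier G" "v \<in> lamps"
  shows "(\<lambda>i\<in>I. v (act (inv\<^bsub>G\<^esub> g) i)) \<in> lamps"
  using assms finite_support_translate[OF assms] lamps_carrier act_closed
  by (auto simp: lamps_def cong: conj_cong)

lemma multiply_lamps:
  assumes "w \<in> lamps" "v \<in> lamps"
  shows "(\<lambda>i\<in>I. if P i then v i else w i \<otimes>\<^bsub>H\<^esub> v i) \<in> lamps"
proof -
  have "finite {i \<in> I. (if P i then v i else w i \<otimes>\<^bsub>H\<^esub> v i) \<noteq> \<one>\<^bsub>H\<^esub>}"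
    by (rule finite_subset[of _ "{i \<in> I. v i \<noteq> \<one>\<^bsub>H\<^esub>} \<union> {i \<in> I. w i \<noteq> \<one>\<^bsub>H\<^esub>}"])
       (use assms in \<open>auto simp: lamps_def split: if_splits\<close>)
  then show ?thesis using assms lamps_carrier by (auto simp: lamps_def cong: conj_cong)
qed

lemma inverse_lamps:
  assumes "w \<in> lamps"
  shows "(\<lambda>i\<in>I. inv\<^bsub>H\<^esub> (w i)) \<in> lamps"
proof -
  have "finite {i \<in> I. inv\<^bsub>H\<^esub> (w i) \<noteq> \<one>\<^bsub>H\<^esub>}"
    by (rule finite_subset[of _ "{i \<in> I. w i \<noteq> \<one>\<^bsub>H\<^esub>}"]) (use assms in \<open>auto simp: lamps_def\<close>)
  then show ?thesis using assms lamps_carrier by (auto simp: lamps_def cong: conj_cong)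
qed

lemma lamps_eqI: "u \<in> lamps \<Longrightarrow> v \<in> lamps \<Longrightarrow> (\<And>i. i \<in> I \<Longrightarrow> u i = v i) \<Longrightarrow> u = v"
  by (rule PiE_ext[of _ I "\<lambda>_. carrier H"]) (auto simp: lamps_def)

lemma bij_translate_lamps:
  assumes g: "g \<in> carrier G"
  shows "bij_betw (\<lambda>v. \<lambda>i\<in>I. v (act (inv\<^bsub>G\<^esub> g) i)) lamps lamps"
proof (rule bij_betw_byWitness[where f' = "\<lambda>v. \<lambda>i\<in>I. v (act g i)"])
  have *: "(\<lambda>i\<in>I. v (act g i)) \<in> lamps" if "v \<in> lamps" for v
    using translate_lamps[of "inv\<^bsub>G\<^esub> g" v] g that by simp
  show "\<forall>v\<in>lamps. (\<lambda>i\<in>I. (\<lambda>i\<in>I. v (act (inv\<^bsub>G\<^esub> g) i)) (act g i)) = v"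
    using g act_closed act_inv_cancel by (intro ballI lamps_eqI * translate_lamps) auto
  show "\<forall>v\<in>lamps. (\<lambda>i\<in>I. (\<lambda>i\<in>I. v (act g i)) (act (inv\<^bsub>G\<^esub> g) i)) = v"
    using g act_closed act_inv_cancel by (intro ballI lamps_eqI * translate_lamps) auto
  show "(\<lambda>v. \<lambda>i\<in>I. v (act (inv\<^bsub>G\<^esub> g) i)) ` lamps \<subseteq> lamps" using g translate_lamps by blast
  show "(\<lambda>v. \<lambda>i\<in>I. v (act g i)) ` lamps \<subseteq> lamps" using * by blast
qed

lemma bij_multiply_lamps:
  assumes w: "w \<in> lamps"
  shows "bij_betw (\<lambda>v. \<lambda>i\<in>I. if P i then v i else w i \<otimes>\<^bsub>H\<^esub> v i) lamps lamps"
proof (rule bij_betw_byWitness[where f' = "\<lambda>v. \<lambda>i\<in>I. if P i then v i else inv\<^bsub>H\<^esub> (w i) \<otimes>\<^bsub>H\<^esub> v i"])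
  have *: "(\<lambda>i\<in>I. if P i then v i else inv\<^bsub>H\<^esub> (w i) \<otimes>\<^bsub>H\<^esub> v i) \<in> lamps" if "v \<in> lamps" for v
  proof -
    have "(\<lambda>i\<in>I. if P i then v i else inv\<^bsub>H\<^esub> (w i) \<otimes>\<^bsub>H\<^esub> v i)
        = (\<lambda>i\<in>I. if P i then v i else (\<lambda>i\<in>I. inv\<^bsub>H\<^esub> (w i)) i \<otimes>\<^bsub>H\<^esub> v i)"
      by (rule restrict_ext) simp
    then show ?thesis using multiply_lamps[OF inverse_lamps[OF w] that, of P] by (simp only:)
  qed
  show "\<forall>v\<in>lamps. (\<lambda>i\<in>I. if P i then (\<lambda>i\<in>I. if P i then v i else w i \<otimes>\<^bsub>H\<^esub> v i) i
      else inv\<^bsub>H\<^esub> (w i) \<otimes>\<^bsub>H\<^esub> (\<lambda>i\<in>I. if P i then v i else w i \<otimes>\<^bsub>H\<^esub> v i) i) = v"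
    using w lamps_carrier by (intro ballI lamps_eqI * multiply_lamps) (auto simp flip: H.m_assoc)
  show "\<forall>v\<in>lamps. (\<lambda>i\<in>I. if P i then (\<lambda>i\<in>I. if P i then v i else inv\<^bsub>H\<^esub> (w i) \<otimes>\<^bsub>H\<^esub> v i) i
      else w i \<otimes>\<^bsub>H\<^esub> (\<lambda>i\<in>I. if P i then v i else inv\<^bsub>H\<^esub> (w i) \<otimes>\<^bsub>H\<^esub> v i) i) = v"
    using w lamps_carrier by (intro ballI lamps_eqI * multiply_lamps) (auto simp flip: H.m_assoc)
  show "(\<lambda>v. \<lambda>i\<in>I. if P i then v i else w i \<otimes>\<^bsub>H\<^esub> v i) ` lamps \<subseteq> lamps"
    using multiply_lamps[OF w] by blast
  show "(\<lambda>v. \<lambda>i\<in>I. if P i then v i else inv\<^bsub>H\<^esub> (w i) \<otimes>\<^bsub>H\<^esub> v i) ` lamps \<subseteq> lamps"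
    using * by blast
qed

lemma shift_lamps_one:
  assumes "y \<in> extensional I" "v \<in> lamps"
  shows "shift_lamps \<one>\<^bsub>\<Gamma>\<^esub> (y, v) = (y, v)"
proof -
  have outside: "y i = undefined" "v i = undefined" if "i \<notin> I" for i
    using assms that by (simp_all add: extensional_def lamps_def PiE_iff)
  have "(\<lambda>i\<in>I. y (act (inv\<^bsub>G\<^esub> \<one>\<^bsub>G\<^esub>) i)) = y"
    by (rule ext) (simp add: act_one outside)
  moreover have "(\<lambda>i\<in>I. if 0 \<le> y (act (inv\<^bsub>G\<^esub> \<one>\<^bsub>G\<^esub>) i) then v (act (inv\<^bsub>G\<^esub> \<one>\<^bsub>G\<^esub>) i)
      else (\<lambda>i\<in>I. \<one>\<^bsub>H\<^esub>) i \<otimes>\<^bsub>H\<^esub> v (act (inv\<^bsub>G\<^esub> \<one>\<^bsub>G\<^esub>) i)) = v"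
    by (rule ext) (simp add: act_one outside lamps_carrier[OF assms(2)])
  ultimately show ?thesis by (simp only: shift_lamps_def one_wreath fst_conv snd_conv prod.case)
qed

text \<open>
  Whether a lamp is multiplied depends on its final position relative to the final half-space, and the
  second translation moves lamp and half-space together; so a lamp is multiplied either by both elements
  or by none.
\<close>

lemma shift_lamps_mult:
  assumes \<gamma>: "\<gamma> \<in> carrier \<Gamma>" and \<delta>: "\<delta> \<in> carrier \<Gamma>" and v: "v \<in> lamps"
  shows "shift_lamps (\<gamma> \<otimes>\<^bsub>\<Gamma>\<^esub> \<delta>) (y, v) = shift_lamps \<gamma> (shift_lamps \<delta> (y, v))"
proof -
  note c = snd_wreath[OF \<gamma>] snd_wreath[OF \<delta>]
  note l = fst_wreath[OF \<gamma>] fst_wreath[OF \<delta>]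
  have a: "act (inv\<^bsub>G\<^esub> (snd \<gamma> \<otimes>\<^bsub>G\<^esub> snd \<delta>)) i = act (inv\<^bsub>G\<^esub> (snd \<delta>)) (act (inv\<^bsub>G\<^esub> (snd \<gamma>)) i)" if "i \<in> I" for i
    using c that by (simp add: G.inv_mult_group act_mult)
  have b: "act (inv\<^bsub>G\<^esub> (snd \<gamma>)) i \<in> I" "act (inv\<^bsub>G\<^esub> (snd \<delta>)) (act (inv\<^bsub>G\<^esub> (snd \<gamma>)) i) \<in> I" if "i \<in> I" for i
    using c that act_closed by auto
  show ?thesis
    unfolding shift_lamps_def mult_wreath fst_conv snd_conv prod.case
    by (intro arg_cong2[where f = Pair] restrict_ext)
       (simp_all add: a b H.m_assoc lamps_carrier[OF l(1)] lamps_carrier[OF l(2)] lamps_carrier[OF v])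
qed

text \<open>
  The commensurated set \<open>E\<close> consists of the half-spaces containing \<open>o'\<close>, with trivial lamps. A point of
  \<open>E\<close> stays in \<open>E\<close> under \<open>\<gamma> = (w, g)\<close> if the translated half-space contains \<open>o'\<close> and also every \<open>j\<close> in
  the support of \<open>w\<close>, as otherwise the lamp at \<open>j\<close> becomes \<open>w j\<close>. So the set of points that leave is the
  union of the finitely many sets \<open>near \<gamma> j\<close> of half-spaces separating \<open>o'\<close> from the inverse translate of
  \<open>o'\<close> or of such a \<open>j\<close>, each of finite measure.
\<close>

lemma Lp_action_wreath_walls:
  assumes p: "p \<ge> 1" and \<psi>: "cond_neg_def_kernel I \<psi>" and o': "o' \<in> I"
    and inv: "\<And>g i j. g \<in> carrier G \<Longrightarrow> i \<in> I \<Longrightarrow> j \<in> I \<Longrightarrow> \<psi> (act g i) (act g j) = \<psi> i j"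
  shows "\<exists>(m :: (('i \<Rightarrow> real) \<times> ('i \<Rightarrow> 'h)) measure) T (b :: _ \<Rightarrow> _ \<Rightarrow> 'k::{real_normed_field, euclidean_space}).
     space m = (I \<rightarrow>\<^sub>E UNIV) \<times> lamps \<and> Lp_action \<Gamma> p m T b \<and>
     (\<forall>\<gamma>\<in>carrier \<Gamma>. \<forall>j\<in>I. fst \<gamma> j \<noteq> \<one>\<^bsub>H\<^esub> \<longrightarrow>
        ennreal (sqrt (\<psi> o' (act (inv\<^bsub>G\<^esub> (snd \<gamma>)) j)) * wall_const) \<le> Lp_mass p m (b \<gamma>))"
proof -
  from cond_neg_def_kernel_walls[OF countable_I \<psi>] obtain m :: "('i \<Rightarrow> real) measure" where
    sets_m: "sets m = sets (PiM I (\<lambda>_. borel))"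
    and m_inv': "\<forall>\<sigma>\<in>I \<rightarrow> I. (\<forall>x\<in>I. \<forall>y\<in>I. \<psi> (\<sigma> x) (\<sigma> y) = \<psi> x y) \<longrightarrow> distr m m (\<lambda>z. \<lambda>x\<in>I. z (\<sigma> x)) = m"
    and m_wall': "\<forall>x\<in>I. \<forall>y\<in>I. emeasure m {z \<in> space m. 0 \<le> z x \<and> z y < 0} = ennreal (sqrt (\<psi> x y) * wall_const)"
    by (elim exE conjE)
  note m_inv = m_inv'[rule_format] and m_wall = m_wall'[rule_format]
  have space_m: "space m = (I \<rightarrow>\<^sub>E UNIV)" using sets_eq_imp_space_eq[OF sets_m] by (simp add: space_PiM)
  have comp [measurable]: "(\<lambda>z. z x) \<in> borel_measurable m" if "x \<in> I" for x
    using measurable_component_singleton[OF that, of "\<lambda>_. borel"] by (simp add: sets_m cong: measurable_cong_sets)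
  let ?W = "count_space lamps"
  let ?\<Omega> = "m \<Otimes>\<^sub>M ?W"
  interpret W: sigma_finite_measure ?W by (rule sigma_finite_measure_count_space_countable[OF countable_lamps])
  have space_\<Omega>: "space ?\<Omega> = (I \<rightarrow>\<^sub>E UNIV) \<times> lamps" by (simp add: space_pair_measure space_m)
  note meas_iff = measurable_countable_slices_iff[OF countable_lamps]
  define tr where "tr = (\<lambda>g (y :: 'i \<Rightarrow> real). \<lambda>i\<in>I. y (act (inv\<^bsub>G\<^esub> g) i))"
  have tr_meas [measurable]: "tr g \<in> measurable m m" if "g \<in> carrier G" for g
  proof -
    have "tr g \<in> measurable m (PiM I (\<lambda>_. borel))"
      unfolding tr_def using that act_closed by (intro measurable_restrict comp) auto
    then show ?thesis by (simp add: sets_m cong: measurable_cong_sets)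
  qed
  have tr_pres: "distr m m (tr g) = m" if "g \<in> carrier G" for g
    unfolding tr_def using that act_closed inv by (intro m_inv) auto
  define mul where "mul = (\<lambda>w (y :: 'i \<Rightarrow> real) v. \<lambda>i\<in>I. if 0 \<le> y i then v i else w i \<otimes>\<^bsub>H\<^esub> v i)"
  define trv where "trv = (\<lambda>g (v :: 'i \<Rightarrow> 'h). \<lambda>i\<in>I. v (act (inv\<^bsub>G\<^esub> g) i))"
  have shift: "shift_lamps \<gamma> (y, v) = (tr (snd \<gamma>) y, mul (fst \<gamma>) (tr (snd \<gamma>) y) (trv (snd \<gamma>) v))" for \<gamma> y v
    by (auto simp: shift_lamps_def tr_def mul_def trv_def intro!: restrict_ext)
  have mul_lamps: "mul w y v \<in> lamps" if "w \<in> lamps" "v \<in> lamps" for w y v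
    unfolding mul_def using that by (rule multiply_lamps)
  have trv_lamps: "trv g v \<in> lamps" if "g \<in> carrier G" "v \<in> lamps" for g v
    unfolding trv_def using that by (rule translate_lamps)
  have mul_meas: "(\<lambda>y. mul w y v) \<in> measurable m ?W" if w: "w \<in> lamps" and v: "v \<in> lamps" for w v
    unfolding measurable_count_space_eq_countable[OF countable_lamps]
  proof (intro conjI ballI)
    show "(\<lambda>y. mul w y v) \<in> space m \<rightarrow> lamps" using w v mul_lamps by auto
    fix u assume u: "u \<in> lamps"
    have "(\<lambda>y. mul w y v) -` {u} \<inter> space m = {y \<in> space m. \<forall>i\<in>I. mul w y v i = u i}"
      using lamps_eqI[OF mul_lamps[OF w v] u] by auto
    also have "\<dots> \<in> sets m"
    proof (rule sets.sets_Collect_countable_All'[OF _ countable_I])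
      fix i assume i: "i \<in> I"
      have [measurable]: "(\<lambda>z. z i) \<in> borel_measurable m" using i by (rule comp)
      have "{y \<in> space m. mul w y v i = u i}
          = {y \<in> space m. if 0 \<le> y i then v i = u i else w i \<otimes>\<^bsub>H\<^esub> v i = u i}"
        using i by (auto simp: mul_def)
      also have "\<dots> \<in> sets m" by measurable
      finally show "{y \<in> space m. mul w y v i = u i} \<in> sets m" .
    qed
    finally show "(\<lambda>y. mul w y v) -` {u} \<inter> space m \<in> sets m" .
  qed
  have mul_pair_meas: "(\<lambda>(y, v). (y, mul w y v)) \<in> measurable ?\<Omega> ?\<Omega>" if w: "w \<in> lamps" for w
    unfolding meas_iff using mul_meas[OF w] by auto
  have shift_meas: "shift_lamps \<gamma> \<in> measurable ?\<Omega> ?\<Omega>" if \<gamma>: "\<gamma> \<in> carrier \<Gamma>" for \<gamma>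
    unfolding meas_iff shift
  proof (intro ballI measurable_Pair)
    fix v assume v: "v \<in> lamps"
    show "tr (snd \<gamma>) \<in> measurable m m" using tr_meas[OF snd_wreath[OF \<gamma>]] .
    show "(\<lambda>y. mul (fst \<gamma>) (tr (snd \<gamma>) y) (trv (snd \<gamma>) v)) \<in> measurable m ?W"
      using mul_meas[OF fst_wreath[OF \<gamma>] trv_lamps[OF snd_wreath[OF \<gamma>] v]] tr_meas[OF snd_wreath[OF \<gamma>]]
      by (rule measurable_compose[rotated])
  qed
  \<comment> \<open>Fubini in both orders: for fixed lamps the translation preserves \<open>m\<close>, and for a fixed half-space the
      translation and the multiplication of lamps permute the configurations.\<close>
  have shift_pres: "distr ?\<Omega> ?\<Omega> (shift_lamps \<gamma>) = ?\<Omega>" if \<gamma>: "\<gamma> \<in> carrier \<Gamma>" for \<gamma>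
  proof (rule measure_eqI)
    fix A assume "A \<in> sets (distr ?\<Omega> ?\<Omega> (shift_lamps \<gamma>))"
    then have A [measurable]: "A \<in> sets ?\<Omega>" by simp
    note g = snd_wreath[OF \<gamma>] and w = fst_wreath[OF \<gamma>]
    have [measurable]: "shift_lamps \<gamma> \<in> measurable ?\<Omega> ?\<Omega>" by (rule shift_meas[OF \<gamma>])
    have [measurable]: "(\<lambda>(y, v). (y, mul (fst \<gamma>) y v)) \<in> measurable ?\<Omega> ?\<Omega>" by (rule mul_pair_meas[OF w])
    let ?f = "\<lambda>z. indicator A ((\<lambda>(y, v). (y, mul (fst \<gamma>) y v)) z) :: ennreal"
    have f [measurable]: "?f \<in> borel_measurable ?\<Omega>" by measurable
    have f_slice [measurable]: "(\<lambda>y. ?f (y, v)) \<in> borel_measurable m" if "v \<in> lamps" for v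
      using f that unfolding meas_iff by blast
    have "emeasure (distr ?\<Omega> ?\<Omega> (shift_lamps \<gamma>)) A = (\<integral>\<^sup>+z. indicator A z \<partial>distr ?\<Omega> ?\<Omega> (shift_lamps \<gamma>))"
      by simp
    also have "\<dots> = (\<integral>\<^sup>+z. indicator A (shift_lamps \<gamma> z) \<partial>?\<Omega>)"
      by (subst nn_integral_distr) auto
    also have "\<dots> = (\<integral>\<^sup>+v. (\<integral>\<^sup>+y. indicator A (shift_lamps \<gamma> (y, v)) \<partial>m) \<partial>?W)"
      by (rule nn_integral_countable_slices[OF countable_lamps]) measurable
    also have "\<dots> = (\<integral>\<^sup>+v. (\<integral>\<^sup>+y. ?f (y, trv (snd \<gamma>) v) \<partial>m) \<partial>?W)"
    proof (rule nn_integral_cong)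
      fix v assume "v \<in> space ?W"
      then have v: "trv (snd \<gamma>) v \<in> lamps" using trv_lamps[OF g] by simp
      have "(\<integral>\<^sup>+y. ?f (y, trv (snd \<gamma>) v) \<partial>m) = (\<integral>\<^sup>+y. ?f (y, trv (snd \<gamma>) v) \<partial>distr m m (tr (snd \<gamma>)))"
        by (simp add: tr_pres[OF g])
      also have "\<dots> = (\<integral>\<^sup>+y. indicator A (shift_lamps \<gamma> (y, v)) \<partial>m)"
        by (subst nn_integral_distr[OF tr_meas[OF g]]) (use f_slice[OF v] in \<open>simp_all add: shift\<close>)
      finally show "(\<integral>\<^sup>+y. indicator A (shift_lamps \<gamma> (y, v)) \<partial>m) = (\<integral>\<^sup>+y. ?f (y, trv (snd \<gamma>) v) \<partial>m)" ..
    qed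
    also have "\<dots> = (\<integral>\<^sup>+v. (\<integral>\<^sup>+y. ?f (y, v) \<partial>m) \<partial>?W)"
      using bij_translate_lamps[OF g] unfolding trv_def by (rule nn_integral_bij_count_space)
    also have "\<dots> = (\<integral>\<^sup>+y. (\<integral>\<^sup>+v. ?f (y, v) \<partial>?W) \<partial>m)"
      by (rule nn_integral_count_space_nn_integral[OF countable_lamps f_slice, symmetric])
    also have "\<dots> = (\<integral>\<^sup>+y. (\<integral>\<^sup>+v. indicator A (y, v) \<partial>?W) \<partial>m)"
    proof (rule nn_integral_cong)
      fix y
      show "(\<integral>\<^sup>+v. ?f (y, v) \<partial>?W) = (\<integral>\<^sup>+v. indicator A (y, v) \<partial>?W)"
        using nn_integral_bij_count_space[OF bij_multiply_lamps[OF w, of "\<lambda>i. 0 \<le> y i"], of "\<lambda>v. indicator A (y, v)"]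
        by (simp add: mul_def)
    qed
    also have "\<dots> = (\<integral>\<^sup>+z. indicator A z \<partial>?\<Omega>)"
      by (rule W.nn_integral_fst) measurable
    also have "\<dots> = emeasure ?\<Omega> A" by simp
    finally show "emeasure (distr ?\<Omega> ?\<Omega> (shift_lamps \<gamma>)) A = emeasure ?\<Omega> A" .
  qed simp
  define e where "e = (\<lambda>i\<in>I. \<one>\<^bsub>H\<^esub>)"
  have e: "e \<in> lamps" by (auto simp: e_def lamps_def)
  define E where "E = {y \<in> space m. 0 \<le> y o'} \<times> {e}"
  have [measurable]: "(\<lambda>z. z o') \<in> borel_measurable m" using o' by (rule comp)
  have E_sets: "E \<in> sets ?\<Omega>" unfolding E_def using e by (intro pair_measureI) auto
  have shift_E: "shift_lamps \<gamma> (y, e) \<in> E \<longleftrightarrow>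
      0 \<le> y (act (inv\<^bsub>G\<^esub> (snd \<gamma>)) o') \<and> (\<forall>j\<in>I. fst \<gamma> j \<noteq> \<one>\<^bsub>H\<^esub> \<longrightarrow> 0 \<le> y (act (inv\<^bsub>G\<^esub> (snd \<gamma>)) j))"
    if \<gamma>: "\<gamma> \<in> carrier \<Gamma>" and y: "y \<in> space m" for \<gamma> y
  proof -
    note g = snd_wreath[OF \<gamma>] and w = fst_wreath[OF \<gamma>]
    have "trv (snd \<gamma>) e = e" using g act_closed by (auto simp: trv_def e_def fun_eq_iff)
    moreover have "mul (fst \<gamma>) (tr (snd \<gamma>) y) e = e \<longleftrightarrow> (\<forall>j\<in>I. fst \<gamma> j \<noteq> \<one>\<^bsub>H\<^esub> \<longrightarrow> 0 \<le> tr (snd \<gamma>) y j)"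
      using lamps_carrier[OF w] by (auto simp: mul_def e_def fun_eq_iff)
    moreover have "tr (snd \<gamma>) y \<in> space m" using measurable_space[OF tr_meas[OF g] y] .
    ultimately show ?thesis using o' by (simp add: shift E_def) (simp add: tr_def)
  qed
  define near where "near \<gamma> j = {y \<in> space m. 0 \<le> y o' \<and> y (act (inv\<^bsub>G\<^esub> (snd \<gamma>)) j) < 0}" for \<gamma> :: "('i \<Rightarrow> 'h) \<times> 'g" and j
  have near: "near \<gamma> j \<in> sets m" "emeasure m (near \<gamma> j) = ennreal (sqrt (\<psi> o' (act (inv\<^bsub>G\<^esub> (snd \<gamma>)) j)) * wall_const)"
    if \<gamma>: "\<gamma> \<in> carrier \<Gamma>" and j: "j \<in> I" for \<gamma> j
  proof -
    have i: "act (inv\<^bsub>G\<^esub> (snd \<gamma>)) j \<in> I" using snd_wreath[OF \<gamma>] act_closed j by simp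
    have [measurable]: "(\<lambda>z. z (act (inv\<^bsub>G\<^esub> (snd \<gamma>)) j)) \<in> borel_measurable m" by (rule comp[OF i])
    show "near \<gamma> j \<in> sets m" unfolding near_def by measurable
    show "emeasure m (near \<gamma> j) = ennreal (sqrt (\<psi> o' (act (inv\<^bsub>G\<^esub> (snd \<gamma>)) j)) * wall_const)"
      unfolding near_def by (rule m_wall[OF o' i])
  qed
  have D: "{z \<in> E. shift_lamps \<gamma> z \<notin> E} = (\<Union>j\<in>insert o' {j \<in> I. fst \<gamma> j \<noteq> \<one>\<^bsub>H\<^esub>}. near \<gamma> j) \<times> {e}"
    if \<gamma>: "\<gamma> \<in> carrier \<Gamma>" for \<gamma>
  proof (rule Set.set_eqI)
    fix z :: "('i \<Rightarrow> real) \<times> ('i \<Rightarrow> 'h)"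
    obtain y v where z: "z = (y, v)" by (cases z)
    have "z \<in> {z \<in> E. shift_lamps \<gamma> z \<notin> E} \<longleftrightarrow> (y \<in> space m \<and> 0 \<le> y o' \<and> v = e) \<and> shift_lamps \<gamma> (y, e) \<notin> E"
      unfolding z by (auto simp: E_def)
    also have "\<dots> \<longleftrightarrow> z \<in> (\<Union>j\<in>insert o' {j \<in> I. fst \<gamma> j \<noteq> \<one>\<^bsub>H\<^esub>}. near \<gamma> j) \<times> {e}"
      unfolding z using shift_E[OF \<gamma>, of y] by (auto simp: near_def not_le) (meson leD)
    finally show "z \<in> {z \<in> E. shift_lamps \<gamma> z \<notin> E} \<longleftrightarrow> \<dots>" .
  qed
  have mass_D: "emeasure ?\<Omega> {z \<in> E. shift_lamps \<gamma> z \<notin> E} = emeasure m (\<Union>j\<in>insert o' {j \<in> I. fst \<gamma> j \<noteq> \<one>\<^bsub>H\<^esub>}. near \<gamma> j)"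
    if \<gamma>: "\<gamma> \<in> carrier \<Gamma>" for \<gamma>
  proof -
    have fin: "finite (insert o' {j \<in> I. fst \<gamma> j \<noteq> \<one>\<^bsub>H\<^esub>})" using fst_wreath[OF \<gamma>] by (simp add: lamps_def)
    have "(\<Union>j\<in>insert o' {j \<in> I. fst \<gamma> j \<noteq> \<one>\<^bsub>H\<^esub>}. near \<gamma> j) \<in> sets m"
      by (rule sets.finite_UN[OF fin]) (use near[OF \<gamma>] o' in auto)
    then show ?thesis
      unfolding D[OF \<gamma>] using e by (subst W.emeasure_pair_measure_Times) auto
  qed
  have fin_D: "emeasure ?\<Omega> {z \<in> E. shift_lamps \<gamma> z \<notin> E} < \<infinity>" if \<gamma>: "\<gamma> \<in> carrier \<Gamma>" for \<gamma>
  proof -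
    let ?J = "insert o' {j \<in> I. fst \<gamma> j \<noteq> \<one>\<^bsub>H\<^esub>}"
    have fin: "finite ?J" using fst_wreath[OF \<gamma>] by (simp add: lamps_def)
    have "emeasure m (\<Union>j\<in>?J. near \<gamma> j) \<le> (\<Sum>j\<in>?J. emeasure m (near \<gamma> j))"
      by (rule emeasure_subadditive_finite[OF fin]) (use near[OF \<gamma>] o' in auto)
    also have "\<dots> < \<infinity>" using near(2)[OF \<gamma>] o' fin by simp
    finally show ?thesis unfolding mass_D[OF \<gamma>] .
  qed
  let ?T = "\<lambda>\<gamma> (f :: _ \<Rightarrow> 'k) z. f (shift_lamps (inv\<^bsub>\<Gamma>\<^esub> \<gamma>) z)"
  let ?b = "\<lambda>\<gamma> z. indicator E (shift_lamps (inv\<^bsub>\<Gamma>\<^esub> \<gamma>) z) - indicator E z :: 'k"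
  have one: "shift_lamps \<one>\<^bsub>\<Gamma>\<^esub> z = z" if "z \<in> space ?\<Omega>" for z
    using that shift_lamps_one by (cases z) (auto simp: space_\<Omega> PiE_iff)
  have mult: "shift_lamps (\<gamma> \<otimes>\<^bsub>\<Gamma>\<^esub> \<delta>) z = shift_lamps \<gamma> (shift_lamps \<delta> z)"
    if "\<gamma> \<in> carrier \<Gamma>" "\<delta> \<in> carrier \<Gamma>" "z \<in> space ?\<Omega>" for \<gamma> \<delta> z
    using that shift_lamps_mult by (cases z) (auto simp: space_\<Omega>)
  note L = Lp_action_commensurated_set[OF wreath.group_axioms p shift_meas shift_pres one mult E_sets fin_D]
  have low: "ennreal (sqrt (\<psi> o' (act (inv\<^bsub>G\<^esub> (snd \<gamma>)) j)) * wall_const) \<le> Lp_mass p ?\<Omega> (?b \<gamma>)"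
    if \<gamma>: "\<gamma> \<in> carrier \<Gamma>" and j: "j \<in> I" and ne: "fst \<gamma> j \<noteq> \<one>\<^bsub>H\<^esub>" for \<gamma> j
  proof -
    have fin: "finite (insert o' {j \<in> I. fst \<gamma> j \<noteq> \<one>\<^bsub>H\<^esub>})" using fst_wreath[OF \<gamma>] by (simp add: lamps_def)
    have "emeasure m (near \<gamma> j) \<le> emeasure m (\<Union>j\<in>insert o' {j \<in> I. fst \<gamma> j \<noteq> \<one>\<^bsub>H\<^esub>}. near \<gamma> j)"
      by (rule emeasure_mono) (use j ne near[OF \<gamma>] o' fin in \<open>auto intro!: sets.finite_UN\<close>)
    also have "\<dots> \<le> Lp_mass p ?\<Omega> (?b \<gamma>)"
      unfolding mass_D[OF \<gamma>, symmetric] by (rule L(2)) (use \<gamma> in simp_all)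
    finally show ?thesis unfolding near(2)[OF \<gamma> j] .
  qed
  have "Lp_action \<Gamma> p ?\<Omega> ?T ?b" by (rule L(1)) assumption+
  then show ?thesis
    by (intro exI[of _ ?\<Omega>] exI[of _ ?T] exI[of _ ?b] conjI ballI impI space_\<Omega> low)
qed

end

lemma (in permutational_wreath) finite_bounded_lamps:
  assumes J: "finite J" and K: "finite K"
  shows "finite {w \<in> lamps. (\<forall>i\<in>I. w i \<noteq> \<one>\<^bsub>H\<^esub> \<longrightarrow> i \<in> J) \<and> (\<forall>i\<in>I. w i \<in> K)}" (is "finite ?S")
proof (rule finite_imageD)
  show "finite ((\<lambda>w. restrict w (I \<inter> J)) ` ?S)"
  proof (rule finite_subset)
    show "(\<lambda>w. restrict w (I \<inter> J)) ` ?S \<subseteq> (I \<inter> J) \<rightarrow>\<^sub>E K"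
    proof (rule image_subsetI)
      fix w assume "w \<in> ?S"
      then show "restrict w (I \<inter> J) \<in> (I \<inter> J) \<rightarrow>\<^sub>E K" by (simp add: restrict_PiE_iff)
    qed
    show "finite ((I \<inter> J) \<rightarrow>\<^sub>E K)" using J K by (intro finite_PiE) auto
  qed
  show "inj_on (\<lambda>w. restrict w (I \<inter> J)) ?S"
  proof (rule inj_onI)
    fix u v assume u: "u \<in> ?S" and v: "v \<in> ?S" and eq: "restrict u (I \<inter> J) = restrict v (I \<inter> J)"
    show "u = v"
    proof (rule lamps_eqI)
      fix i assume i: "i \<in> I"
      show "u i = v i"
      proof (cases "i \<in> J")
        case True then show ?thesis using fun_cong[OF eq, of i] i by simp
      next
        case False then show ?thesis using u v i by auto
      qed
    qed (use u v in auto)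
  qed
qed

section \<open>Proper kernels and injections into the reals\<close>

text \<open>
  The glued space only has to contain copies of the sample spaces as sets, so a count of cardinalities
  suffices: real numbers are sets of naturals, and a countable family of these is again one.
\<close>

lemma countable_real_functions_inject_reals:
  assumes X: "countable X"
  shows "\<exists>e :: ('x \<Rightarrow> real) \<Rightarrow> real. inj_on e (X \<rightarrow>\<^sub>E UNIV)"
proof -
  obtain f :: "nat set \<Rightarrow> real" where f: "bij f"
    using nat_sets_eqpoll_reals by (auto simp: eqpoll_def)
  define d where "d = inv_into UNIV f"
  have d: "inj d" using f by (simp add: d_def bij_is_surj surj_imp_inj_inv)
  define code where "code y = {prod_encode (to_nat_on X x, n) |x n. x \<in> X \<and> n \<in> d (y x)}" for y :: "'x \<Rightarrow> real"
  have mem: "prod_encode (to_nat_on X x, n) \<in> code y \<longleftrightarrow> n \<in> d (y x)" if "x \<in> X" for x n y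
    using X that by (auto simp: code_def prod_encode_eq)
  have "inj_on code (X \<rightarrow>\<^sub>E UNIV)"
  proof (rule inj_onI)
    fix y z assume y: "y \<in> X \<rightarrow>\<^sub>E (UNIV :: real set)" and z: "z \<in> X \<rightarrow>\<^sub>E UNIV" and eq: "code y = code z"
    show "y = z"
    proof (rule PiE_ext[OF y z])
      fix x assume x: "x \<in> X"
      have "d (y x) = d (z x)" using mem[OF x, of _ y] mem[OF x, of _ z] eq by blast
      then show "y x = z x" using d by (simp add: inj_eq)
    qed
  qed
  then have "inj_on (f \<circ> code) (X \<rightarrow>\<^sub>E UNIV)"
    using f by (intro comp_inj_on) (auto intro: inj_on_subset[OF bij_is_inj])
  then show ?thesis by blast
qed

lemma times_countable_inject_reals:
  assumes e: "inj_on (e :: 'a \<Rightarrow> real) A" and B: "countable B"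
  shows "\<exists>e' :: 'a \<times> 'b \<Rightarrow> real. inj_on e' (A \<times> B)"
proof -
  obtain f :: "(bool \<Rightarrow> real) \<Rightarrow> real" where f: "inj_on f (UNIV \<rightarrow>\<^sub>E UNIV)"
    using countable_real_functions_inject_reals[of "UNIV :: bool set"] by auto
  have "inj_on (\<lambda>(a, b). f (\<lambda>t. if t then e a else real (to_nat_on B b))) (A \<times> B)"
  proof (rule inj_onI, clarify)
    fix a b a' b' assume ab: "a \<in> A" "b \<in> B" "a' \<in> A" "b' \<in> B"
      and eq: "f (\<lambda>t. if t then e a else real (to_nat_on B b)) = f (\<lambda>t. if t then e a' else real (to_nat_on B b'))"
    have "(\<lambda>t. if t then e a else real (to_nat_on B b)) = (\<lambda>t. if t then e a' else real (to_nat_on B b'))"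
      by (rule inj_onD[OF f, OF eq]) auto
    from fun_cong[OF this, of True] fun_cong[OF this, of False]
    show "a = a' \<and> b = b'" using ab B inj_onD[OF e] by auto
  qed
  then show ?thesis by blast
qed

text \<open>
  The orbit map of the origin, \<open>g \<mapsto> \<alpha> g 0\<close>, pulls back the squared distance of the Hilbert space.
\<close>

lemma haagerup_kernel:
  fixes G :: "('g, 'a) monoid_scheme"
  assumes G: "group G" and haag: "haagerup TYPE('v::{real_inner, complete_space}) G"
  shows "\<exists>\<psi>. cond_neg_def_kernel (carrier G) \<psi> \<and>
     (\<forall>k\<in>carrier G. \<forall>g\<in>carrier G. \<forall>h\<in>carrier G. \<psi> (k \<otimes>\<^bsub>G\<^esub> g) (k \<otimes>\<^bsub>G\<^esub> h) = \<psi> g h) \<and>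
     (\<forall>R\<ge>0. finite {g \<in> carrier G. \<psi> g \<one>\<^bsub>G\<^esub> \<le> R})"
proof -
  interpret G: group G by fact
  let ?V = "normed_space_of_type TYPE('v)"
  from haag obtain \<alpha> :: "'g \<Rightarrow> 'v \<Rightarrow> 'v" where
    iso: "isometric_affine_action G ?V \<alpha>" and prp: "proper_action G ?V \<alpha>"
    unfolding haagerup_def by (elim exE conjE)
  note iso_unfolded = iso[unfolded isometric_affine_action_def]
  note iso1 = conjunct1[OF iso_unfolded] and iso2 = conjunct1[OF conjunct2[OF iso_unfolded]]
    and iso3 = conjunct2[OF conjunct2[OF iso_unfolded]]
  have [simp]: "points ?V = UNIV" "vzero ?V = 0" "vadd ?V = (+)" "vscale ?V = (*\<^sub>R)" "vnorm ?V = norm"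
    by (simp_all add: normed_space_of_type_def)
  define b where "b g = \<alpha> g 0" for g
  define \<psi> where "\<psi> g h = (norm (b g - b h))\<^sup>2" for g h
  have one: "b \<one>\<^bsub>G\<^esub> = 0" using iso2 by (simp add: b_def)
  have diff: "norm (\<alpha> k u - \<alpha> k v) = norm (u - v)" if k: "k \<in> carrier G" for k u v
  proof -
    from bspec[OF iso1 k] obtain S c where S: "linear_isometry ?V S" and \<alpha>: "\<forall>v. \<alpha> k v = S v + c"
      by auto
    have add: "S (x + y) = S x + S y" and scale: "S (r *\<^sub>R x) = r *\<^sub>R S x" and norm: "norm (S x) = norm x" for x y r
      using S by (simp_all add: linear_isometry_def)
    have "\<alpha> k u - \<alpha> k v = S u + (-1) *\<^sub>R S v" by (simp add: \<alpha>)
    also have "\<dots> = S (u - v)" using add[of u "(-1) *\<^sub>R v"] scale[of "-1" v] by simp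
    finally show ?thesis by (simp add: norm)
  qed
  have "cond_neg_def_kernel (carrier G) \<psi>"
    unfolding cond_neg_def_kernel_def
  proof (intro conjI ballI allI impI)
    show "\<psi> i i = 0" for i by (simp add: \<psi>_def)
    show "\<psi> i j = \<psi> j i" for i j by (simp add: \<psi>_def norm_minus_commute)
    fix F c assume F: "finite F \<and> F \<subseteq> carrier G \<and> sum c F = (0 :: real)"
    have "(\<Sum>i\<in>F. \<Sum>j\<in>F. c i * c j * \<psi> i j)
      = (\<Sum>i\<in>F. \<Sum>j\<in>F. (c i * (b i \<bullet> b i)) * c j + c i * (c j * (b j \<bullet> b j)) - 2 * ((c i *\<^sub>R b i) \<bullet> (c j *\<^sub>R b j)))"
      by (intro sum.cong refl)
         (simp add: \<psi>_def power2_norm_eq_inner inner_diff_left inner_diff_right inner_commute algebra_simps)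
    also have "\<dots> = (\<Sum>i\<in>F. c i * (b i \<bullet> b i)) * sum c F + sum c F * (\<Sum>j\<in>F. c j * (b j \<bullet> b j))
        - 2 * ((\<Sum>i\<in>F. c i *\<^sub>R b i) \<bullet> (\<Sum>j\<in>F. c j *\<^sub>R b j))"
    proof -
      have "(\<Sum>i\<in>F. c i *\<^sub>R b i) \<bullet> (\<Sum>j\<in>F. c j *\<^sub>R b j) = (\<Sum>i\<in>F. \<Sum>j\<in>F. (c i *\<^sub>R b i) \<bullet> (c j *\<^sub>R b j))"
        by (subst inner_sum_left) (simp only: inner_sum_right)
      then have "(\<Sum>i\<in>F. \<Sum>j\<in>F. 2 * ((c i *\<^sub>R b i) \<bullet> (c j *\<^sub>R b j)))
          = 2 * ((\<Sum>i\<in>F. c i *\<^sub>R b i) \<bullet> (\<Sum>j\<in>F. c j *\<^sub>R b j))"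
        by (simp only: sum_distrib_left)
      then show ?thesis by (simp only: sum.distrib sum_subtractf sum_product)
    qed
    also have "\<dots> \<le> 0" using F by simp
    finally show "(\<Sum>i\<in>F. \<Sum>j\<in>F. c i * c j * \<psi> i j) \<le> 0" .
  qed
  moreover have "\<psi> (k \<otimes>\<^bsub>G\<^esub> g) (k \<otimes>\<^bsub>G\<^esub> h) = \<psi> g h"
    if "k \<in> carrier G" "g \<in> carrier G" "h \<in> carrier G" for k g h
    using iso3 that diff[OF that(1)] by (simp add: \<psi>_def b_def)
  moreover have "finite {g \<in> carrier G. \<psi> g \<one>\<^bsub>G\<^esub> \<le> R}" if R: "R \<ge> 0" for R
  proof (rule finite_subset)
    show "finite {g \<in> carrier G. vnorm ?V (\<alpha> g (vzero ?V)) \<le> sqrt R}"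
      using prp R unfolding proper_action_def by simp
    show "{g \<in> carrier G. \<psi> g \<one>\<^bsub>G\<^esub> \<le> R} \<subseteq> \<dots>"
      by (auto simp: \<psi>_def one intro: real_le_rsqrt) (simp add: b_def real_le_rsqrt)
  qed
  ultimately show ?thesis by (intro exI[of _ \<psi>] conjI ballI allI impI)
qed

section \<open>The wreath product theorem\<close>

lemma sqrt_wall_le:
  assumes "ennreal (sqrt x * wall_const) \<le> ennreal R" "R \<ge> 0"
  shows "x \<le> (R / wall_const)\<^sup>2"
proof (cases "x \<le> 0")
  case True then show ?thesis by (rule order_trans) simp
next
  case False
  have "wall_const > 0" by simp
  moreover have "sqrt x * wall_const \<le> R" using assms by (simp add: ennreal_le_iff)
  ultimately have "sqrt x \<le> R / wall_const" by (simp add: pos_le_divide_eq)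
  then show ?thesis using False by (metis real_sqrt_le_iff' real_sqrt_pow2 power_mono real_sqrt_ge_zero linorder_le_cases)
qed

theorem theorem3:
  fixes G :: "('g, 'a) monoid_scheme" and H :: "('h, 'b) monoid_scheme"
    and L :: "'g set" and p :: real
  assumes "group G" and "countable (carrier G)"
    and "group H" and "countable (carrier H)"
    and "subgroup L G"
    and "p > 1" and "p \<notin> {2 * real_of_int k |k. True} - {2}"
    and "haagerup TYPE('v::{real_inner, complete_space}) G"
    and "co_haagerup L G"
    and "property_PL TYPE('x \<Rightarrow> 'k::{real_normed_field, euclidean_space}) p H"
  shows "property_PL TYPE('x \<times> real \<Rightarrow> 'k) p
           (permutational_wreath_product H (lcosets\<^bsub>G\<^esub> L) G (\<lambda>g i. g <#\<^bsub>G\<^esub> i))"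
proof -
  interpret G: group G by fact
  let ?I = "lcosets\<^bsub>G\<^esub> L" and ?act = "\<lambda>g i. g <#\<^bsub>G\<^esub> i"
  have p: "p \<ge> 1" using \<open>p > 1\<close> by simp
  have L: "L \<subseteq> carrier G" using \<open>subgroup L G\<close> by (rule subgroup.subset)
  have I_sub: "i \<subseteq> carrier G" if "i \<in> ?I" for i
    using that L G.l_coset_subset_G by (auto simp: LCOSETS_def)
  interpret permutational_wreath G H ?I ?act
  proof (rule permutational_wreath.intro)
    show "group G" "group H" "countable (carrier H)" by fact+
    show "g <#\<^bsub>G\<^esub> i \<in> ?I" if "g \<in> carrier G" "i \<in> ?I" for g i
      using that L by (auto simp: LCOSETS_def G.lcos_m_assoc)
    show "\<one>\<^bsub>G\<^esub> <#\<^bsub>G\<^esub> i = i" if "i \<in> ?I" for i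
      using I_sub[OF that] by (rule G.lcos_mult_one)
    show "(g \<otimes>\<^bsub>G\<^esub> h) <#\<^bsub>G\<^esub> i = g <#\<^bsub>G\<^esub> (h <#\<^bsub>G\<^esub> i)" if "g \<in> carrier G" "h \<in> carrier G" "i \<in> ?I" for g h i
      using G.lcos_m_assoc[OF I_sub[OF that(3)] that(1,2)] by simp
    show "countable ?I" using \<open>countable (carrier G)\<close> by (auto simp: LCOSETS_def)
  qed
  have o': "L \<in> ?I"
    using G.lcos_mult_one[OF L] by (auto simp: LCOSETS_def intro!: bexI[of _ "\<one>\<^bsub>G\<^esub>"])
  obtain \<phi> where \<phi>: "cond_neg_def_kernel (carrier G) \<phi>"
    and \<phi>_inv: "\<forall>k\<in>carrier G. \<forall>g\<in>carrier G. \<forall>h\<in>carrier G. \<phi> (k \<otimes>\<^bsub>G\<^esub> g) (k \<otimes>\<^bsub>G\<^esub> h) = \<phi> g h"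
    and \<phi>_proper: "\<forall>R\<ge>0. finite {g \<in> carrier G. \<phi> g \<one>\<^bsub>G\<^esub> \<le> R}"
    using haagerup_kernel[OF \<open>group G\<close> \<open>haagerup TYPE('v) G\<close>] by (elim exE conjE)
  obtain \<psi> where \<psi>: "cond_neg_def_kernel ?I \<psi>" and \<psi>_proper: "proper_kernel ?I \<psi>"
    and \<psi>_inv: "\<forall>g\<in>carrier G. \<forall>i\<in>?I. \<forall>j\<in>?I. \<psi> (g <#\<^bsub>G\<^esub> i) (g <#\<^bsub>G\<^esub> j) = \<psi> i j"
    using \<open>co_haagerup L G\<close> unfolding co_haagerup_def by (elim exE conjE)
  obtain M :: "'x measure" and T :: "'h \<Rightarrow> ('x \<Rightarrow> 'k) \<Rightarrow> 'x \<Rightarrow> 'k" and b where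
    M: "Lp_action H p M T b" and M_proper: "\<And>R. R \<ge> 0 \<Longrightarrow> finite {h \<in> carrier H. Lp_mass p M (b h) \<le> ennreal R}"
    using Lp_action_of_property_PL[OF p \<open>group H\<close> \<open>property_PL TYPE('x \<Rightarrow> 'k) p H\<close>] by blast
  obtain m1 :: "('g \<Rightarrow> real) measure" and T1 and b1 :: "_ \<Rightarrow> _ \<Rightarrow> 'k" where
    space1: "space m1 = (carrier G \<rightarrow>\<^sub>E UNIV)" and A1: "Lp_action \<Gamma> p m1 T1 b1"
    and low1: "\<forall>\<gamma>\<in>carrier \<Gamma>. ennreal (sqrt (\<phi> \<one>\<^bsub>G\<^esub> (snd (inv\<^bsub>\<Gamma>\<^esub> \<gamma>) \<otimes>\<^bsub>G\<^esub> \<one>\<^bsub>G\<^esub>)) * wall_const) \<le> Lp_mass p m1 (b1 \<gamma>)"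
  proof -
    have "\<exists>(m :: ('g \<Rightarrow> real) measure) T (b :: _ \<Rightarrow> _ \<Rightarrow> 'k).
     space m = (carrier G \<rightarrow>\<^sub>E UNIV) \<and> Lp_action \<Gamma> p m T b \<and>
     (\<forall>\<gamma>\<in>carrier \<Gamma>. ennreal (sqrt (\<phi> \<one>\<^bsub>G\<^esub> (snd (inv\<^bsub>\<Gamma>\<^esub> \<gamma>) \<otimes>\<^bsub>G\<^esub> \<one>\<^bsub>G\<^esub>)) * wall_const) \<le> Lp_mass p m (b \<gamma>))"
      by (rule Lp_action_gaussian_walls[where act = "\<lambda>\<gamma> x. snd \<gamma> \<otimes>\<^bsub>G\<^esub> x"])
         (use p \<phi> \<phi>_inv \<open>countable (carrier G)\<close> snd_wreath in
           \<open>auto simp: wreath.group_axioms one_wreath mult_wreath G.m_assoc\<close>)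
    then show thesis using that by blast
  qed
  obtain m3 :: "(('g set \<Rightarrow> real) \<times> ('g set \<Rightarrow> 'h)) measure" and T3 and b3 :: "_ \<Rightarrow> _ \<Rightarrow> 'k" where
    space3: "space m3 = (?I \<rightarrow>\<^sub>E UNIV) \<times> lamps" and A3: "Lp_action \<Gamma> p m3 T3 b3"
    and low3: "\<forall>\<gamma>\<in>carrier \<Gamma>. \<forall>j\<in>?I. fst \<gamma> j \<noteq> \<one>\<^bsub>H\<^esub> \<longrightarrow>
        ennreal (sqrt (\<psi> L (?act (inv\<^bsub>G\<^esub> (snd \<gamma>)) j)) * wall_const) \<le> Lp_mass p m3 (b3 \<gamma>)"
    using Lp_action_wreath_walls[OF p \<psi> o' \<psi>_inv[rule_format], where 'k = 'k] by blast
  have w_mult: "fst (\<gamma> \<otimes>\<^bsub>\<Gamma>\<^esub> \<delta>) i = fst \<gamma> i \<otimes>\<^bsub>H\<^esub> fst \<delta> (?act (snd (inv\<^bsub>\<Gamma>\<^esub> \<gamma>)) i)"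
    if "\<gamma> \<in> carrier \<Gamma>" "\<delta> \<in> carrier \<Gamma>" "i \<in> ?I" for \<gamma> \<delta> i
    using that by (simp add: mult_wreath snd_inv_wreath)
  have w_fin: "finite {i \<in> ?I. fst \<gamma> i \<noteq> \<one>\<^bsub>H\<^esub>}" if "\<gamma> \<in> carrier \<Gamma>" for \<gamma>
    using fst_wreath[OF that] by (simp add: lamps_def)
  obtain T2 and b2 :: "_ \<Rightarrow> 'x \<times> 'g set \<Rightarrow> 'k" where A2: "Lp_action \<Gamma> p (M \<Otimes>\<^sub>M count_space ?I) T2 b2"
    and low2: "\<And>\<gamma> i. \<gamma> \<in> carrier \<Gamma> \<Longrightarrow> i \<in> ?I \<Longrightarrow> Lp_mass p M (b (fst \<gamma> i)) \<le> Lp_mass p (M \<Otimes>\<^sub>M count_space ?I) (b2 \<gamma>)"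
  proof -
    have 1: "?act (snd \<gamma>) i \<in> ?I" if "\<gamma> \<in> carrier \<Gamma>" "i \<in> ?I" for \<gamma> i
      using that act_closed snd_wreath by blast
    have 2: "?act (snd \<one>\<^bsub>\<Gamma>\<^esub>) i = i" "fst \<one>\<^bsub>\<Gamma>\<^esub> i = \<one>\<^bsub>H\<^esub>" if "i \<in> ?I" for i
      using that by (simp_all add: one_wreath act_one)
    have 3: "?act (snd (\<gamma> \<otimes>\<^bsub>\<Gamma>\<^esub> \<delta>)) i = ?act (snd \<gamma>) (?act (snd \<delta>) i)"
      if "\<gamma> \<in> carrier \<Gamma>" "\<delta> \<in> carrier \<Gamma>" "i \<in> ?I" for \<gamma> \<delta> i
      using that snd_wreath act_mult by (simp add: mult_wreath)
    have 4: "fst \<gamma> i \<in> carrier H" if "\<gamma> \<in> carrier \<Gamma>" "i \<in> ?I" for \<gamma> i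
      using lamps_carrier[OF fst_wreath[OF that(1)] that(2)] .
    note C = Lp_action_coordinatewise[where w = fst and act = "\<lambda>\<gamma>. ?act (snd \<gamma>)",
        OF M wreath.group_axioms \<open>group H\<close> countable_I 1 2(1) 3 4 2(2) w_mult w_fin]
    show thesis by (rule that[OF C(1) C(2)])
  qed
  obtain e1 :: "('g \<Rightarrow> real) \<Rightarrow> real" where e1: "inj_on e1 (space m1)"
    using countable_real_functions_inject_reals[OF \<open>countable (carrier G)\<close>] unfolding space1 by blast
  obtain e3 :: "('g set \<Rightarrow> real) \<times> ('g set \<Rightarrow> 'h) \<Rightarrow> real" where e3: "inj_on e3 (space m3)"
    using countable_real_functions_inject_reals[OF countable_I] times_countable_inject_reals[OF _ countable_lamps]
    unfolding space3 by blast
  \<comment> \<open>The sign of the real coordinate separates the copy of a probabilistic sample space, placed over a single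
      point of \<open>'x\<close>, from the copies of \<open>M\<close>. The second gluing starts from all of \<open>'x \<times> real\<close>, which the
      exponential function first compresses to the positive half.\<close>
  let ?\<iota>1 = "\<lambda>z. (undefined :: 'x, - exp (e1 z))" and ?\<iota>2 = "\<lambda>(x, i). (x, exp (real (to_nat_on ?I i)))"
  let ?\<kappa>1 = "\<lambda>(x :: 'x, r). (x, exp r)" and ?\<kappa>2 = "\<lambda>z. (undefined :: 'x, - exp (e3 z))"
  have exp_sign: "- exp (r :: real) \<noteq> exp s" "exp s \<noteq> - exp r" for r s
    using exp_gt_zero[of r] exp_gt_zero[of s] by linarith+
  have 1: "inj_on ?\<iota>1 (space m1)" "inj_on ?\<iota>2 (space (M \<Otimes>\<^sub>M count_space ?I))"
      "?\<iota>1 ` space m1 \<inter> ?\<iota>2 ` space (M \<Otimes>\<^sub>M count_space ?I) = {}"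
    using e1 countable_I by (auto simp: inj_on_def space_pair_measure exp_sign)
  note A12 = Lp_action_glue[OF 1 A1 A2 wreath.group_axioms p]
  let ?N = "glue_measure ?\<iota>1 m1 ?\<iota>2 (M \<Otimes>\<^sub>M count_space ?I)"
  have 2: "inj_on ?\<kappa>1 (space ?N)" "inj_on ?\<kappa>2 (space m3)" "?\<kappa>1 ` space ?N \<inter> ?\<kappa>2 ` space m3 = {}"
    using e3 by (auto simp: inj_on_def exp_sign)
  note A123 = Lp_action_glue[OF 2 A12(1) A3 wreath.group_axioms p]
  show ?thesis
  proof (rule property_PL_of_Lp_action[OF p wreath.group_axioms A123(1)])
    fix R :: real assume R: "R \<ge> 0"
    \<comment> \<open>A mass of at most \<open>R\<close> forces the kernels to be at most \<open>R'\<close>. The bound on the support of \<open>w\<close> depends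
        on \<open>g\<close>, and \<open>g\<close> ranges over the finite set \<open>F\<close>.\<close>
    define R' where "R' = (R / wall_const)\<^sup>2"
    define F where "F = {g \<in> carrier G. \<phi> g \<one>\<^bsub>G\<^esub> \<le> R'}"
    define J where "J g = {j \<in> ?I. \<psi> j (?act g L) \<le> R'}" for g
    define K where "K = {h \<in> carrier H. Lp_mass p M (b h) \<le> ennreal R}"
    have "finite F" using \<phi>_proper by (simp add: F_def R'_def)
    moreover have "finite (J g)" if "g \<in> F" for g
      using \<psi>_proper that act_closed[OF _ o'] by (simp add: J_def F_def R'_def proper_kernel_def)
    moreover have "finite K" using M_proper[OF R] by (simp add: K_def)
    ultimately have "finite (\<Union>g\<in>F. {w \<in> lamps. (\<forall>i\<in>?I. w i \<noteq> \<one>\<^bsub>H\<^esub> \<longrightarrow> i \<in> J g) \<and> (\<forall>i\<in>?I. w i \<in> K)} \<times> {g})"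
      by (intro finite_UN_I finite_cartesian_product finite_bounded_lamps) auto
    then show "finite {\<gamma> \<in> carrier \<Gamma>. Lp_mass p (glue_measure ?\<kappa>1 ?N ?\<kappa>2 m3)
        (glue_fun ?\<kappa>1 ?N ?\<kappa>2 m3 (glue_fun ?\<iota>1 m1 ?\<iota>2 (M \<Otimes>\<^sub>M count_space ?I) (b1 \<gamma>) (b2 \<gamma>)) (b3 \<gamma>)) \<le> ennreal R}"
    proof (rule rev_finite_subset, safe)
      fix w :: "'g set \<Rightarrow> 'h" and g :: 'g
      let ?\<gamma> = "(w, g)"
      assume \<gamma>: "?\<gamma> \<in> carrier \<Gamma>" and le: "Lp_mass p (glue_measure ?\<kappa>1 ?N ?\<kappa>2 m3)
        (glue_fun ?\<kappa>1 ?N ?\<kappa>2 m3 (glue_fun ?\<iota>1 m1 ?\<iota>2 (M \<Otimes>\<^sub>M count_space ?I) (b1 ?\<gamma>) (b2 ?\<gamma>)) (b3 ?\<gamma>)) \<le> ennreal R"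
      have g: "g \<in> carrier G" and w: "w \<in> lamps" using \<gamma> by (auto simp: carrier_wreath)
      have sum: "Lp_mass p m1 (b1 ?\<gamma>) + Lp_mass p (M \<Otimes>\<^sub>M count_space ?I) (b2 ?\<gamma>) + Lp_mass p m3 (b3 ?\<gamma>) \<le> ennreal R"
        using le by (simp only: A123(2)[OF \<gamma>] A12(2)[OF \<gamma>])
      have le1: "Lp_mass p m1 (b1 ?\<gamma>) \<le> ennreal R" and le2: "Lp_mass p (M \<Otimes>\<^sub>M count_space ?I) (b2 ?\<gamma>) \<le> ennreal R"
        and le3: "Lp_mass p m3 (b3 ?\<gamma>) \<le> ennreal R"
        using sum by (auto elim!: order_trans[rotated] intro: add_increasing add_increasing2)
      have "\<phi> g \<one>\<^bsub>G\<^esub> = \<phi> \<one>\<^bsub>G\<^esub> (snd (inv\<^bsub>\<Gamma>\<^esub> ?\<gamma>) \<otimes>\<^bsub>G\<^esub> \<one>\<^bsub>G\<^esub>)"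
        using \<phi>_inv[rule_format, of "inv\<^bsub>G\<^esub> g" g "\<one>\<^bsub>G\<^esub>"] g by (simp add: snd_inv_wreath[OF \<gamma>])
      also have "\<dots> \<le> R'"
        unfolding R'_def by (rule sqrt_wall_le[OF order_trans[OF low1[rule_format, OF \<gamma>] le1] R])
      finally have gF: "g \<in> F" using g by (simp add: F_def)
      have "j \<in> J g" if j: "j \<in> ?I" and ne: "w j \<noteq> \<one>\<^bsub>H\<^esub>" for j
      proof -
        have ij: "?act (inv\<^bsub>G\<^esub> g) j \<in> ?I" using act_closed j g by simp
        have "\<psi> L (?act (inv\<^bsub>G\<^esub> g) j) \<le> R'"
          unfolding R'_def by (rule sqrt_wall_le[OF order_trans[OF _ le3] R]) (use low3 \<gamma> j ne in auto)
        moreover have "\<psi> (?act g L) (?act g (?act (inv\<^bsub>G\<^esub> g) j)) = \<psi> L (?act (inv\<^bsub>G\<^esub> g) j)"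
          using \<psi>_inv g o' ij by blast
        moreover have "\<psi> (?act g L) j = \<psi> j (?act g L)"
          using \<psi> act_closed[OF g o'] j by (simp add: cond_neg_def_kernel_def)
        ultimately show ?thesis using j by (simp add: J_def act_inv_cancel(1)[OF g j])
      qed
      moreover have "w i \<in> K" if i: "i \<in> ?I" for i
        using order_trans[OF low2[OF \<gamma> i] le2] lamps_carrier[OF w i] by (simp add: K_def)
      ultimately show "?\<gamma> \<in> (\<Union>g\<in>F. {w \<in> lamps. (\<forall>i\<in>?I. w i \<noteq> \<one>\<^bsub>H\<^esub> \<longrightarrow> i \<in> J g) \<and> (\<forall>i\<in>?I. w i \<in> K)} \<times> {g})"
        using gF w by auto
    qed
  qed
qed

end
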